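(* Let $\mathbb{M}$ be a complex surface and let $\Sigma\subset\mathbb{M}$ be an embedded real surface with a single complex point $\gamma\in\Sigma$, which is hyperbolic. Then the surface $\tilde\Sigma=\Sigma\#\mathbb{R}P^2$ given by removing a neighbourhood of $\gamma$ in $\Sigma$ and joining a cross-cap in $\mathbb{M}$ along the resulting boundary circle can be smoothed so that $\tilde\Sigma$ is totally real and embedded in $\mathbb{M}$.
   Context: A complex surface is a complex manifold of complex dimension 2, with complex structure $\mathbb{J}$; a real surface in it is a submanifold of real dimension 2. A point $\gamma\in\Sigma$ is complex if $\mathbb{J}(T_\gamma\Sigma)=T_\gamma\Sigma$. A real surface is totally real if it has no complex points. If $\gamma$ is an isolated complex point of $\Sigma$, choose local holomorphic coordinates $(\xi,\eta)$ on $\mathbb{M}$ in which $\Sigma$ is, near $\gamma$, a graph $\eta=F(\xi,\bar\xi)$ with $\gamma$ over $\xi=0$. The complex points of the graph are the zeros of $\partial F/\partial\bar\xi$, and the index $I(\gamma)\in\mathbb{Z}$ is the winding number about $0$ of $\partial F/\partial\bar\xi$ along a small positively oriented circle around $\xi=0$. An isolated complex point is hyperbolic if its index is equal to $-1$. A cross-cap is a copy of the real projective plane $\mathbb{R}P^2$ with an open disc removed (equivalently, an annulus with one boundary curve antipodally identified). The connected sum $\Sigma\#\mathbb{R}P^2$ is obtained by removing discs from $\Sigma$ and $\mathbb{R}P^2$ and identifying the boundary circles. *)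

theory Defs
  imports "HOL-Complex_Analysis.Winding_Numbers"
begin

section \<open>Smooth and holomorphic maps\<close>

text \<open>Class \<open>C\<^sup>n\<close> on an open set \<open>S\<close>, by recursion over directional derivatives.\<close>

primrec Ck_on ::
  "nat \<Rightarrow> ('a::real_normed_vector \<Rightarrow> 'b::real_normed_vector) \<Rightarrow> 'a set \<Rightarrow> bool" where
  "Ck_on 0 f S \<longleftrightarrow> continuous_on S f"
| "Ck_on (Suc n) f S \<longleftrightarrow>
     (\<forall>x\<in>S. f differentiable (at x)) \<and> (\<forall>v. Ck_on n (\<lambda>x. frechet_derivative f (at x) v) S)"

definition smooth_on ::
  "('a::real_normed_vector \<Rightarrow> 'b::real_normed_vector) \<Rightarrow> 'a set \<Rightarrow> bool" where
  "smooth_on f S \<longleftrightarrow> (\<forall>n. Ck_on n f S)"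

definition complex_structure :: "complex \<times> complex \<Rightarrow> complex \<times> complex" where
  "complex_structure v = (\<i> * fst v, \<i> * snd v)"

text \<open>Holomorphic maps between open subsets of \<open>\<complex>\<^sup>2\<close>: differentiable, with complex linear
  differential.\<close>

definition holomorphic2_on :: "(complex \<times> complex \<Rightarrow> complex \<times> complex) \<Rightarrow> (complex \<times> complex) set \<Rightarrow> bool" where
  "holomorphic2_on f S \<longleftrightarrow>
     (\<forall>z\<in>S. \<exists>f'. (f has_derivative f') (at z) \<and>
        (\<forall>v. f' (complex_structure v) = complex_structure (f' v)))"

definition dbar :: "(complex \<Rightarrow> complex) \<Rightarrow> complex \<Rightarrow> complex" where
  "dbar F z = (frechet_derivative F (at z) 1 + \<i> * frechet_derivative F (at z) \<i>) / 2"


section \<open>Complex surfaces\<close>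

text \<open>A chart is a pair of its domain and its coordinate map; the values of the coordinate map
  outside the domain are irrelevant.\<close>

type_synonym 'a chart = "'a set \<times> ('a \<Rightarrow> complex \<times> complex)"

definition is_chart :: "'a topology \<Rightarrow> 'a chart \<Rightarrow> bool" where
  "is_chart X c \<longleftrightarrow> (case c of (U, \<phi>) \<Rightarrow>
     openin X U \<and> open (\<phi> ` U) \<and>
     homeomorphic_map (subtopology X U) (top_of_set (\<phi> ` U)) \<phi>)"

definition holomorphic_transition :: "'a chart \<Rightarrow> 'a chart \<Rightarrow> bool" where
  "holomorphic_transition c d \<longleftrightarrow> (case c of (U, \<phi>) \<Rightarrow> case d of (V, \<psi>) \<Rightarrow>
     holomorphic2_on (\<psi> \<circ> inv_into U \<phi>) (\<phi> ` (U \<inter> V)))"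

definition complex_surface :: "'a topology \<Rightarrow> 'a chart set \<Rightarrow> bool" where
  "complex_surface X A \<longleftrightarrow>
     Hausdorff_space X \<and> second_countable X \<and>
     (\<forall>c\<in>A. is_chart X c) \<and> (\<Union>c\<in>A. fst c) = topspace X \<and>
     (\<forall>c\<in>A. \<forall>d\<in>A. holomorphic_transition c d)"

text \<open>Arbitrary local holomorphic coordinates, i.e. the charts of the maximal atlas
  generated by \<open>A\<close>.\<close>

definition holomorphic_chart :: "'a topology \<Rightarrow> 'a chart set \<Rightarrow> 'a chart \<Rightarrow> bool" where
  "holomorphic_chart X A c \<longleftrightarrow>
     is_chart X c \<and> (\<forall>d\<in>A. holomorphic_transition c d \<and> holomorphic_transition d c)"


section \<open>Embedded real surfaces and complex points\<close>

text \<open>A local parametrization of \<open>S\<close>: a smooth immersion of an open set \<open>V\<close> of the plane (written as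
  \<open>\<complex>\<close>, only its real structure being used) that is a homeomorphism onto a relatively open
  subset of \<open>S\<close>.\<close>

definition surface_parametrization ::
  "'a topology \<Rightarrow> 'a chart set \<Rightarrow> 'a set \<Rightarrow> complex set \<Rightarrow> (complex \<Rightarrow> 'a) \<Rightarrow> bool" where
  "surface_parametrization X A S V \<psi> \<longleftrightarrow>
     open V \<and> \<psi> ` V \<subseteq> S \<and> openin (subtopology X S) (\<psi> ` V) \<and>
     homeomorphic_map (top_of_set V) (subtopology X (\<psi> ` V)) \<psi> \<and>
     (\<forall>(U, \<phi>)\<in>A. smooth_on (\<phi> \<circ> \<psi>) (V \<inter> \<psi> -` U) \<and>
        (\<forall>x\<in>V \<inter> \<psi> -` U. inj (frechet_derivative (\<phi> \<circ> \<psi>) (at x))))"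

definition embedded_real_surface :: "'a topology \<Rightarrow> 'a chart set \<Rightarrow> 'a set \<Rightarrow> bool" where
  "embedded_real_surface X A S \<longleftrightarrow>
     S \<subseteq> topspace X \<and>
     (\<forall>p\<in>S. \<exists>V \<psi>. surface_parametrization X A S V \<psi> \<and> p \<in> \<psi> ` V)"

text \<open>The tangent space of \<open>S\<close> at \<open>p\<close>, read in the chart \<open>(U, \<phi>)\<close>: the velocities of smooth
  curves in \<open>S\<close> through \<open>p\<close>.\<close>

definition tangent_space_in ::
  "'a chart \<Rightarrow> 'a set \<Rightarrow> 'a \<Rightarrow> (complex \<times> complex) set" where
  "tangent_space_in c S p = (case c of (U, \<phi>) \<Rightarrow>
     {v. \<exists>e>0. \<exists>g :: real \<Rightarrow> complex \<times> complex.
           smooth_on g {-e<..<e} \<and> g ` {-e<..<e} \<subseteq> \<phi> ` (S \<inter> U) \<and> g 0 = \<phi> p \<and>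
           (g has_vector_derivative v) (at 0)})"

text \<open>Since transition maps are holomorphic, the condition below does not depend on the chart.\<close>

definition complex_point :: "'a topology \<Rightarrow> 'a chart set \<Rightarrow> 'a set \<Rightarrow> 'a \<Rightarrow> bool" where
  "complex_point X A S p \<longleftrightarrow>
     p \<in> S \<and>
     (\<exists>c\<in>A. p \<in> fst c \<and> complex_structure ` tangent_space_in c S p = tangent_space_in c S p)"

definition totally_real :: "'a topology \<Rightarrow> 'a chart set \<Rightarrow> 'a set \<Rightarrow> bool" where
  "totally_real X A S \<longleftrightarrow> (\<nexists>p. complex_point X A S p)"

definition isolated_complex_point :: "'a topology \<Rightarrow> 'a chart set \<Rightarrow> 'a set \<Rightarrow> 'a \<Rightarrow> bool" where
  "isolated_complex_point X A S p \<longleftrightarrow>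
     complex_point X A S p \<and>
     (\<exists>W. openin X W \<and> p \<in> W \<and> (\<forall>q\<in>W. complex_point X A S q \<longrightarrow> q = p))"

text \<open>The index is a relation rather than a function, so that no independence of the chosen
  coordinates is built into the definition.\<close>

definition complex_point_has_index ::
  "'a topology \<Rightarrow> 'a chart set \<Rightarrow> 'a set \<Rightarrow> 'a \<Rightarrow> int \<Rightarrow> bool" where
  "complex_point_has_index X A S p n \<longleftrightarrow>
     (\<exists>U \<phi> W r F.
        holomorphic_chart X A (U, \<phi>) \<and>
        openin X W \<and> p \<in> W \<and> W \<subseteq> U \<and> fst (\<phi> p) = 0 \<and>
        r > 0 \<and> smooth_on F (ball 0 r) \<and>
        \<phi> ` (S \<inter> W) = (\<lambda>\<xi>. (\<xi>, F \<xi>)) ` ball 0 r \<and>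
        (\<forall>\<xi>\<in>ball 0 r - {0}. dbar F \<xi> \<noteq> 0) \<and>
        (\<forall>\<^sub>F \<rho> in at_right 0. winding_number (dbar F \<circ> circlepath 0 \<rho>) 0 = of_int n))"

definition hyperbolic_complex_point :: "'a topology \<Rightarrow> 'a chart set \<Rightarrow> 'a set \<Rightarrow> 'a \<Rightarrow> bool" where
  "hyperbolic_complex_point X A S p \<longleftrightarrow>
     isolated_complex_point X A S p \<and> complex_point_has_index X A S p (-1)"


section \<open>Cross-caps and connected sum with the projective plane\<close>

text \<open>The quotient of the unit sphere by the antipodal map; its points are the pairs \<open>{x, -x}\<close>.\<close>

definition antipodal_class :: "real^3 \<Rightarrow> (real^3) set" where
  "antipodal_class x = {x, - x}"

definition real_projective_plane :: "(real^3) set topology" where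
  "real_projective_plane = topology (\<lambda>U.
     U \<subseteq> antipodal_class ` sphere 0 1 \<and>
     openin (top_of_set (sphere 0 1)) {x \<in> sphere 0 1. antipodal_class x \<in> U})"

lemma openin_real_projective_plane:
  "openin real_projective_plane U \<longleftrightarrow>
     U \<subseteq> antipodal_class ` sphere 0 1 \<and>
     openin (top_of_set (sphere 0 1)) {x \<in> sphere 0 1. antipodal_class x \<in> U}"
proof -
  let ?P = "\<lambda>U. U \<subseteq> antipodal_class ` sphere 0 1 \<and>
     openin (top_of_set (sphere 0 1)) {x \<in> sphere 0 1. antipodal_class x \<in> U}"
  have "istopology ?P"
    unfolding istopology_def
  proof (intro conjI allI impI)
    fix S T assume S: "?P S" and T: "?P T"
    show "S \<inter> T \<subseteq> antipodal_class ` sphere 0 1" using S by blast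
    have "{x \<in> sphere 0 1. antipodal_class x \<in> S \<inter> T} =
        {x \<in> sphere 0 1. antipodal_class x \<in> S} \<inter> {x \<in> sphere 0 1. antipodal_class x \<in> T}"
      by blast
    then show "openin (top_of_set (sphere 0 1)) {x \<in> sphere 0 1. antipodal_class x \<in> S \<inter> T}"
      using S T by (simp only: openin_Int)
  next
    fix K assume K: "\<forall>S\<in>K. ?P S"
    show "\<Union>K \<subseteq> antipodal_class ` sphere 0 1" using K by blast
    have "{x \<in> sphere 0 1. antipodal_class x \<in> \<Union>K} =
        (\<Union>S\<in>K. {x \<in> sphere 0 1. antipodal_class x \<in> S})"
      by blast
    moreover have "openin (top_of_set (sphere 0 1))
        (\<Union>S\<in>K. {x \<in> sphere 0 1. antipodal_class x \<in> S})"
      by (rule openin_Union) (use K in blast)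
    ultimately show "openin (top_of_set (sphere 0 1)) {x \<in> sphere 0 1. antipodal_class x \<in> \<Union>K}"
      by (simp only:)
  qed
  then show ?thesis
    unfolding real_projective_plane_def by (simp only: topology_inverse')
qed

lemma topspace_real_projective_plane:
  "topspace real_projective_plane = antipodal_class ` sphere 0 1"
proof
  show "topspace real_projective_plane \<subseteq> antipodal_class ` sphere 0 1"
    using openin_topspace[of real_projective_plane]
    unfolding openin_real_projective_plane by blast
  have "{x \<in> sphere 0 1. antipodal_class x \<in> antipodal_class ` sphere 0 1} = sphere 0 1"
    by blast
  then have "openin real_projective_plane (antipodal_class ` sphere 0 1)"
    unfolding openin_real_projective_plane by simp
  then show "antipodal_class ` sphere 0 1 \<subseteq> topspace real_projective_plane"
    by (rule openin_subset)
qed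

text \<open>The removed open disc is the image of the open polar cap \<open>x\<^sub>3 > 1/2\<close>, which the quotient map
  embeds.\<close>

definition standard_cross_cap :: "(real^3) set set" where
  "standard_cross_cap =
     topspace real_projective_plane - antipodal_class ` {x \<in> sphere 0 1. x $ 3 > 1/2}"

definition standard_cross_cap_boundary :: "(real^3) set set" where
  "standard_cross_cap_boundary = antipodal_class ` {x \<in> sphere 0 1. x $ 3 = 1/2}"

definition cross_cap :: "'a topology \<Rightarrow> 'a set \<Rightarrow> 'a set \<Rightarrow> bool" where
  "cross_cap X C K \<longleftrightarrow>
     C \<subseteq> topspace X \<and>
     (\<exists>h. homeomorphic_map (subtopology real_projective_plane standard_cross_cap)
            (subtopology X C) h \<and>
          h ` standard_cross_cap_boundary = K)"

text \<open>\<open>S'\<close> arises from \<open>S\<close> by removing an open disc around \<open>p\<close>, the interior of a smoothly embedded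
  closed disc in \<open>S\<close>, and joining a cross-cap in \<open>X\<close> that meets the remainder of \<open>S\<close> exactly in
  the common boundary circle.\<close>

definition cross_cap_surgery ::
  "'a topology \<Rightarrow> 'a chart set \<Rightarrow> 'a set \<Rightarrow> 'a \<Rightarrow> 'a set \<Rightarrow> bool" where
  "cross_cap_surgery X A S p S' \<longleftrightarrow>
     (\<exists>V \<psi> C.
        surface_parametrization X A S V \<psi> \<and> cball 0 1 \<subseteq> V \<and> p \<in> \<psi> ` ball 0 1 \<and>
        cross_cap X C (\<psi> ` sphere 0 1) \<and>
        C \<inter> (S - \<psi> ` ball 0 1) = \<psi> ` sphere 0 1 \<and>
        S' = (S - \<psi> ` ball 0 1) \<union> C)"

end

theory Submission
  imports Defs "HOL-Complex_Analysis.Cauchy_Integral_Formula"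
begin

text \<open>
  In the given coordinates the surface is, near \<open>\<gamma>\<close>, a graph \<open>\<eta> = F(\<xi>)\<close>, and a graph is totally real
  exactly where \<open>dbar F \<noteq> 0\<close>. Write \<open>\<xi> = s u\<close> with \<open>|u| = 1\<close> and let \<open>s\<close> be negative as well, so that
  \<open>(s, u)\<close> and \<open>(-s, -u)\<close> name the same point. The band \<open>|s| \<le> R\<close> modulo this identification is a
  Moebius band, that is, a cross-cap. An even function \<open>G(s, u)\<close> maps it to \<open>\<complex>\<^sup>2\<close> by
  \<open>(s, u) \<mapsto> (s u, G(s, u))\<close>; away from \<open>s = 0\<close> the image is an ordinary graph over the punctured disc, and
  over \<open>\<xi> = 0\<close> lies the image of the core circle. With \<open>G = F(0) + \<epsilon> u\<^sup>-\<^sup>2\<close> near the core this is an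
  embedding. The crucial observation is that the band is totally real where \<open>s G\<^sub>s + i G\<^sub>\<theta> \<noteq> 0\<close>, a
  condition that makes sense at \<open>s = 0\<close> too. For a graph this expression is \<open>2 cnj \<xi> dbar F\<close>, with winding
  number the index minus one; for the core it is \<open>2 \<epsilon> u\<^sup>-\<^sup>2\<close>, with winding number \<open>-2\<close>. The two agree
  exactly when the index is \<open>-1\<close>.

  Hence \<open>F\<close> has to be changed to \<open>F(0) + \<epsilon> cnj \<xi>/\<xi>\<close> near \<open>0\<close> while \<open>dbar F\<close> stays nonzero. Equality of the
  winding numbers provides a homotopy of nonvanishing functions between the two derivatives
  (\<open>smooth_log_punctured_disc\<close>), and one step of convex integration turns it into an honest function:
  a rapid oscillation in \<open>ln |\<xi>|\<close> of small amplitude moves the derivative of a naive interpolation off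
  zero (\<open>hyperbolic_modification\<close>). The amplitude can be made so small that nothing leaves a given
  neighbourhood of \<open>\<gamma>\<close>, where no other part of the surface is met.

  The rest transfers this picture to the complex surface. Changes of holomorphic coordinates are
  smooth with invertible complex linear differential, which is where the smoothness of holomorphic maps of
  two variables enters (\<open>holomorphic2_imp_smooth_on\<close>); therefore pieces parametrized in one chart are
  embedded and totally real in every chart (\<open>coordinate_piece\<close>). The band \<open>|x\<^sub>3| \<le> 1/2\<close> of the sphere, with
  \<open>2 R x\<^sub>3\<close> as signed radius and the longitude as direction, identifies the standard cross-cap with the
  Moebius band (\<open>cross_cap_from_even_map\<close>). Outside the removed disc the surface is unchanged, and both
  embeddedness and complex points are local.
\<close>

section \<open>Calculus of smooth maps\<close>

lemma frechet_derivative_eq: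
  "(f has_derivative f') (at x) \<Longrightarrow> frechet_derivative f (at x) = f'"
  using frechet_derivative_at by metis

lemma Ck_on_mono_set: "Ck_on n f S \<Longrightarrow> T \<subseteq> S \<Longrightarrow> Ck_on n f T"
  by (induction n arbitrary: f) (auto intro: continuous_on_subset)

lemma Ck_on_lower: "Ck_on (Suc n) f S \<Longrightarrow> Ck_on n f S"
proof (induction n arbitrary: f)
  case 0
  then show ?case
    by (auto intro!: continuous_at_imp_continuous_on differentiable_imp_continuous_within)
next
  case (Suc n)
  then show ?case by (metis Ck_on.simps(2))
qed

lemma Ck_on_cong_open:
  assumes "open S" "\<And>x. x \<in> S \<Longrightarrow> f x = g x" "Ck_on n f S"
  shows "Ck_on n g S"
  using assms(2,3)
proof (induction n arbitrary: f g)
  case 0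
  then show ?case by (metis Ck_on.simps(1) continuous_on_cong)
next
  case (Suc n)
  have der: "(g has_derivative frechet_derivative f (at x)) (at x)" if "x \<in> S" for x
    using Suc.prems that assms(1)
    by (metis Ck_on.simps(2) frechet_derivative_works has_derivative_transform_within_open)
  then have "Ck_on n (\<lambda>x. frechet_derivative g (at x) v) S" for v
    using Suc.IH[of "\<lambda>x. frechet_derivative f (at x) v" "\<lambda>x. frechet_derivative g (at x) v"]
      Suc.prems frechet_derivative_eq by force
  with der show ?case
    by (auto simp: differentiable_def)
qed

lemma Ck_on_SucI:
  assumes "open S" "\<And>x. x \<in> S \<Longrightarrow> (f has_derivative f' x) (at x)"
    "\<And>v. Ck_on n (\<lambda>x. f' x v) S"
  shows "Ck_on (Suc n) f S"
proof -
  have "Ck_on n (\<lambda>x. frechet_derivative f (at x) v) S" for v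
    by (rule Ck_on_cong_open[OF assms(1) _ assms(3)[of v]])
      (simp add: frechet_derivative_eq[OF assms(2)])
  with assms(2) show ?thesis by (auto simp: differentiable_def)
qed

lemma Ck_on_locally:
  assumes "\<And>x. x \<in> S \<Longrightarrow> \<exists>U. open U \<and> x \<in> U \<and> Ck_on n f U"
  shows "Ck_on n f S"
  using assms
proof (induction n arbitrary: f)
  case 0
  then show ?case
    by (metis Ck_on.simps(1) continuous_at_imp_continuous_on continuous_on_eq_continuous_at)
next
  case (Suc n)
  have "Ck_on n (\<lambda>x. frechet_derivative f (at x) v) S" for v
    by (rule Suc.IH) (use Suc.prems in fastforce)
  with Suc.prems show ?case by fastforce
qed

lemma Ck_on_const: "Ck_on n (\<lambda>x. c) S"
  by (induction n arbitrary: c) (auto simp: frechet_derivative_const)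

lemma Ck_on_add:
  assumes "open S" "Ck_on n f S" "Ck_on n g S"
  shows "Ck_on n (\<lambda>x. f x + g x) S"
  using assms(2,3)
proof (induction n arbitrary: f g)
  case 0
  then show ?case by (auto intro: continuous_on_add)
next
  case (Suc n)
  show ?case
  proof (rule Ck_on_SucI[OF assms(1)])
    show "((\<lambda>x. f x + g x) has_derivative
        (\<lambda>v. frechet_derivative f (at x) v + frechet_derivative g (at x) v)) (at x)"
      if "x \<in> S" for x
      using Suc.prems that by (auto intro!: has_derivative_add simp: frechet_derivative_works)
  qed (use Suc in auto)
qed

lemma Ck_on_bounded_linear:
  assumes "open S" "bounded_linear h" "Ck_on n f S"
  shows "Ck_on n (\<lambda>x. h (f x)) S"
  using assms(3)
proof (induction n arbitrary: f)
  case 0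
  then show ?case using bounded_linear.continuous_on[OF assms(2)] by simp
next
  case (Suc n)
  show ?case
  proof (rule Ck_on_SucI[OF assms(1)])
    show "((\<lambda>x. h (f x)) has_derivative (\<lambda>v. h (frechet_derivative f (at x) v))) (at x)"
      if "x \<in> S" for x
      using Suc.prems that
      by (intro bounded_linear.has_derivative[OF assms(2)]) (simp add: frechet_derivative_works)
  qed (use Suc in auto)
qed

lemma Ck_on_bilinear:
  assumes "open S" "bounded_bilinear h" "Ck_on n f S" "Ck_on n g S"
  shows "Ck_on n (\<lambda>x. h (f x) (g x)) S"
  using assms(3,4)
proof (induction n arbitrary: f g)
  case 0
  then show ?case using bounded_bilinear.continuous_on[OF assms(2)] by simp
next
  case (Suc n)
  show ?case
  proof (rule Ck_on_SucI[OF assms(1)])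
    show "((\<lambda>x. h (f x) (g x)) has_derivative
        (\<lambda>v. h (f x) (frechet_derivative g (at x) v) + h (frechet_derivative f (at x) v) (g x))) (at x)"
      if "x \<in> S" for x
      using Suc.prems that
      by (intro bounded_bilinear.FDERIV[OF assms(2)]) (auto simp: frechet_derivative_works)
    show "Ck_on n (\<lambda>x. h (f x) (frechet_derivative g (at x) v) + h (frechet_derivative f (at x) v) (g x)) S"
      for v
      using Suc.prems Ck_on_lower[OF Suc.prems(1)] Ck_on_lower[OF Suc.prems(2)]
      by (intro Ck_on_add Suc.IH assms(1)) auto
  qed
qed

lemma Ck_on_sum:
  assumes "open S" "finite I" "\<And>i. i \<in> I \<Longrightarrow> Ck_on n (f i) S"
  shows "Ck_on n (\<lambda>x. \<Sum>i\<in>I. f i x) S"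
  using assms(2,3)
proof (induction I rule: finite_induct)
  case (insert i I)
  then have "Ck_on n (\<lambda>x. f i x + (\<Sum>i\<in>I. f i x)) S"
    by (intro Ck_on_add[OF assms(1)]) simp_all
  with insert.hyps show ?case by simp
qed (simp add: Ck_on_const)

text \<open>The direction \<open>f'(x) v\<close> occurring in the chain rule varies with \<open>x\<close>; expanding it in an
  orthonormal basis reduces the induction to products of functions of lower class.\<close>

lemma Ck_on_compose:
  fixes f :: "'a::real_normed_vector \<Rightarrow> 'b::euclidean_space" and g :: "'b \<Rightarrow> 'c::real_normed_vector"
  assumes "open S" "open T" "f ` S \<subseteq> T" "Ck_on n f S" "Ck_on n g T"
  shows "Ck_on n (\<lambda>x. g (f x)) S"
  using assms(4,5)
proof (induction n arbitrary: g)
  case 0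
  then have "continuous_on S f" "continuous_on T g" by simp_all
  then show ?case using continuous_on_compose2[of T g S f] assms(3) by simp
next
  case (Suc n)
  let ?g' = "\<lambda>x. frechet_derivative g (at (f x))" and ?f' = "\<lambda>x. frechet_derivative f (at x)"
  show ?case
  proof (rule Ck_on_SucI[OF assms(1)])
    fix x assume x: "x \<in> S"
    have f: "(f has_derivative ?f' x) (at x)"
      using Suc.prems(1) x by (simp add: frechet_derivative_works)
    have "f x \<in> T" using x assms(3) by blast
    then have g: "(g has_derivative ?g' x) (at (f x))"
      using Suc.prems(2) by (simp add: frechet_derivative_works)
    have "((\<lambda>x. g (f x)) has_derivative (\<lambda>v. ?g' x (?f' x v))) (at x)"
      by (rule has_derivative_compose[OF f g])
    moreover have "?g' x (?f' x v) = (\<Sum>b\<in>Basis. (?f' x v \<bullet> b) *\<^sub>R ?g' x b)" for v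
    proof -
      interpret L: linear "?g' x" by (rule has_derivative_linear[OF g])
      have "?g' x (?f' x v) = ?g' x (\<Sum>b\<in>Basis. (?f' x v \<bullet> b) *\<^sub>R b)"
        by (simp only: euclidean_representation)
      then show ?thesis by (simp only: L.sum L.scaleR)
    qed
    ultimately show "((\<lambda>x. g (f x)) has_derivative
        (\<lambda>v. \<Sum>b\<in>Basis. (?f' x v \<bullet> b) *\<^sub>R ?g' x b)) (at x)"
      by (simp only:)
  next
    fix v
    show "Ck_on n (\<lambda>x. \<Sum>b\<in>Basis. (?f' x v \<bullet> b) *\<^sub>R ?g' x b) S"
    proof (rule Ck_on_sum[OF assms(1) finite_Basis],
        rule Ck_on_bilinear[OF assms(1) bounded_bilinear_scaleR])
      fix b :: 'b
      have "Ck_on n (\<lambda>x. ?f' x v) S"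
        using Suc.prems(1) by simp
      then show "Ck_on n (\<lambda>x. ?f' x v \<bullet> b) S"
        by (rule Ck_on_bounded_linear[OF assms(1) bounded_linear_inner_left])
      have "Ck_on n (\<lambda>y. frechet_derivative g (at y) b) T"
        using Suc.prems(2) by simp
      then show "Ck_on n (\<lambda>x. ?g' x b) S"
        by (rule Suc.IH[OF Ck_on_lower[OF Suc.prems(1)]])
    qed
  qed
qed

lemma smooth_on_subset: "smooth_on f S \<Longrightarrow> T \<subseteq> S \<Longrightarrow> smooth_on f T"
  unfolding smooth_on_def by (metis Ck_on_mono_set)

lemma smooth_on_cong_open:
  "open S \<Longrightarrow> (\<And>x. x \<in> S \<Longrightarrow> f x = g x) \<Longrightarrow> smooth_on f S \<Longrightarrow> smooth_on g S"
  unfolding smooth_on_def by (metis Ck_on_cong_open)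

lemma smooth_on_locally:
  assumes "\<And>x. x \<in> S \<Longrightarrow> \<exists>U. open U \<and> x \<in> U \<and> smooth_on f U"
  shows "smooth_on f S"
  unfolding smooth_on_def
proof
  fix n
  show "Ck_on n f S"
  proof (rule Ck_on_locally)
    fix x assume "x \<in> S"
    then show "\<exists>U. open U \<and> x \<in> U \<and> Ck_on n f U"
      using assms[of x] unfolding smooth_on_def by metis
  qed
qed

lemma smooth_on_const: "smooth_on (\<lambda>x. c) S"
  by (simp add: smooth_on_def Ck_on_const)

lemma smooth_on_add:
  "open S \<Longrightarrow> smooth_on f S \<Longrightarrow> smooth_on g S \<Longrightarrow> smooth_on (\<lambda>x. f x + g x) S"
  unfolding smooth_on_def by (intro allI Ck_on_add) simp_all

lemma smooth_on_bounded_linear: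
  "open S \<Longrightarrow> bounded_linear h \<Longrightarrow> smooth_on f S \<Longrightarrow> smooth_on (\<lambda>x. h (f x)) S"
  unfolding smooth_on_def by (intro allI, rule Ck_on_bounded_linear[of S h _ f]) simp_all

lemma smooth_on_bilinear:
  "open S \<Longrightarrow> bounded_bilinear h \<Longrightarrow> smooth_on f S \<Longrightarrow> smooth_on g S
    \<Longrightarrow> smooth_on (\<lambda>x. h (f x) (g x)) S"
  unfolding smooth_on_def by (intro allI, rule Ck_on_bilinear[of S h _ f g]) simp_all

lemma smooth_on_compose:
  fixes f :: "'a::real_normed_vector \<Rightarrow> 'b::euclidean_space" and g :: "'b \<Rightarrow> 'c::real_normed_vector"
  shows "open S \<Longrightarrow> open T \<Longrightarrow> smooth_on g T \<Longrightarrow> smooth_on f S \<Longrightarrow> f ` S \<subseteq> T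
    \<Longrightarrow> smooth_on (\<lambda>x. g (f x)) S"
  unfolding smooth_on_def by (intro allI, rule Ck_on_compose[of S T f _ g]) simp_all

lemma smooth_on_frechet_derivative:
  "smooth_on f S \<Longrightarrow> smooth_on (\<lambda>x. frechet_derivative f (at x) v) S"
  unfolding smooth_on_def by (metis Ck_on.simps(2))

lemma smooth_on_imp_has_derivative:
  "smooth_on f S \<Longrightarrow> x \<in> S \<Longrightarrow> (f has_derivative frechet_derivative f (at x)) (at x)"
  unfolding smooth_on_def by (metis Ck_on.simps(2) frechet_derivative_works)

lemma smooth_on_imp_continuous_on: "smooth_on f S \<Longrightarrow> continuous_on S f"
  unfolding smooth_on_def by (metis Ck_on.simps(1))

lemma smooth_on_id: "smooth_on (\<lambda>x. x) S"
proof -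
  have "Ck_on n (\<lambda>x. x) S" for n :: nat
    by (cases n) (auto simp: frechet_derivative_ident Ck_on_const)
  then show ?thesis unfolding smooth_on_def by blast
qed

lemma smooth_on_linear: "bounded_linear h \<Longrightarrow> open S \<Longrightarrow> smooth_on h S"
  using smooth_on_bounded_linear[of S h "\<lambda>x. x"] smooth_on_id by auto

lemma smooth_on_mult:
  fixes f g :: "_ \<Rightarrow> 'b::real_normed_algebra"
  shows "open S \<Longrightarrow> smooth_on f S \<Longrightarrow> smooth_on g S \<Longrightarrow> smooth_on (\<lambda>x. f x * g x) S"
  by (rule smooth_on_bilinear[OF _ bounded_bilinear_mult])

lemma smooth_on_minus:
  "open S \<Longrightarrow> smooth_on f S \<Longrightarrow> smooth_on (\<lambda>x. - f x) S"
  by (rule smooth_on_bounded_linear[OF _ bounded_linear_minus[OF bounded_linear_ident]])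

lemma smooth_on_diff:
  "open S \<Longrightarrow> smooth_on f S \<Longrightarrow> smooth_on g S \<Longrightarrow> smooth_on (\<lambda>x. f x - g x) S"
  using smooth_on_add[of S f "\<lambda>x. - g x"] smooth_on_minus by auto

lemma smooth_on_Pair:
  assumes "open S" "smooth_on f S" "smooth_on g S"
  shows "smooth_on (\<lambda>x. (f x, g x)) S"
proof -
  have "smooth_on (\<lambda>x. (f x, 0) + (0, g x)) S"
    by (intro smooth_on_add smooth_on_bounded_linear[where h="\<lambda>y. (y, 0)"]
        smooth_on_bounded_linear[where h="\<lambda>y. (0, y)"] assms bounded_linear_Pair
        bounded_linear_ident bounded_linear_zero)
  then show ?thesis by simp
qed

lemma holomorphic_imp_smooth_on:
  assumes "open S" "f holomorphic_on S"
  shows "smooth_on f S"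
proof -
  have "Ck_on n f S" for n
    using assms(2)
  proof (induction n arbitrary: f)
    case 0
    then show ?case by (simp add: holomorphic_on_imp_continuous_on)
  next
    case (Suc n)
    show ?case
    proof (rule Ck_on_SucI[OF assms(1)])
      show "(f has_derivative (\<lambda>v. v * deriv f x)) (at x)" if "x \<in> S" for x
        using holomorphic_derivI[OF Suc.prems assms(1) that]
        by (simp add: has_field_derivative_def mult.commute[of "deriv f x"] mult_commute_abs)
      show "Ck_on n (\<lambda>x. v * deriv f x) S" for v
        by (rule Ck_on_bilinear[OF assms(1) bounded_bilinear_mult Ck_on_const])
          (rule Suc.IH[OF holomorphic_deriv[OF Suc.prems assms(1)]])
    qed
  qed
  then show ?thesis by (simp add: smooth_on_def)
qed

lemma smooth_on_holomorphic_compose: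
  "open S \<Longrightarrow> open T \<Longrightarrow> g holomorphic_on T \<Longrightarrow> smooth_on f S \<Longrightarrow> f ` S \<subseteq> T
    \<Longrightarrow> smooth_on (\<lambda>x. g (f x)) S" for f :: "'a::real_normed_vector \<Rightarrow> complex"
  by (rule smooth_on_compose[OF _ _ holomorphic_imp_smooth_on])

section \<open>A smooth step function\<close>

text \<open>The functions \<open>x\<^sup>-\<^sup>k exp (-1/x)\<close>: their span is closed under differentiation, so smoothness at
  \<open>0\<close> follows for all of them at once by induction on the order of differentiability.\<close>

definition flat_fun :: "nat \<Rightarrow> real \<Rightarrow> real" where
  "flat_fun k x = (if x > 0 then (1/x)^k * exp (- (1/x)) else 0)"

lemma flat_fun_tendsto: "(flat_fun k \<longlongrightarrow> 0) (at_right 0)"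
proof -
  have "((\<lambda>x::real. (1/x)^k * exp (- (1/x))) \<longlongrightarrow> 0) (at_right 0)"
  proof -
    have "((\<lambda>x::real. x^k / exp x) \<longlongrightarrow> 0) at_top"
      by (rule tendsto_power_div_exp_0)
    then have "((\<lambda>x::real. (inverse x)^k / exp (inverse x)) \<longlongrightarrow> 0) (at_right 0)"
      using filterlim_compose filterlim_inverse_at_top_right by fast
    then show ?thesis by (simp add: exp_minus field_simps)
  qed
  then show ?thesis
    by (rule Lim_transform_eventually) (auto simp: flat_fun_def eventually_at_filter)
qed

lemma flat_fun_has_derivative:
  "(flat_fun k has_real_derivative flat_fun (k+2) x - k * flat_fun (k+1) x) (at x)"
proof (cases x "0::real" rule: linorder_cases)
  case less
  have "((\<lambda>x. 0) has_real_derivative 0) (at x)" by simp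
  then have "(flat_fun k has_real_derivative 0) (at x)"
    by (rule has_field_derivative_transform_within_open[of _ _ _ "{..<0}"])
      (use less in \<open>auto simp: flat_fun_def\<close>)
  then show ?thesis using less by (simp add: flat_fun_def)
next
  case greater
  have k: "real k * (1/x)^(k - Suc 0) = real k * (x * (1/x)^k)"
    using greater by (cases k) (auto simp: field_simps)
  have "((\<lambda>x. (1/x)^k) has_real_derivative real k * (1/x)^(k - Suc 0) * (-((1/x)^2))) (at x)"
  proof (rule DERIV_power[THEN DERIV_cong])
    show "((\<lambda>x. 1/x) has_real_derivative (-((1/x)^2))) (at x)"
      using greater by (auto intro!: derivative_eq_intros simp: field_simps power2_eq_square)
  qed simp
  moreover have "((\<lambda>x. exp (- (1/x))) has_real_derivative exp (- (1/x)) * (1/x)^2) (at x)"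
    using greater by (auto intro!: derivative_eq_intros simp: field_simps power2_eq_square)
  ultimately have "((\<lambda>x. (1/x)^k * exp (- (1/x))) has_real_derivative
      (1/x)^k * (exp (- (1/x)) * (1/x)^2) + real k * (1/x)^(k - Suc 0) * (-((1/x)^2)) * exp (- (1/x))) (at x)"
    by (rule DERIV_mult')
  moreover have "(1/x)^k * (exp (- (1/x)) * (1/x)^2) + real k * (1/x)^(k - Suc 0) * (-((1/x)^2)) * exp (- (1/x))
      = flat_fun (k+2) x - k * flat_fun (k+1) x"
    unfolding k using greater by (simp add: flat_fun_def power2_eq_square field_simps)
  ultimately have "((\<lambda>x. (1/x)^k * exp (- (1/x))) has_real_derivative
      flat_fun (k+2) x - k * flat_fun (k+1) x) (at x)" by simp
  then show ?thesis
    by (rule has_field_derivative_transform_within_open[of _ _ _ "{0<..}"])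
      (use greater in \<open>auto simp: flat_fun_def\<close>)
next
  case equal
  have "((\<lambda>h. (flat_fun k h - 0) / h) \<longlongrightarrow> 0) (at 0)"
  proof -
    have *: "(\<lambda>h. (flat_fun k h - 0) / h) = flat_fun (k+1)"
      by (auto simp: flat_fun_def field_simps)
    have "(flat_fun (k+1) \<longlongrightarrow> 0) (at_left 0)"
      by (rule Lim_transform_eventually[OF tendsto_const]) (auto simp: flat_fun_def eventually_at_filter)
    then show ?thesis
      unfolding * by (intro filterlim_split_at flat_fun_tendsto)
  qed
  then show ?thesis
    using equal by (auto simp: has_field_derivative_iff flat_fun_def)
qed

lemma flat_fun_smooth: "smooth_on (flat_fun k) UNIV"
proof -
  have "Ck_on n (flat_fun k) UNIV" for n
  proof (induction n arbitrary: k)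
    case 0
    have "continuous_on UNIV (flat_fun k)"
      by (rule DERIV_continuous_on[OF DERIV_subset[OF flat_fun_has_derivative subset_UNIV]])
    then show ?case by simp
  next
    case (Suc n)
    show ?case
    proof (rule Ck_on_SucI)
      show "(flat_fun k has_derivative (\<lambda>v. v * (flat_fun (k+2) x + (- real k) * flat_fun (k+1) x))) (at x)" for x
        using flat_fun_has_derivative[of k x] by (simp add: has_field_derivative_def mult_commute_abs)
      show "Ck_on n (\<lambda>x. v * (flat_fun (k+2) x + (- real k) * flat_fun (k+1) x)) UNIV" for v
        by (intro Ck_on_bilinear[OF _ bounded_bilinear_mult] Ck_on_const Ck_on_add Suc.IH open_UNIV)
    qed auto
  qed
  then show ?thesis by (simp add: smooth_on_def)
qed

definition smooth_step :: "real \<Rightarrow> real" where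
  "smooth_step x = flat_fun 0 x / (flat_fun 0 x + flat_fun 0 (1 - x))"

lemma smooth_step_eq_0: "x \<le> 0 \<Longrightarrow> smooth_step x = 0"
  and smooth_step_eq_1: "x \<ge> 1 \<Longrightarrow> smooth_step x = 1"
  by (auto simp: smooth_step_def flat_fun_def)

lemma smooth_step_denominator_pos: "flat_fun 0 x + flat_fun 0 (1 - x) > 0"
  by (auto simp: flat_fun_def add_pos_pos)

lemma smooth_step_range: "0 \<le> smooth_step x" "smooth_step x \<le> 1"
  using smooth_step_denominator_pos[of x]
  by (auto simp: smooth_step_def flat_fun_def divide_simps)

text \<open>Real inversion is the real part of complex inversion, for which smoothness comes from holomorphy.\<close>

lemma smooth_on_inverse_pos:
  "open S \<Longrightarrow> smooth_on f S \<Longrightarrow> (\<And>x. x \<in> S \<Longrightarrow> f x > (0::real)) \<Longrightarrow> smooth_on (\<lambda>x. inverse (f x)) S"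
proof -
  assume f: "open S" "smooth_on f S" "\<And>x. x \<in> S \<Longrightarrow> f x > (0::real)"
  have "smooth_on (\<lambda>x. Re (inverse (complex_of_real (f x)))) S"
    by (rule smooth_on_bounded_linear[OF f(1) bounded_linear_Re],
        rule smooth_on_holomorphic_compose[where T="-{0}"])
      (use f in \<open>auto intro!: smooth_on_bounded_linear[OF _ bounded_linear_of_real] holomorphic_intros\<close>, force)
  then show ?thesis by (simp flip: of_real_inverse)
qed

lemma smooth_step_smooth: "smooth_on smooth_step UNIV"
proof -
  have 1: "smooth_on (\<lambda>x. flat_fun 0 (1 - x)) UNIV"
    by (rule smooth_on_compose[OF _ _ flat_fun_smooth])
      (auto intro!: smooth_on_diff smooth_on_const smooth_on_id)
  have "smooth_on (\<lambda>x. flat_fun 0 x * inverse (flat_fun 0 x + flat_fun 0 (1 - x))) UNIV"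
    by (intro smooth_on_mult smooth_on_inverse_pos smooth_on_add flat_fun_smooth 1 open_UNIV
        smooth_step_denominator_pos)
  then show ?thesis by (simp add: smooth_step_def[abs_def] divide_inverse)
qed

section \<open>Holomorphic maps of two variables are smooth\<close>

definition cscale :: "complex \<Rightarrow> complex \<times> complex \<Rightarrow> complex \<times> complex" where
  "cscale c v = (c * fst v, c * snd v)"

lemma complex_structure_eq_cscale: "complex_structure v = cscale \<i> v"
  by (simp add: complex_structure_def cscale_def)

lemma cscale_Re_Im: "cscale c v = Re c *\<^sub>R v + Im c *\<^sub>R complex_structure v"
  by (cases v) (simp add: cscale_def complex_structure_def complex_eq_iff)

lemma bounded_bilinear_cscale: "bounded_bilinear cscale"
proof
  show "\<exists>K. \<forall>a b. norm (cscale a b) \<le> norm a * norm b * K"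
  proof (intro exI allI)
    fix a :: complex and b :: "complex \<times> complex"
    have "norm (cscale a b) = norm a * norm b"
      by (cases b) (simp add: cscale_def norm_Pair norm_mult power_mult_distrib real_sqrt_mult
          flip: distrib_left)
    then show "norm (cscale a b) \<le> norm a * norm b * 1" by simp
  qed
qed (auto simp: cscale_def algebra_simps scaleR_conv_of_real)

lemmas continuous_on_cscale [continuous_intros] =
  bounded_bilinear.continuous_on[OF bounded_bilinear_cscale]

definition complex_linear :: "(complex \<times> complex \<Rightarrow> complex) \<Rightarrow> bool" where
  "complex_linear L \<longleftrightarrow> (\<forall>v. L (complex_structure v) = \<i> * L v)"

definition holomorphic_fun2_on :: "(complex \<times> complex \<Rightarrow> complex) \<Rightarrow> (complex \<times> complex) set \<Rightarrow> bool" where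
  "holomorphic_fun2_on f S \<longleftrightarrow>
     (\<forall>z\<in>S. f differentiable (at z) \<and> complex_linear (frechet_derivative f (at z)))"

text \<open>Restricted to a complex line the function is holomorphic in one variable, so Cauchy's formula expresses
  its directional derivative as an integral of the function itself over a circle. This first gives
  continuity of the derivative, and then, differentiating under the integral sign, that the directional
  derivative is again complex differentiable. Iteration yields smoothness.\<close>

context
  fixes f :: "complex \<times> complex \<Rightarrow> complex" and S :: "(complex \<times> complex) set"
  assumes S: "open S" and f: "holomorphic_fun2_on f S"
begin

private abbreviation f' where "f' z \<equiv> frechet_derivative f (at z)"

private lemma deriv_f: "z \<in> S \<Longrightarrow> (f has_derivative f' z) (at z)"
  using f by (simp add: holomorphic_fun2_on_def frechet_derivative_works)

private lemma f'_cscale: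
  assumes "z \<in> S" shows "f' z (cscale c v) = c * f' z v"
proof -
  interpret L: linear "f' z" by (rule has_derivative_linear[OF deriv_f[OF assms]])
  have "f' z (complex_structure v) = \<i> * f' z v"
    using f assms unfolding holomorphic_fun2_on_def complex_linear_def by blast
  then show ?thesis
    unfolding cscale_Re_Im L.add L.scaleR by (simp add: complex_eq_iff)
qed

private lemma cont_f: "continuous_on S f"
  by (meson continuous_at_imp_continuous_on deriv_f has_derivative_continuous)

private lemma deriv_along_complex_line:
  assumes "z + cscale \<zeta> v \<in> S"
  shows "((\<lambda>\<zeta>. f (z + cscale \<zeta> v)) has_field_derivative f' (z + cscale \<zeta> v) v) (at \<zeta>)"
proof -
  have "((\<lambda>\<zeta>. z + cscale \<zeta> v) has_derivative (\<lambda>h. cscale h v)) (at \<zeta>)"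
    using has_derivative_add[OF has_derivative_const bounded_linear_imp_has_derivative[OF
        bounded_bilinear.bounded_linear_left[OF bounded_bilinear_cscale]]] by simp
  from has_derivative_compose[OF this deriv_f[OF assms]]
  show ?thesis
    by (simp add: has_field_derivative_def f'_cscale[OF assms] mult_commute_abs)
qed

private lemma directional_derivative_integral:
  assumes "\<rho> > 0" and sub: "\<And>\<zeta>. norm \<zeta> \<le> \<rho> \<Longrightarrow> z + cscale \<zeta> v \<in> S"
  shows "f' z v = integral {0..1} (\<lambda>t. f (z + cscale (circlepath 0 \<rho> t) v) / circlepath 0 \<rho> t)"
proof -
  let ?g = "\<lambda>\<zeta>. f (z + cscale \<zeta> v)"
  have "z \<in> S" using sub[of 0] \<open>\<rho> > 0\<close> by (simp add: cscale_def zero_prod_def[symmetric])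
  have hol: "?g holomorphic_on cball 0 \<rho>"
    using deriv_along_complex_line sub
    by (intro holomorphic_onI) (meson field_differentiable_at_within field_differentiable_def mem_cball_0)
  have "(?g has_field_derivative f' z v) (at 0)"
    using deriv_along_complex_line[of z 0 v] \<open>z \<in> S\<close> by (simp add: cscale_def zero_prod_def[symmetric])
  then have "deriv ?g 0 = f' z v" by (rule DERIV_imp_deriv)
  moreover have "contour_integral (circlepath 0 \<rho>) (\<lambda>u. ?g u / (u - 0)^2) = (2 * pi * \<i>) * deriv ?g 0"
    using hol \<open>\<rho> > 0\<close> holomorphic_on_subset[OF hol ball_subset_cball]
    by (intro Cauchy_contour_integral_circlepath_2) (auto intro: holomorphic_on_imp_continuous_on)
  moreover have "contour_integral (circlepath 0 \<rho>) (\<lambda>u. ?g u / (u - 0)^2) =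
      (2 * pi * \<i>) * integral {0..1} (\<lambda>t. ?g (circlepath 0 \<rho> t) / circlepath 0 \<rho> t)"
    unfolding contour_integral_integral vector_derivative_circlepath integral_mult_right[symmetric]
    using \<open>\<rho> > 0\<close> by (intro integral_cong) (auto simp: circlepath field_simps power2_eq_square)
  ultimately show ?thesis by simp
qed

private lemma local_radius:
  assumes "z0 \<in> S"
  obtains \<rho> d where "\<rho> > 0" "d > 0"
    "\<And>z \<zeta>. z \<in> ball z0 d \<Longrightarrow> norm \<zeta> \<le> \<rho> \<Longrightarrow> z + cscale \<zeta> v \<in> S"
proof -
  have "continuous_on UNIV (\<lambda>p. fst p + cscale (snd p) v)"
    by (intro continuous_intros)
  then have "open ((\<lambda>p. fst p + cscale (snd p) v) -` S)"
    using S by (simp add: continuous_on_open_vimage)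
  moreover have "(z0, 0) \<in> (\<lambda>p. fst p + cscale (snd p) v) -` S"
    using assms by (simp add: cscale_def zero_prod_def[symmetric])
  ultimately obtain A B where "open A" "open B" "(z0, 0) \<in> A \<times> B"
      "A \<times> B \<subseteq> (\<lambda>p. fst p + cscale (snd p) v) -` S"
    by (rule open_prod_elim)
  then have AB: "open A" "open B" "z0 \<in> A" "0 \<in> B"
      "A \<times> B \<subseteq> (\<lambda>p. fst p + cscale (snd p) v) -` S"
    by simp_all
  obtain d where "d > 0" "ball z0 d \<subseteq> A" using AB open_contains_ball by metis
  obtain \<rho> where "\<rho> > 0" "cball 0 \<rho> \<subseteq> B" using AB open_contains_cball by metis
  show thesis
  proof (rule that[OF \<open>\<rho> > 0\<close> \<open>d > 0\<close>])
    fix z \<zeta> assume "z \<in> ball z0 d" "norm (\<zeta>::complex) \<le> \<rho>"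
    then have "z \<in> A" "\<zeta> \<in> B"
      using \<open>ball z0 d \<subseteq> A\<close> \<open>cball 0 \<rho> \<subseteq> B\<close> by auto
    then have "(z, \<zeta>) \<in> (\<lambda>p. fst p + cscale (snd p) v) -` S" using AB(5) by blast
    then show "z + cscale \<zeta> v \<in> S" by simp
  qed
qed

private lemma continuous_directional_derivative: "continuous_on S (\<lambda>z. f' z v)"
proof (rule continuous_at_imp_continuous_on, rule ballI)
  fix z0 assume "z0 \<in> S"
  obtain \<rho> d where \<rho>: "\<rho> > 0" "d > 0"
    "\<And>z \<zeta>. z \<in> ball z0 d \<Longrightarrow> norm \<zeta> \<le> \<rho> \<Longrightarrow> z + cscale \<zeta> v \<in> S"
    using local_radius[OF \<open>z0 \<in> S\<close>] by metis
  have "continuous_on (ball z0 d \<times> cbox 0 1)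
      (\<lambda>(z, t::real). f (z + cscale (circlepath 0 \<rho> t) v) / circlepath 0 \<rho> t)"
    unfolding split_beta circlepath
    using \<rho> by (intro continuous_intros continuous_on_compose2[OF cont_f]) (auto simp: norm_mult)
  from integral_continuous_on_param[OF this]
  have "continuous_on (ball z0 d) (\<lambda>z. f' z v)"
    by (rule continuous_on_eq) (use \<rho> directional_derivative_integral in \<open>auto simp: cbox_interval\<close>)
  then show "isCont (\<lambda>z. f' z v) z0"
    using \<open>d > 0\<close> by (simp add: continuous_on_eq_continuous_at)
qed

private lemma directional_derivative_holomorphic: "holomorphic_fun2_on (\<lambda>z. f' z v) S"
  unfolding holomorphic_fun2_on_def
proof
  fix z0 assume "z0 \<in> S"
  obtain \<rho> d where \<rho>: "\<rho> > 0" "d > 0"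
    "\<And>z \<zeta>. z \<in> ball z0 d \<Longrightarrow> norm \<zeta> \<le> \<rho> \<Longrightarrow> z + cscale \<zeta> v \<in> S"
    using local_radius[OF \<open>z0 \<in> S\<close>] by metis
  let ?c = "circlepath 0 \<rho>"
  let ?F = "\<lambda>z (t::real). f (z + cscale (?c t) v) / ?c t"
  define G where "G z t = blinfun_compose (blinfun_mult_left (inverse (?c t))) (Blinfun (f' (z + cscale (?c t) v)))"
    for z t
  have c0: "?c t \<noteq> 0" and cn: "norm (?c t) = \<rho>" for t
    using \<rho> by (auto simp: circlepath norm_mult)
  have inS: "z + cscale (?c t) v \<in> S" if "z \<in> ball z0 d" for z t
    using \<rho>(3)[OF that, of "?c t"] cn by simp
  have G: "blinfun_apply (G z t) h = f' (z + cscale (?c t) v) h / ?c t" if "z \<in> ball z0 d" for z t h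
    unfolding G_def
    by (simp add: bounded_linear_Blinfun_apply[OF has_derivative_bounded_linear[OF deriv_f[OF inS[OF that]]]]
        divide_inverse)
  have G': "blinfun_apply (G z t) = (\<lambda>h. f' (z + cscale (?c t) v) h / ?c t)" if "z \<in> ball z0 d" for z t
    using G[OF that] by auto
  have contG: "continuous_on (ball z0 d \<times> cbox 0 1) (\<lambda>(z, t). G z t)"
  proof (rule continuous_on_blinfun_componentwise)
    fix i :: "complex \<times> complex"
    have "continuous_on (ball z0 d \<times> cbox 0 1) (\<lambda>p. f' (fst p + cscale (?c (snd p)) v) i / ?c (snd p))"
      unfolding circlepath
      by (intro continuous_intros continuous_on_compose2[OF continuous_directional_derivative])
        (use inS c0 in \<open>auto simp: circlepath\<close>)
    then show "continuous_on (ball z0 d \<times> cbox 0 1) (\<lambda>x. blinfun_apply (case x of (z, t) \<Rightarrow> G z t) i)"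
      by (rule continuous_on_eq) (auto simp: G)
  qed
  have contF: "continuous_on (cbox 0 1) (?F z)" if "z \<in> ball z0 d" for z
    unfolding circlepath
    by (intro continuous_intros continuous_on_compose2[OF cont_f])
      (use inS[OF that] c0 in \<open>auto simp: circlepath\<close>)
  have "((\<lambda>z. integral (cbox 0 1) (?F z)) has_derivative integral (cbox 0 1) (G z0)) (at z0 within ball z0 d)"
  proof (rule leibniz_rule[OF _ _ contG])
    fix z and t :: real assume z: "z \<in> ball z0 d"
    have "((\<lambda>z. z + cscale (?c t) v) has_derivative (\<lambda>h. h)) (at z)"
      by (auto intro!: derivative_eq_intros)
    from has_derivative_compose[OF this deriv_f[OF inS[OF z]]]
    have "((\<lambda>z. f (z + cscale (?c t) v)) has_derivative f' (z + cscale (?c t) v)) (at z)" .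
    from bounded_linear.has_derivative[OF bounded_linear_divide this]
    show "((\<lambda>z. ?F z t) has_derivative blinfun_apply (G z t)) (at z within ball z0 d)"
      unfolding G'[OF z] by (rule has_derivative_at_withinI)
  qed (use \<rho> integrable_continuous[OF contF] in simp_all)
  then have "((\<lambda>z. integral (cbox 0 1) (?F z)) has_derivative integral (cbox 0 1) (G z0)) (at z0)"
    using \<open>d > 0\<close> at_within_open[of z0 "ball z0 d"] by simp
  then have der: "((\<lambda>z. f' z v) has_derivative integral (cbox 0 1) (G z0)) (at z0)"
    by (rule has_derivative_transform_within_open[of _ _ _ _ "ball z0 d"])
      (use \<rho> directional_derivative_integral in \<open>auto simp: cbox_interval\<close>)
  have "continuous_on (cbox 0 1) (\<lambda>t. case (z0, t) of (z, t) \<Rightarrow> G z t)"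
    using \<open>d > 0\<close> by (intro continuous_on_compose2[OF contG]) (auto intro!: continuous_intros)
  then have "G z0 integrable_on cbox 0 1"
    by (intro integrable_continuous) simp
  then have "blinfun_apply (integral (cbox 0 1) (G z0)) h = integral (cbox 0 1) (\<lambda>t. blinfun_apply (G z0 t) h)" for h
    by (rule blinfun_apply_integral)
  moreover have "blinfun_apply (G z0 t) (complex_structure h) = \<i> * blinfun_apply (G z0 t) h" for t h
    using G[of z0] \<open>d > 0\<close> f'_cscale[OF inS, of z0 t \<i>] by (simp add: complex_structure_eq_cscale)
  ultimately have "complex_linear (blinfun_apply (integral (cbox 0 1) (G z0)))"
    by (simp add: complex_linear_def)
  then show "(\<lambda>z. f' z v) differentiable at z0 \<and> complex_linear (frechet_derivative (\<lambda>z. f' z v) (at z0))"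
    using der frechet_derivative_eq[OF der] by (auto simp: differentiable_def)
qed

lemmas holomorphic_fun2_directional = directional_derivative_holomorphic
lemmas holomorphic_fun2_continuous = cont_f

end

lemma holomorphic_fun2_imp_Ck: "open S \<Longrightarrow> holomorphic_fun2_on f S \<Longrightarrow> Ck_on n f S"
proof (induction n arbitrary: f)
  case 0
  then show ?case by (simp add: holomorphic_fun2_continuous)
next
  case (Suc n)
  then show ?case
    using holomorphic_fun2_directional[OF Suc.prems] by (simp add: holomorphic_fun2_on_def)
qed

lemma holomorphic2_imp_smooth_on:
  assumes "open S" "holomorphic2_on f S"
  shows "smooth_on f S"
proof -
  have *: "holomorphic_fun2_on (\<lambda>z. p (f z)) S"
    if p: "bounded_linear p" "\<And>v. p (complex_structure v) = \<i> * p v" for p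
    unfolding holomorphic_fun2_on_def
  proof
    fix z assume "z \<in> S"
    then obtain L where L: "(f has_derivative L) (at z)" "\<And>v. L (complex_structure v) = complex_structure (L v)"
      using assms(2) by (auto simp: holomorphic2_on_def)
    have d: "((\<lambda>z. p (f z)) has_derivative (\<lambda>v. p (L v))) (at z)"
      by (rule bounded_linear.has_derivative[OF p(1) L(1)])
    then show "(\<lambda>z. p (f z)) differentiable at z \<and> complex_linear (frechet_derivative (\<lambda>z. p (f z)) (at z))"
      using L(2) p(2) by (auto simp: frechet_derivative_eq[OF d] complex_linear_def differentiable_def)
  qed
  have "holomorphic_fun2_on (\<lambda>z. fst (f z)) S" "holomorphic_fun2_on (\<lambda>z. snd (f z)) S"
    by (rule *; simp add: bounded_linear_fst bounded_linear_snd complex_structure_def)+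
  then have "smooth_on (\<lambda>z. fst (f z)) S" "smooth_on (\<lambda>z. snd (f z)) S"
    unfolding smooth_on_def using holomorphic_fun2_imp_Ck[OF assms(1)] by blast+
  from smooth_on_Pair[OF assms(1) this] show ?thesis by simp
qed

section \<open>The Cauchy-Riemann operator\<close>

text \<open>A relational form of \<open>dbar\<close>, analogous to \<open>has_derivative\<close>, so that derivatives can be computed
  by rules.\<close>

definition has_dbar :: "(complex \<Rightarrow> complex) \<Rightarrow> complex \<Rightarrow> complex \<Rightarrow> bool" where
  "has_dbar f d z \<longleftrightarrow> (\<exists>f'. (f has_derivative f') (at z) \<and> (f' 1 + \<i> * f' \<i>) / 2 = d)"

lemma has_dbar_imp_dbar: "has_dbar f d z \<Longrightarrow> dbar f z = d"
  by (auto simp: has_dbar_def dbar_def frechet_derivative_eq)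

lemma smooth_on_imp_has_dbar: "smooth_on f S \<Longrightarrow> z \<in> S \<Longrightarrow> has_dbar f (dbar f z) z"
  unfolding has_dbar_def dbar_def using smooth_on_imp_has_derivative by blast

lemma has_dbar_transform:
  "has_dbar f d z \<Longrightarrow> open S \<Longrightarrow> z \<in> S \<Longrightarrow> (\<And>w. w \<in> S \<Longrightarrow> f w = g w) \<Longrightarrow> has_dbar g d z"
  unfolding has_dbar_def using has_derivative_transform_within_open by metis

lemma has_dbar_const: "has_dbar (\<lambda>z. c) 0 z"
  unfolding has_dbar_def by (rule exI[of _ "\<lambda>_. 0"]) simp

lemma has_dbar_cnj: "has_dbar cnj 1 z"
  unfolding has_dbar_def
  by (rule exI[of _ cnj]) (simp add: bounded_linear_imp_has_derivative bounded_linear_cnj)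

lemma has_dbar_add:
  assumes "has_dbar f d z" "has_dbar g e z"
  shows "has_dbar (\<lambda>z. f z + g z) (d + e) z"
proof -
  obtain f' g' where "(f has_derivative f') (at z)" "(f' 1 + \<i> * f' \<i>) / 2 = d"
    "(g has_derivative g') (at z)" "(g' 1 + \<i> * g' \<i>) / 2 = e"
    using assms by (auto simp: has_dbar_def)
  then show ?thesis unfolding has_dbar_def
    by (intro exI[of _ "\<lambda>h. f' h + g' h"]) (auto intro: has_derivative_add simp: field_simps)
qed

lemma has_dbar_mult:
  assumes "has_dbar f d z" "has_dbar g e z"
  shows "has_dbar (\<lambda>z. f z * g z) (f z * e + d * g z) z"
proof -
  obtain f' g' where "(f has_derivative f') (at z)" "(f' 1 + \<i> * f' \<i>) / 2 = d"
    "(g has_derivative g') (at z)" "(g' 1 + \<i> * g' \<i>) / 2 = e"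
    using assms by (auto simp: has_dbar_def)
  moreover from this have "(f z * g' 1 + f' 1 * g z + \<i> * (f z * g' \<i> + f' \<i> * g z)) / 2 = f z * e + d * g z"
    by (auto simp: algebra_simps add_divide_distrib)
  ultimately show ?thesis unfolding has_dbar_def
    by (intro exI[of _ "\<lambda>h. f z * g' h + f' h * g z"] conjI has_derivative_mult)
qed

lemma has_dbar_holomorphic_compose:
  assumes "has_dbar f d z" "(h has_field_derivative h') (at (f z))"
  shows "has_dbar (\<lambda>z. h (f z)) (h' * d) z"
proof -
  obtain f' where f': "(f has_derivative f') (at z)" "(f' 1 + \<i> * f' \<i>) / 2 = d"
    using assms by (auto simp: has_dbar_def)
  have "((\<lambda>z. h (f z)) has_derivative (\<lambda>v. h' * f' v)) (at z)"
    using has_derivative_compose[OF f'(1)] assms(2) by (simp add: has_field_derivative_def)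
  then show ?thesis unfolding has_dbar_def
    by (intro exI[of _ "\<lambda>v. h' * f' v"]) (auto simp: f'(2)[symmetric] algebra_simps)
qed

lemma has_dbar_holomorphic:
  "(h has_field_derivative h') (at z) \<Longrightarrow> has_dbar h 0 z"
  unfolding has_dbar_def has_field_derivative_def
  by (rule exI[of _ "(*) h'"]) (simp add: mult.left_commute[of "\<i>"])

lemma has_dbar_cmult: "has_dbar f d z \<Longrightarrow> has_dbar (\<lambda>z. c * f z) (c * d) z"
  using has_dbar_mult[OF has_dbar_const] by simp

section \<open>A logarithm on the punctured disc\<close>

lemma open_punctured_ball: "open (ball (0::complex) r - {0})"
  by (simp add: open_Diff)

text \<open>The index enters through this lemma. On the universal cover \<open>Re w < ln r\<close> of the punctured disc the function \<open>f(e\<^sup>w)\<close> has a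
  logarithm. Translation by \<open>2 \<pi> i\<close> changes it by \<open>2 \<pi> i\<close> times the winding number, so adding \<open>w\<close>
  makes it periodic when the winding number is \<open>-1\<close>. Smoothness is local: near each point the continuous
  logarithm is the principal logarithm of a quotient.\<close>

lemma smooth_log_punctured_disc:
  assumes r: "0 < \<rho>" "\<rho> < r"
    and f: "smooth_on f (ball 0 r - {0})" "\<And>\<xi>. \<xi> \<in> ball 0 r - {0} \<Longrightarrow> f \<xi> \<noteq> 0"
    and wn: "winding_number (f \<circ> circlepath 0 \<rho>) 0 = -1"
  obtains b where "smooth_on b (ball 0 r - {0})" "\<And>\<xi>. \<xi> \<in> ball 0 r - {0} \<Longrightarrow> \<xi> * f \<xi> = exp (b \<xi>)"
proof -
  define P where "P = ball (0::complex) r - {0}"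
  have P: "open P" unfolding P_def by (rule open_punctured_ball)
  define H where "H = {w. Re w < ln r}"
  have "convex H" unfolding H_def by (rule convex_halfspace_Re_lt)
  have expP: "exp w \<in> P \<longleftrightarrow> w \<in> H" for w
    using r by (simp add: P_def H_def ln_less_cancel_iff[symmetric] del: ln_less_cancel_iff)
  have contf: "continuous_on P f" using f(1) smooth_on_imp_continuous_on P_def by blast
  have "continuous_on H (\<lambda>w. f (exp w))"
    using expP by (intro continuous_on_compose2[OF contf]) (auto intro!: continuous_intros)
  moreover have "f (exp w) \<noteq> 0" if "w \<in> H" for w using f(2) expP that P_def by blast
  ultimately obtain B0 where B0: "continuous_on H B0" "\<And>w. w \<in> H \<Longrightarrow> f (exp w) = exp (B0 w)"
    using continuous_logarithm_on_contractible convex_imp_contractible[OF \<open>convex H\<close>] by metis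
  \<comment> \<open>A logarithm of \<open>\<xi> f(\<xi>)\<close> pulled back to the cover; adding \<open>w\<close> cancels the monodromy of \<open>B0\<close>.\<close>
  define B where "B w = B0 w + w" for w
  have contB: "continuous_on H B" unfolding B_def by (intro continuous_intros B0(1))
  have expB: "exp w * f (exp w) = exp (B w)" if "w \<in> H" for w
    using B0(2)[OF that] by (simp add: B_def exp_add)
  define \<tau> where "\<tau> = 2 * complex_of_real pi * \<i>"
  have shiftH: "w + of_int n * \<tau> \<in> H \<longleftrightarrow> w \<in> H" for w n by (simp add: H_def \<tau>_def)
  define \<phi> where "\<phi> w = B (w + \<tau>) - B w" for w
  have shiftH1: "w + \<tau> \<in> H \<longleftrightarrow> w \<in> H" for w using shiftH[of w 1] by simp
  have exp\<phi>: "exp (\<phi> w) = 1" if "w \<in> H" for w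
  proof -
    have "exp (w + \<tau>) = exp w" by (simp add: \<tau>_def exp_add)
    then have "exp (B (w + \<tau>)) = exp (B w)"
      using expB[OF that] expB[of "w + \<tau>"] shiftH1 that by simp
    then show ?thesis by (simp add: \<phi>_def exp_diff)
  qed
  have "\<phi> constant_on H"
  proof (rule continuous_discrete_range_constant)
    show "connected H" using \<open>convex H\<close> by (rule convex_connected)
    show "continuous_on H \<phi>"
      unfolding \<phi>_def using shiftH1
      by (intro continuous_intros contB continuous_on_compose2[OF contB]) auto
    fix w assume w: "w \<in> H"
    have "2 * pi \<le> norm (\<phi> y - \<phi> w)" if y: "y \<in> H" "\<phi> y \<noteq> \<phi> w" for y
    proof -
      have "exp (\<phi> y) = exp (\<phi> w)" using exp\<phi> w y by simp
      then obtain n :: int where n: "\<phi> y = \<phi> w + (of_int (2 * n) * pi) * \<i>"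
        using exp_eq by blast
      with y(2) have "n \<noteq> 0" by auto
      then have "1 \<le> \<bar>real_of_int n\<bar>" by linarith
      moreover have "norm (\<phi> y - \<phi> w) = 2 * pi * \<bar>real_of_int n\<bar>"
        using n by (simp add: norm_mult abs_mult)
      ultimately show ?thesis by simp
    qed
    then show "\<exists>e>0. \<forall>y. y \<in> H \<and> \<phi> y \<noteq> \<phi> w \<longrightarrow> e \<le> norm (\<phi> y - \<phi> w)"
      by (intro exI[of _ "2 * pi"]) auto
  qed
  then obtain c where c: "\<And>w. w \<in> H \<Longrightarrow> \<phi> w = c" by (auto simp: constant_on_def)
  have "c = 0"
  proof -
    define w0 where "w0 = complex_of_real (ln \<rho>)"
    have path_in: "w0 + of_real t * \<tau> \<in> H" for t
      using r by (simp add: w0_def \<tau>_def H_def)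
    have "exp (w0 + of_real t * \<tau>) = circlepath 0 \<rho> t" for t
    proof -
      have "exp w0 = of_real \<rho>" using r exp_of_real[of "ln \<rho>"] by (simp add: w0_def)
      then show ?thesis by (simp add: \<tau>_def circlepath exp_add mult_ac)
    qed
    then have "f \<circ> circlepath 0 \<rho> = exp \<circ> (\<lambda>t. B0 (w0 + of_real t * \<tau>))"
      using B0(2)[OF path_in] by (auto simp: fun_eq_iff)
    moreover have "path (\<lambda>t. B0 (w0 + of_real t * \<tau>))"
      unfolding path_def using path_in
      by (intro continuous_on_compose2[OF B0(1)]) (auto intro!: continuous_intros)
    ultimately have "winding_number (f \<circ> circlepath 0 \<rho>) 0 = (B0 (w0 + \<tau>) - B0 w0) / \<tau>"
      by (simp add: winding_number_compose_exp pathfinish_def pathstart_def \<tau>_def)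
    moreover have "\<tau> \<noteq> 0" by (simp add: \<tau>_def)
    ultimately have "B0 (w0 + \<tau>) - B0 w0 = - \<tau>" using wn by (simp add: field_simps)
    then have "\<phi> w0 = 0" by (simp add: \<phi>_def B_def algebra_simps)
    then show ?thesis using c path_in[of 0] by simp
  qed
  have periodic: "B (w + of_int n * \<tau>) = B w" if "w \<in> H" for w n
  proof (induction n rule: int_induct[where k=0])
    case (step1 i)
    have "B (w + of_int i * \<tau> + \<tau>) = B (w + of_int i * \<tau>)"
      using c[of "w + of_int i * \<tau>"] \<open>c = 0\<close> shiftH that by (simp add: \<phi>_def)
    then show ?case using step1 by (simp add: algebra_simps)
  next
    case (step2 i)
    have "B (w + of_int (i - 1) * \<tau> + \<tau>) = B (w + of_int (i - 1) * \<tau>)"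
      using c[of "w + of_int (i - 1) * \<tau>"] \<open>c = 0\<close> shiftH[of w "i - 1"] that by (simp only: \<phi>_def) simp
    then show ?case using step2 by (simp add: algebra_simps)
  qed simp
  define b where "b \<xi> = B (Ln \<xi>)" for \<xi>
  have LnH: "Ln \<xi> \<in> H" if "\<xi> \<in> P" for \<xi>
    using that expP[of "Ln \<xi>"] by (simp add: P_def)
  have expb: "exp (b \<xi>) = \<xi> * f \<xi>" if "\<xi> \<in> P" for \<xi>
    using expB[OF LnH[OF that]] that by (simp add: b_def P_def)
  have contb: "continuous_on P b"
  proof (rule continuous_at_imp_continuous_on, rule ballI)
    fix \<xi>0 assume \<xi>0: "\<xi>0 \<in> P"
    define U where "U = P \<inter> ball \<xi>0 (norm \<xi>0)"
    define l where "l \<xi> = Ln (\<xi> / \<xi>0) + Ln \<xi>0" for \<xi>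
    have "\<xi>0 \<noteq> 0" using \<xi>0 by (simp add: P_def)
    have U: "open U" "\<xi>0 \<in> U" using P \<xi>0 \<open>\<xi>0 \<noteq> 0\<close> by (auto simp: U_def)
    have Re: "Re (\<xi> / \<xi>0) > 0" if "\<xi> \<in> U" for \<xi>
    proof -
      have "norm (\<xi> - \<xi>0) < norm \<xi>0" using that by (simp add: U_def dist_norm norm_minus_commute)
      then have "norm (\<xi> / \<xi>0 - 1) < 1"
        using \<open>\<xi>0 \<noteq> 0\<close> by (simp add: diff_divide_distrib[symmetric] norm_divide field_simps)
      then show ?thesis using abs_Re_le_cmod[of "\<xi> / \<xi>0 - 1"] by simp
    qed
    have expl: "exp (l \<xi>) = \<xi>" if "\<xi> \<in> U" for \<xi>
      using that \<open>\<xi>0 \<noteq> 0\<close> by (simp add: l_def exp_add U_def P_def)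
    \<comment> \<open>\<open>Ln\<close> may jump near \<open>\<xi>0\<close>, but by periodicity of \<open>B\<close> it can be replaced by the continuous
        branch \<open>l\<close>.\<close>
    have bl: "b \<xi> = B (l \<xi>)" if "\<xi> \<in> U" for \<xi>
    proof -
      have "\<xi> \<in> P" "\<xi> \<noteq> 0" using that by (auto simp: U_def P_def)
      then have "exp (l \<xi>) = exp (Ln \<xi>)" using expl that by simp
      then obtain n :: int where "l \<xi> = Ln \<xi> + (of_int (2 * n) * pi) * \<i>"
        using exp_eq by blast
      then have "l \<xi> = Ln \<xi> + of_int n * \<tau>" by (simp add: \<tau>_def)
      then show ?thesis using periodic[OF LnH[OF \<open>\<xi> \<in> P\<close>]] by (simp add: b_def)
    qed
    have "continuous_on U (\<lambda>\<xi>. B (l \<xi>))"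
    proof (rule continuous_on_compose2[OF contB])
      show "continuous_on U l"
        unfolding l_def using \<open>\<xi>0 \<noteq> 0\<close>
        by (intro continuous_intros) (auto simp: complex_nonpos_Reals_iff dest!: Re)
      show "l ` U \<subseteq> H" using expl expP U_def by fastforce
    qed
    then have "continuous_on U b" by (rule continuous_on_eq) (simp add: bl)
    then show "isCont b \<xi>0" using U by (simp add: continuous_on_eq_continuous_at)
  qed
  have "smooth_on b P"
  proof (rule smooth_on_locally)
    fix \<xi>0 assume \<xi>0: "\<xi>0 \<in> P"
    define U where "U = P \<inter> b -` ball (b \<xi>0) 1"
    have U: "open U" "\<xi>0 \<in> U"
      using contb P \<xi>0 by (auto simp: U_def intro: continuous_open_preimage)
    have Im: "\<bar>Im (b \<xi> - b \<xi>0)\<bar> < 1" if "\<xi> \<in> U" for \<xi>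
      using that abs_Im_le_cmod[of "b \<xi> - b \<xi>0"] by (auto simp: U_def dist_norm norm_minus_commute)
    have exp_eq': "exp (b \<xi> - b \<xi>0) = \<xi> * f \<xi> * inverse (\<xi>0 * f \<xi>0)" if "\<xi> \<in> U" for \<xi>
      using that expb \<xi>0 by (simp add: exp_diff U_def divide_inverse)
    have "smooth_on (\<lambda>\<xi>. Ln (\<xi> * f \<xi> * inverse (\<xi>0 * f \<xi>0)) + b \<xi>0) U"
    proof (intro smooth_on_add smooth_on_const U(1) smooth_on_holomorphic_compose[where g=Ln and T="- \<real>\<^sub>\<le>\<^sub>0"])
      show "Ln holomorphic_on - \<real>\<^sub>\<le>\<^sub>0" by (auto intro!: holomorphic_intros)
      show "smooth_on (\<lambda>\<xi>. \<xi> * f \<xi> * inverse (\<xi>0 * f \<xi>0)) U"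
        using smooth_on_subset[OF f(1)]
        by (intro smooth_on_mult smooth_on_id smooth_on_const U(1)) (auto simp: U_def P_def)
      show "(\<lambda>\<xi>. \<xi> * f \<xi> * inverse (\<xi>0 * f \<xi>0)) ` U \<subseteq> - \<real>\<^sub>\<le>\<^sub>0"
      proof clarify
        fix \<xi> assume \<xi>: "\<xi> \<in> U" "\<xi> * f \<xi> * inverse (\<xi>0 * f \<xi>0) \<in> \<real>\<^sub>\<le>\<^sub>0"
        have "cos (Im (b \<xi> - b \<xi>0)) > 0"
          using Im[OF \<xi>(1)] pi_gt3 by (intro cos_gt_zero_pi) auto
        then have "Re (exp (b \<xi> - b \<xi>0)) > 0" by (simp add: Re_exp)
        with \<xi> exp_eq' show False by (simp add: complex_nonpos_Reals_iff)
      qed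
    qed auto
    moreover have "Ln (\<xi> * f \<xi> * inverse (\<xi>0 * f \<xi>0)) + b \<xi>0 = b \<xi>" if "\<xi> \<in> U" for \<xi>
    proof -
      have "Ln (exp (b \<xi> - b \<xi>0)) = b \<xi> - b \<xi>0"
        using Im[OF that] pi_gt3 by (intro Ln_exp) auto
      then show ?thesis using exp_eq'[OF that] by simp
    qed
    ultimately have "smooth_on b U" by (rule smooth_on_cong_open[OF U(1), rotated])
    with U show "\<exists>U. open U \<and> \<xi>0 \<in> U \<and> smooth_on b U" by blast
  qed
  then show thesis using that expb by (simp add: P_def)
qed

section \<open>Modifying a graph near a hyperbolic complex point\<close>

text \<open>The loop \<open>u \<mapsto> i cos u - cos 2u\<close> has mean zero and traverses an arc of a parabola back and
  forth: with \<open>y = cos u\<close> it is \<open>1 - 2 y\<^sup>2 + i y\<close>. The arc crosses the real axis only at \<open>1\<close>. So a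
  nonnegative multiple of it can be switched on, starting from a positive number, without ever meeting
  \<open>0\<close>; and once the multiple is large, the loop stays away from any prescribed bounded set.\<close>

definition parabola :: "real \<Rightarrow> complex" where
  "parabola y = Complex (1 - 2 * y^2) y"

definition parabola_primitive :: "complex \<Rightarrow> complex" where
  "parabola_primitive u = \<i> * sin u - sin (2 * u) / 2"

lemma parabola_primitive_deriv:
  "(parabola_primitive has_field_derivative parabola (cos u)) (at (of_real u))"
proof -
  have "(parabola_primitive has_field_derivative \<i> * cos (of_real u) - cos (2 * of_real u)) (at (of_real u))"
    unfolding parabola_primitive_def by (auto intro!: derivative_eq_intros)
  moreover have "\<i> * cos (of_real u) - cos (2 * of_real u) = parabola (cos u)"
  proof -
    have 1: "cos (complex_of_real u) = of_real (cos u)" by (simp add: cos_of_real)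
    have "cos (2 * complex_of_real u) = of_real (2 * (cos u)^2 - 1)"
      unfolding cos_double_cos 1 by simp
    then show ?thesis unfolding 1 by (simp add: parabola_def complex_eq_iff)
  qed
  ultimately show ?thesis by simp
qed

lemma norm_parabola_primitive_le: "norm (parabola_primitive (of_real u)) \<le> 2"
proof -
  have "norm (parabola_primitive (of_real u)) \<le> norm (\<i> * sin (of_real u :: complex)) + norm (sin (2 * of_real u :: complex) / 2)"
    unfolding parabola_primitive_def by (rule norm_triangle_ineq4)
  also have "\<dots> = \<bar>sin u\<bar> + \<bar>sin (2 * u)\<bar> / 2"
    using sin_of_real[of u, where 'a=complex] sin_of_real[of "2*u", where 'a=complex]
    by (simp add: norm_mult norm_divide)
  also have "\<dots> \<le> 2" using abs_sin_le_one[of u] abs_sin_le_one[of "2*u"] by linarith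
  finally show ?thesis .
qed

lemma norm_parabola_gt: "norm (parabola y) > 1/2"
proof -
  have "(norm (parabola y))^2 = 1 - 3 * y^2 + 4 * (y^2)^2"
    unfolding parabola_def cmod_power2 by (simp add: power2_eq_square algebra_simps)
  also have "\<dots> = (2 * y^2 - 3/4)^2 + 7/16"
    by (simp add: power2_eq_square algebra_simps)
  also have "\<dots> > (1/2)^2"
    using add_pos_nonneg[of "3/16" "(2 * y^2 - 3/4)^2"] by (simp add: power_divide)
  finally show ?thesis by (rule power2_less_imp_less) simp
qed

lemma one_plus_parabola_nonzero: "0 \<le> k \<Longrightarrow> 0 < c \<Longrightarrow> of_real c + of_real k * parabola y \<noteq> 0"
proof
  assume *: "0 \<le> k" "0 < c" "of_real c + of_real k * parabola y = 0"
  then have "c + k * (1 - 2 * y^2) = 0" "k * y = 0" by (simp_all add: parabola_def complex_eq_iff)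
  then show False using * by auto
qed

lemma smooth_on_dbar:
  assumes "open S" "smooth_on F S" shows "smooth_on (dbar F) S"
proof -
  have "smooth_on (\<lambda>z. (frechet_derivative F (at z) 1 + \<i> * frechet_derivative F (at z) \<i>) * (1/2)) S"
    by (intro smooth_on_mult smooth_on_add smooth_on_const smooth_on_frechet_derivative assms)
  then show ?thesis by (simp add: dbar_def[abs_def])
qed

lemma smooth_on_norm_power2: "open S \<Longrightarrow> smooth_on (\<lambda>z::complex. (norm z)^2) S"
proof -
  assume S: "open S"
  have "smooth_on (\<lambda>z. Re z * Re z + Im z * Im z) S"
    by (intro smooth_on_add smooth_on_mult smooth_on_linear bounded_linear_Re bounded_linear_Im S)
  then show ?thesis unfolding cmod_power2 by (simp only: power2_eq_square)
qed

lemma smooth_on_step_of_norm: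
  "open S \<Longrightarrow> smooth_on (\<lambda>z::complex. complex_of_real (smooth_step (c * (norm z)^2 + d))) S"
  by (intro smooth_on_bounded_linear[OF _ bounded_linear_of_real]
      smooth_on_compose[OF _ open_UNIV smooth_step_smooth] smooth_on_add smooth_on_mult
      smooth_on_const smooth_on_norm_power2) auto

text \<open>The operator \<open>D = cnj \<xi> dbar\<close> is a derivation that maps \<open>ln |\<xi>|\<^sup>2\<close> to \<open>1\<close> and \<open>m = cnj \<xi>/\<xi>\<close> to \<open>m\<close>. Outside,
  \<open>D F = m exp b\<close>; for the model near \<open>0\<close> it takes the value \<open>\<epsilon> m\<close>. The function \<open>H = m exp (\<alpha> b)\<close>, with a cutoff
  \<open>\<alpha>\<close>, is nonzero and joins these two up to positive factors. To the interpolation \<open>G0\<close> of \<open>F\<close> and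
  the model one adds \<open>(K/N) \<kappa> H E(N ln |\<xi>|\<^sup>2)\<close>, where \<open>E\<close> is the primitive of the parabolic loop. Up to
  \<open>O(1/N)\<close>, this changes \<open>D G0\<close> by \<open>K \<kappa> H\<close> times a point of the parabola. Where \<open>\<alpha>\<close> varies,
  \<open>\<kappa> = 1\<close> and \<open>K\<close> is so large that the added term dominates; where \<open>\<kappa>\<close> varies, \<open>D G0\<close> is a positive
  multiple of \<open>H\<close> and the sum cannot vanish either. Finally \<open>N\<close> is chosen large by compactness.\<close>

lemma hyperbolic_modification:
  assumes r: "0 < r" and F: "smooth_on F (ball 0 r)"
    and nz: "\<And>\<xi>. \<xi> \<in> ball 0 r - {0} \<Longrightarrow> dbar F \<xi> \<noteq> 0"
    and wn: "\<forall>\<^sub>F \<rho> in at_right 0. winding_number (dbar F \<circ> circlepath 0 \<rho>) 0 = -1"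
    and e: "0 < e"
  obtains g R \<delta> \<epsilon> where "0 < \<delta>" "\<delta> < R" "R < r" "R < e" "0 < \<epsilon>" "\<epsilon> < e"
    "smooth_on g (ball 0 r - {0})"
    "\<And>\<xi>. \<xi> \<in> ball 0 r - {0} \<Longrightarrow> dbar g \<xi> \<noteq> 0"
    "\<And>\<xi>. R \<le> norm \<xi> \<Longrightarrow> g \<xi> = F \<xi>"
    "\<And>\<xi>. norm \<xi> < \<delta> \<Longrightarrow> g \<xi> = F 0 + of_real \<epsilon> * (cnj \<xi> * inverse \<xi>)"
    "\<And>\<xi>. \<xi> \<noteq> 0 \<Longrightarrow> norm \<xi> \<le> R \<Longrightarrow> norm (g \<xi> - F 0) < e"
proof -
  define P where "P = ball (0::complex) r - {0}"
  have P: "open P" unfolding P_def by (rule open_punctured_ball)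
  have FP: "smooth_on F P" by (rule smooth_on_subset[OF F]) (auto simp: P_def)
  have nzP: "dbar F \<xi> \<noteq> 0" "\<xi> \<noteq> 0" if "\<xi> \<in> P" for \<xi> using that nz by (auto simp: P_def)
  obtain \<rho>1 where "\<rho>1 > 0" "\<And>y. 0 < y \<Longrightarrow> y < \<rho>1 \<Longrightarrow> winding_number (dbar F \<circ> circlepath 0 y) 0 = -1"
    using wn unfolding eventually_at_right_field by auto
  then have "winding_number (dbar F \<circ> circlepath 0 (min \<rho>1 r / 2)) 0 = -1" "0 < min \<rho>1 r / 2" "min \<rho>1 r / 2 < r"
    using r by auto
  then obtain b where b: "smooth_on b P" "\<And>\<xi>. \<xi> \<in> P \<Longrightarrow> \<xi> * dbar F \<xi> = exp (b \<xi>)"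
    using smooth_log_punctured_disc[of "min \<rho>1 r / 2" r "dbar F"] nz smooth_on_dbar[OF P FP]
    unfolding P_def by metis
  have "isCont F 0"
    using smooth_on_imp_continuous_on[OF F] r by (simp add: continuous_on_eq_continuous_at)
  then obtain d where d: "d > 0" "\<And>\<xi>. norm \<xi> < d \<Longrightarrow> norm (F \<xi> - F 0) < e / 4"
    using e unfolding continuous_at_eps_delta by (metis diff_zero dist_norm zero_less_divide_iff zero_less_numeral)
  define R where "R = min (min r e) d / 2"
  have R: "0 < R" "R < r" "R < e" "R < d" using r e d(1) by (auto simp: R_def)
  define a where "a = (R/2)^2"
  have a: "a > 0" using R by (simp add: a_def)
  have nR: "4 * a \<le> (norm \<xi>)^2 \<longleftrightarrow> R \<le> norm \<xi>" "(norm \<xi>)^2 \<le> 4 * a \<longleftrightarrow> norm \<xi> \<le> R"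
     "(norm \<xi>)^2 < a \<longleftrightarrow> norm \<xi> < R/2" for \<xi> :: complex
    using R abs_le_square_iff[of R "norm \<xi>"] abs_le_square_iff[of "norm \<xi>" R] abs_le_square_iff[of "R/2" "norm \<xi>"]
    by (auto simp: a_def power_divide not_le[symmetric])
  define \<epsilon> where "\<epsilon> = e / 8"
  have \<epsilon>: "0 < \<epsilon>" "\<epsilon> < e" using e by (auto simp: \<epsilon>_def)
  \<comment> \<open>With \<open>\<tau> = |\<xi>|\<^sup>2 / a\<close>, the cutoff \<open>\<alpha>\<close> varies only for \<open>9/4 \<le> \<tau> \<le> 11/4\<close>, inside the region
      \<open>2 \<le> \<tau> \<le> 3\<close> where \<open>\<kappa> = 1\<close>; and \<open>\<kappa>\<close> is supported in \<open>1 \<le> \<tau> \<le> 4\<close>.\<close>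
  define \<alpha> where "\<alpha> \<xi> = complex_of_real (smooth_step ((2/a) * (norm \<xi>)^2 + (-9/2)))" for \<xi> :: complex
  define \<kappa>' where "\<kappa>' \<xi> = smooth_step ((1/a) * (norm \<xi>)^2 + (-1)) * smooth_step ((-1/a) * (norm \<xi>)^2 + 4)" for \<xi> :: complex
  define \<kappa> where "\<kappa> \<xi> = complex_of_real (\<kappa>' \<xi>)" for \<xi>
  have \<alpha>_smooth: "smooth_on \<alpha> P" unfolding \<alpha>_def by (rule smooth_on_step_of_norm[OF P])
  have \<kappa>_smooth: "smooth_on \<kappa> P" unfolding \<kappa>_def \<kappa>'_def of_real_mult
    by (intro smooth_on_mult smooth_on_step_of_norm P)
  have \<alpha>0: "\<alpha> \<xi> = 0" if "(norm \<xi>)^2 < 9/4 * a" for \<xi>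
    using that a by (simp add: \<alpha>_def smooth_step_eq_0 field_simps)
  have \<alpha>1: "\<alpha> \<xi> = 1" if "(norm \<xi>)^2 > 11/4 * a" for \<xi>
    using that a by (simp add: \<alpha>_def smooth_step_eq_1 field_simps)
  have \<kappa>0: "\<kappa> \<xi> = 0" if "(norm \<xi>)^2 \<le> a \<or> 4 * a \<le> (norm \<xi>)^2" for \<xi>
  proof -
    have "(1/a) * (norm \<xi>)^2 + (-1) \<le> 0 \<or> (-1/a) * (norm \<xi>)^2 + 4 \<le> 0"
      using that a by (auto simp: field_simps)
    then show ?thesis by (auto simp: \<kappa>_def \<kappa>'_def smooth_step_eq_0)
  qed
  have \<kappa>1: "\<kappa> \<xi> = 1" if "2 * a \<le> (norm \<xi>)^2" "(norm \<xi>)^2 \<le> 3 * a" for \<xi>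
  proof -
    have "(1/a) * (norm \<xi>)^2 + (-1) \<ge> 1" "(-1/a) * (norm \<xi>)^2 + 4 \<ge> 1"
      using that a by (auto simp: field_simps)
    then show ?thesis by (simp add: \<kappa>_def \<kappa>'_def smooth_step_eq_1)
  qed
  have \<kappa>'_nonneg: "0 \<le> \<kappa>' \<xi>" for \<xi> by (simp add: \<kappa>'_def smooth_step_range)
  define m where "m \<xi> = cnj \<xi> * inverse \<xi>" for \<xi>
  have m_norm: "norm (m \<xi>) = 1" if "\<xi> \<noteq> 0" for \<xi>
    using that by (simp add: m_def norm_mult norm_inverse)
  have m_smooth: "smooth_on m P" unfolding m_def
    using nzP by (intro smooth_on_mult smooth_on_linear bounded_linear_cnj P holomorphic_imp_smooth_on holomorphic_intros) auto
  have m_dbar: "has_dbar m (inverse \<xi>) \<xi>" if "\<xi> \<noteq> 0" for \<xi>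
    using has_dbar_mult[OF has_dbar_cnj has_dbar_holomorphic[OF DERIV_inverse[OF that]]]
    by (simp add: m_def[abs_def])
  define H where "H \<xi> = m \<xi> * exp (\<alpha> \<xi> * b \<xi>)" for \<xi>
  have H_smooth: "smooth_on H P" unfolding H_def
    by (intro smooth_on_mult m_smooth smooth_on_holomorphic_compose[where g=exp and T=UNIV]
        \<alpha>_smooth b P open_UNIV holomorphic_intros) auto
  have H_nz: "H \<xi> \<noteq> 0" if "\<xi> \<in> P" for \<xi>
    using nzP[OF that] by (simp add: H_def m_def)
  define \<Phi> where "\<Phi> \<xi> = \<kappa> \<xi> * H \<xi>" for \<xi>
  have \<Phi>_smooth: "smooth_on \<Phi> P" unfolding \<Phi>_def by (intro smooth_on_mult \<kappa>_smooth H_smooth P)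
  define G0 where "G0 \<xi> = \<alpha> \<xi> * F \<xi> + (1 - \<alpha> \<xi>) * (F 0 + of_real \<epsilon> * m \<xi>)" for \<xi>
  have G0_smooth: "smooth_on G0 P" unfolding G0_def
    by (intro smooth_on_add smooth_on_mult smooth_on_diff smooth_on_const \<alpha>_smooth m_smooth FP P)
  define W where "W \<xi> = cnj \<xi> * dbar G0 \<xi>" for \<xi>
  have W_cont: "continuous_on P W" unfolding W_def
    by (intro continuous_intros smooth_on_imp_continuous_on smooth_on_dbar P G0_smooth)
  have \<Phi>_cont: "continuous_on P \<Phi>" by (rule smooth_on_imp_continuous_on[OF \<Phi>_smooth])
  have H_cont: "continuous_on P H" by (rule smooth_on_imp_continuous_on[OF H_smooth])
  have model_dbar: "has_dbar (\<lambda>\<xi>. F 0 + of_real \<epsilon> * m \<xi>) (of_real \<epsilon> * inverse \<xi>) \<xi>" if "\<xi> \<noteq> 0" for \<xi>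
    using has_dbar_add[OF has_dbar_const has_dbar_cmult[OF m_dbar[OF that]]] by simp
  have W_inner: "W \<xi> = of_real \<epsilon> * H \<xi>" if "\<xi> \<in> P" "(norm \<xi>)^2 < 9/4 * a" for \<xi>
  proof -
    have "has_dbar G0 (of_real \<epsilon> * inverse \<xi>) \<xi>"
    proof (rule has_dbar_transform[OF model_dbar])
      show "open {\<xi>::complex. (norm \<xi>)^2 < 9/4 * a}" by (intro open_Collect_less continuous_intros)
    qed (use that nzP \<alpha>0 in \<open>auto simp: G0_def\<close>)
    then show ?thesis using that \<alpha>0 by (simp add: W_def has_dbar_imp_dbar H_def m_def)
  qed
  have W_outer: "W \<xi> = H \<xi>" if "\<xi> \<in> P" "(norm \<xi>)^2 > 11/4 * a" for \<xi>
  proof -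
    have "has_dbar G0 (dbar F \<xi>) \<xi>"
    proof (rule has_dbar_transform[OF smooth_on_imp_has_dbar[OF FP that(1)]])
      show "open {\<xi>::complex. (norm \<xi>)^2 > 11/4 * a}" by (intro open_Collect_less continuous_intros)
    qed (use that \<alpha>1 in \<open>auto simp: G0_def\<close>)
    then show ?thesis
      using that \<alpha>1 nzP[OF that(1)] b(2)[OF that(1), symmetric]
      by (simp add: W_def has_dbar_imp_dbar H_def m_def)
  qed
  define A where "A = {\<xi>::complex. a \<le> (norm \<xi>)^2 \<and> (norm \<xi>)^2 \<le> 4 * a}"
  have A_eq: "A = cball 0 R - ball 0 (R/2)"
    using nR by (auto simp: A_def not_less[symmetric])
  have "compact A" unfolding A_eq by (intro compact_diff compact_cball open_ball)
  have "A \<subseteq> P" using R by (auto simp: A_eq P_def)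
  have "complex_of_real R \<in> A" using R by (simp add: A_eq)
  have bounded: "\<exists>B\<ge>0. \<forall>\<xi>\<in>A. norm (f \<xi>) \<le> B" if "continuous_on P f" for f :: "complex \<Rightarrow> complex"
  proof -
    have "bounded (f ` A)"
      by (rule compact_imp_bounded[OF compact_continuous_image[OF continuous_on_subset[OF that \<open>A \<subseteq> P\<close>] \<open>compact A\<close>]])
    then obtain B where B: "\<forall>x\<in>f ` A. norm x \<le> B" unfolding bounded_iff by blast
    then show ?thesis by (intro exI[of _ "max B 0"]) auto
  qed
  obtain M where M: "M \<ge> 0" "\<And>\<xi>. \<xi> \<in> A \<Longrightarrow> norm (W \<xi> / H \<xi>) \<le> M"
    using bounded[of "\<lambda>\<xi>. W \<xi> / H \<xi>"] W_cont H_cont H_nz by (auto intro: continuous_on_divide)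
  \<comment> \<open>The points of the parabola have modulus greater than \<open>1/2\<close>, so with this factor they exceed \<open>W / H\<close>.\<close>
  define K where "K = 2 * M + 1"
  have "K > 0" using M by (simp add: K_def)
  \<comment> \<open>The value of \<open>cnj \<xi> dbar g\<close> up to \<open>O(1/N)\<close>, with \<open>y\<close> in place of the cosine of the fast phase.\<close>
  define \<Psi> where "\<Psi> \<xi> y = W \<xi> + of_real K * (\<Phi> \<xi> * parabola y)" for \<xi> y
  have \<Psi>_nz: "\<Psi> \<xi> y \<noteq> 0" if \<xi>: "\<xi> \<in> A" for \<xi> y
  proof -
    have "\<xi> \<in> P" using \<xi> \<open>A \<subseteq> P\<close> by blast
    consider "(norm \<xi>)^2 < 9/4 * a" | "(norm \<xi>)^2 > 11/4 * a" | "2 * a \<le> (norm \<xi>)^2" "(norm \<xi>)^2 \<le> 3 * a"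
      using a by linarith
    then show ?thesis
    proof cases
      case 1
      have "\<Psi> \<xi> y = H \<xi> * (of_real \<epsilon> + of_real (K * \<kappa>' \<xi>) * parabola y)"
        using W_inner[OF \<open>\<xi> \<in> P\<close> 1] by (simp add: \<Psi>_def \<Phi>_def \<kappa>_def algebra_simps)
      then show ?thesis
        using H_nz[OF \<open>\<xi> \<in> P\<close>] one_plus_parabola_nonzero[of "K * \<kappa>' \<xi>" \<epsilon> y] \<epsilon> \<kappa>'_nonneg \<open>K > 0\<close> by simp
    next
      case 2
      have "\<Psi> \<xi> y = H \<xi> * (of_real 1 + of_real (K * \<kappa>' \<xi>) * parabola y)"
        using W_outer[OF \<open>\<xi> \<in> P\<close> 2] by (simp add: \<Psi>_def \<Phi>_def \<kappa>_def algebra_simps)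
      then show ?thesis
        using H_nz[OF \<open>\<xi> \<in> P\<close>] one_plus_parabola_nonzero[of "K * \<kappa>' \<xi>" 1 y] \<kappa>'_nonneg \<open>K > 0\<close> by simp
    next
      case 3
      have "\<Psi> \<xi> y = H \<xi> * (W \<xi> / H \<xi> + of_real K * parabola y)"
        using \<kappa>1[OF 3] H_nz[OF \<open>\<xi> \<in> P\<close>] by (simp add: \<Psi>_def \<Phi>_def field_simps)
      moreover have "W \<xi> / H \<xi> + of_real K * parabola y \<noteq> 0"
      proof
        assume "W \<xi> / H \<xi> + of_real K * parabola y = 0"
        then have "norm (W \<xi> / H \<xi>) = norm (of_real K * parabola y)"
          by (metis add_eq_0_iff norm_minus_cancel)
        also have "\<dots> = K * norm (parabola y)" using \<open>K > 0\<close> by (simp add: norm_mult)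
        also have "\<dots> > K * (1/2)" using \<open>K > 0\<close> norm_parabola_gt by (intro mult_strict_left_mono)
        finally show False using M(2)[OF \<xi>] by (simp add: K_def)
      qed
      ultimately show ?thesis using H_nz[OF \<open>\<xi> \<in> P\<close>] by simp
    qed
  qed
  have "continuous_on (A \<times> {-1..1}) (\<lambda>p. norm (\<Psi> (fst p) (snd p)))"
    unfolding \<Psi>_def parabola_def Complex_eq using \<open>A \<subseteq> P\<close>
    by (intro continuous_intros continuous_on_compose2[OF W_cont] continuous_on_compose2[OF \<Phi>_cont]) auto
  moreover have "compact (A \<times> {-1..1::real})" by (intro compact_Times \<open>compact A\<close> compact_Icc)
  moreover have "A \<times> {-1..1::real} \<noteq> {}" using \<open>complex_of_real R \<in> A\<close> by auto
  ultimately obtain p0 where p0: "p0 \<in> A \<times> {-1..1::real}"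
      "\<And>p. p \<in> A \<times> {-1..1} \<Longrightarrow> norm (\<Psi> (fst p0) (snd p0)) \<le> norm (\<Psi> (fst p) (snd p))"
    using continuous_attains_inf[of "A \<times> {-1..1::real}" "\<lambda>p. norm (\<Psi> (fst p) (snd p))"] by blast
  define m0 where "m0 = norm (\<Psi> (fst p0) (snd p0))"
  have m0: "m0 > 0" "\<And>\<xi> y. \<xi> \<in> A \<Longrightarrow> -1 \<le> y \<Longrightarrow> y \<le> 1 \<Longrightarrow> m0 \<le> norm (\<Psi> \<xi> y)"
    using p0(1) \<Psi>_nz[of "fst p0"] p0(2)[of "(_, _)"] by (auto simp: m0_def)
  obtain B where B: "B \<ge> 0" "\<And>\<xi>. \<xi> \<in> A \<Longrightarrow> norm (cnj \<xi> * dbar \<Phi> \<xi>) \<le> B"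
    using bounded[OF continuous_on_mult[OF continuous_on_cnj[OF continuous_on_id]
        smooth_on_imp_continuous_on[OF smooth_on_dbar[OF P \<Phi>_smooth]]]] by auto
  obtain B' where B': "B' \<ge> 0" "\<And>\<xi>. \<xi> \<in> A \<Longrightarrow> norm (\<Phi> \<xi>) \<le> B'"
    using bounded[OF \<Phi>_cont] by blast
  \<comment> \<open>The second summand controls the error in the derivative, the third the size of the perturbation.\<close>
  define N where "N = 1 + 2 * K * B / m0 + 4 * K * B' / e"
  have N: "N > 0" "K / N * (B * 2) < m0" "K / N * (B' * 2) < e / 2"
  proof -
    have *: "0 \<le> 2 * K * B / m0" "0 \<le> 4 * K * B' / e" using \<open>K > 0\<close> B(1) B'(1) m0(1) e by auto
    then show "N > 0" by (simp add: N_def)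
    have "2 * K * B / m0 < N" "4 * K * B' / e < N" using * by (auto simp: N_def)
    then show "K / N * (B * 2) < m0" "K / N * (B' * 2) < e / 2"
      using \<open>N > 0\<close> m0(1) e by (auto simp: field_simps)
  qed
  have norm_KN: "norm (complex_of_real (K / N)) = K / N"
    unfolding norm_of_real using \<open>K > 0\<close> N(1) by simp
  define T where "T \<xi> = Ln (\<xi> * cnj \<xi>)" for \<xi>
  have pos: "\<xi> * cnj \<xi> \<notin> \<real>\<^sub>\<le>\<^sub>0" if "\<xi> \<noteq> 0" for \<xi>
    using that unfolding complex_norm_square[symmetric] complex_nonpos_Reals_iff by simp
  have T_real: "T \<xi> = of_real (ln ((norm \<xi>)^2))" if "\<xi> \<noteq> 0" for \<xi>
    using that Ln_of_real[of "(norm \<xi>)^2"] unfolding T_def complex_norm_square[symmetric] by simp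
  have T_smooth: "smooth_on T P" unfolding T_def
  proof (rule smooth_on_holomorphic_compose[where g=Ln and T="- \<real>\<^sub>\<le>\<^sub>0"])
    show "smooth_on (\<lambda>\<xi>. \<xi> * cnj \<xi>) P"
      by (intro smooth_on_mult smooth_on_id smooth_on_linear bounded_linear_cnj P)
  qed (use pos nzP P in \<open>auto intro!: holomorphic_intros\<close>)
  have T_dbar: "has_dbar T (inverse (cnj \<xi>)) \<xi>" if "\<xi> \<noteq> 0" for \<xi>
  proof -
    have "has_dbar (\<lambda>z. z * cnj z) \<xi> \<xi>"
      using has_dbar_mult[OF has_dbar_holomorphic[OF DERIV_ident] has_dbar_cnj] by simp
    from has_dbar_holomorphic_compose[OF this has_field_derivative_Ln[OF pos[OF that]]]
    show ?thesis using that by (simp add: T_def[abs_def] field_simps)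
  qed
  define g where "g \<xi> = G0 \<xi> + of_real (K / N) * (\<Phi> \<xi> * parabola_primitive (of_real N * T \<xi>))" for \<xi>
  have g_smooth: "smooth_on g P" unfolding g_def
    by (intro smooth_on_add smooth_on_mult smooth_on_const G0_smooth \<Phi>_smooth T_smooth P
        smooth_on_holomorphic_compose[where g=parabola_primitive and T=UNIV])
      (auto simp: parabola_primitive_def[abs_def] intro!: holomorphic_intros)
  have g_inner: "g \<xi> = F 0 + of_real \<epsilon> * m \<xi>" if "(norm \<xi>)^2 \<le> a" for \<xi>
  proof -
    have "(norm \<xi>)^2 < 9/4 * a" using that a by linarith
    then show ?thesis using \<alpha>0 \<kappa>0 that by (simp add: g_def G0_def \<Phi>_def)
  qed
  have g_outer: "g \<xi> = F \<xi>" if "4 * a \<le> (norm \<xi>)^2" for \<xi>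
  proof -
    have "(norm \<xi>)^2 > 11/4 * a" using that a by linarith
    then show ?thesis using \<alpha>1 \<kappa>0 that by (simp add: g_def G0_def \<Phi>_def)
  qed
  have g_nz: "dbar g \<xi> \<noteq> 0" if \<xi>: "\<xi> \<in> P" for \<xi>
  proof -
    have "\<xi> \<noteq> 0" using nzP \<xi> by blast
    consider "(norm \<xi>)^2 < a" | "(norm \<xi>)^2 > 4 * a" | "\<xi> \<in> A" by (force simp: A_def)
    then show ?thesis
    proof cases
      case 1
      have "has_dbar g (of_real \<epsilon> * inverse \<xi>) \<xi>"
      proof (rule has_dbar_transform[OF model_dbar[OF \<open>\<xi> \<noteq> 0\<close>]])
        show "open {\<xi>::complex. (norm \<xi>)^2 < a}" by (intro open_Collect_less continuous_intros)
      qed (use 1 g_inner in auto)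
      then show ?thesis using \<epsilon> \<open>\<xi> \<noteq> 0\<close> by (simp add: has_dbar_imp_dbar)
    next
      case 2
      have "has_dbar g (dbar F \<xi>) \<xi>"
      proof (rule has_dbar_transform[OF smooth_on_imp_has_dbar[OF FP \<xi>]])
        show "open {\<xi>::complex. (norm \<xi>)^2 > 4 * a}" by (intro open_Collect_less continuous_intros)
      qed (use 2 g_outer in auto)
      then show ?thesis using nzP[OF \<xi>] by (simp add: has_dbar_imp_dbar)
    next
      case 3
      define u where "u = N * ln ((norm \<xi>)^2)"
      have u: "of_real N * T \<xi> = of_real u" using T_real[OF \<open>\<xi> \<noteq> 0\<close>] by (simp add: u_def)
      have "has_dbar (\<lambda>\<xi>. of_real N * T \<xi>) (of_real N * inverse (cnj \<xi>)) \<xi>"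
        by (rule has_dbar_cmult[OF T_dbar[OF \<open>\<xi> \<noteq> 0\<close>]])
      from has_dbar_holomorphic_compose[OF this, of parabola_primitive "parabola (cos u)"]
      have "has_dbar (\<lambda>\<xi>. parabola_primitive (of_real N * T \<xi>)) (parabola (cos u) * (of_real N * inverse (cnj \<xi>))) \<xi>"
        using parabola_primitive_deriv[of u] u by simp
      from has_dbar_add[OF smooth_on_imp_has_dbar[OF G0_smooth \<xi>] has_dbar_cmult[OF has_dbar_mult[OF
          smooth_on_imp_has_dbar[OF \<Phi>_smooth \<xi>] this], of "of_real (K / N)"]]
      have "has_dbar g (dbar G0 \<xi> + of_real (K / N) * (\<Phi> \<xi> * (parabola (cos u) * (of_real N * inverse (cnj \<xi>)))
          + dbar \<Phi> \<xi> * parabola_primitive (of_real u))) \<xi>"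
        unfolding u by (simp add: g_def[abs_def])
      then have "cnj \<xi> * dbar g \<xi> = \<Psi> \<xi> (cos u) + of_real (K / N) * ((cnj \<xi> * dbar \<Phi> \<xi>) * parabola_primitive (of_real u))"
        using \<open>\<xi> \<noteq> 0\<close> \<open>N > 0\<close> by (simp add: has_dbar_imp_dbar \<Psi>_def W_def field_simps)
      moreover have "norm (of_real (K / N) * ((cnj \<xi> * dbar \<Phi> \<xi>) * parabola_primitive (of_real u))) \<le> K / N * (B * 2)"
        unfolding norm_mult[of "of_real (K / N)"] norm_mult[of "cnj \<xi> * dbar \<Phi> \<xi>"] norm_KN
        using \<open>K > 0\<close> \<open>N > 0\<close> B(1) B(2)[OF 3] norm_parabola_primitive_le[of u]
        by (intro mult_mono mult_nonneg_nonneg norm_ge_zero order_refl) auto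
      moreover have "m0 \<le> norm (\<Psi> \<xi> (cos u))" using m0(2)[OF 3] by simp
      ultimately have "cnj \<xi> * dbar g \<xi> \<noteq> 0"
        using N(2) by (smt (verit) add_eq_0_iff norm_minus_cancel)
      then show ?thesis by auto
    qed
  qed
  have g_close: "norm (g \<xi> - F 0) < e" if \<xi>: "\<xi> \<noteq> 0" "norm \<xi> \<le> R" for \<xi>
  proof (cases "\<xi> \<in> A")
    case False
    then have "(norm \<xi>)^2 \<le> a" using \<xi> nR by (auto simp: A_def)
    then show ?thesis using g_inner m_norm[OF \<xi>(1)] \<epsilon> by (simp add: norm_mult)
  next
    case True
    define u where "u = N * ln ((norm \<xi>)^2)"
    have u: "of_real N * T \<xi> = of_real u" using T_real[OF \<open>\<xi> \<noteq> 0\<close>] by (simp add: u_def)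
    define s where "s = smooth_step ((2/a) * (norm \<xi>)^2 + (-9/2))"
    have s: "0 \<le> s" "s \<le> 1" "\<alpha> \<xi> = of_real s" by (simp_all add: s_def \<alpha>_def smooth_step_range)
    have "g \<xi> - F 0 = of_real s * (F \<xi> - F 0) + of_real (1 - s) * (of_real \<epsilon> * m \<xi>)
        + of_real (K / N) * (\<Phi> \<xi> * parabola_primitive (of_real u))"
      unfolding g_def G0_def u s(3) by (simp add: algebra_simps)
    also have "norm \<dots> \<le> norm (of_real s * (F \<xi> - F 0)) + norm (of_real (1 - s) * (of_real \<epsilon> * m \<xi>))
        + norm (of_real (K / N) * (\<Phi> \<xi> * parabola_primitive (of_real u)))"
      by (intro norm_triangle_mono order_refl)
    also have "norm (of_real s * (F \<xi> - F 0)) \<le> 1 * (e / 4)"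
      unfolding norm_mult using s d(2)[of \<xi>] \<xi>(2) R by (intro mult_mono) auto
    also have "norm (of_real (1 - s) * (of_real \<epsilon> * m \<xi>)) \<le> 1 * \<epsilon>"
      unfolding norm_mult m_norm[OF \<xi>(1)] norm_of_real using s \<epsilon> by (intro mult_mono) auto
    also have "norm (of_real (K / N) * (\<Phi> \<xi> * parabola_primitive (of_real u))) \<le> K / N * (B' * 2)"
      unfolding norm_mult[of "of_real (K / N)"] norm_mult[of "\<Phi> \<xi>"] norm_KN
      using \<open>K > 0\<close> \<open>N > 0\<close> B'(1) B'(2)[OF True] norm_parabola_primitive_le[of u]
      by (intro mult_mono mult_nonneg_nonneg norm_ge_zero order_refl) auto
    also have "1 * (e / 4) + 1 * \<epsilon> + K / N * (B' * 2) < e" using N(3) \<epsilon>_def e by linarith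
    finally show ?thesis by simp
  qed
  show thesis
  proof (rule that[of "R/2" R \<epsilon> g])
    show "g \<xi> = F 0 + of_real \<epsilon> * (cnj \<xi> * inverse \<xi>)" if "norm \<xi> < R/2" for \<xi>
      using g_inner[of \<xi>] nR(3)[of \<xi>] that by (simp add: m_def)
  qed (use R \<epsilon> g_smooth g_nz g_outer g_close nR in \<open>auto simp: P_def\<close>)
qed

section \<open>Real surfaces in holomorphic coordinates\<close>

text \<open>For linear \<open>L\<close> this says that \<open>L\<close> is injective and that its range is a totally real plane.\<close>

definition totally_real_map :: "(complex \<Rightarrow> complex \<times> complex) \<Rightarrow> bool" where
  "totally_real_map L \<longleftrightarrow> (\<forall>a b. L a = complex_structure (L b) \<longrightarrow> b = 0)"

lemma linear_complex_structure: "linear complex_structure"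
  by (auto intro!: linearI simp: complex_structure_def algebra_simps scaleR_conv_of_real)

lemma totally_real_map_imp_inj:
  assumes "linear L" "totally_real_map L" shows "inj L"
proof -
  have "b = 0" if "L b = 0" for b
  proof -
    have "complex_structure (L b) = L 0"
      using that linear_0[OF assms(1)] linear_0[OF linear_complex_structure] by simp
    then show ?thesis using assms(2) unfolding totally_real_map_def by metis
  qed
  then show ?thesis using linear_injective_0[OF assms(1)] by blast
qed

text \<open>Velocities of curves inside the image of an injectively immersed and homeomorphically embedded
  piece are tangent to that piece: the parameter of the curve point depends at least Lipschitz
  continuously on the point, so difference quotients of the curve are asymptotic to the plane
  \<open>range L\<close>, which is closed.\<close>

lemma velocity_in_range:
  fixes f :: "complex \<Rightarrow> complex \<times> complex" and c :: "real \<Rightarrow> complex \<times> complex" and y :: "real \<Rightarrow> complex"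
  assumes f: "(f has_derivative L) (at x)" "inj L"
    and c: "(c has_vector_derivative v) (at 0)" "c 0 = f x"
    and y: "(y \<longlongrightarrow> x) (at 0)" "\<forall>\<^sub>F t in at 0. f (y t) = c t"
  shows "v \<in> range L"
proof -
  have lin: "linear L" using f(1) by (rule has_derivative_linear)
  obtain B where B: "B > 0" "\<And>h. B * norm h \<le> norm (L h)"
    using linear_inj_bounded_below_pos[OF lin f(2)] by metis
  have "closed (range L)"
    by (rule closed_subspace[OF linear_subspace_image[OF lin subspace_UNIV]])
  moreover have "v \<in> closure (range L)"
    unfolding closure_approachable
  proof (intro allI impI)
    fix \<eta> :: real assume "\<eta> > 0"
    define \<epsilon> where "\<epsilon> = min (B/2) (\<eta> * B / (4 * (norm v + 1)))"
    have vp: "norm v + 1 > 0" using norm_ge_zero[of v] by linarith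
    have \<epsilon>: "\<epsilon> > 0" "\<epsilon> \<le> B/2" "\<epsilon> * (2/B) * (norm v + 1) \<le> \<eta>/2"
    proof -
      show "\<epsilon> > 0" using B(1) \<open>\<eta> > 0\<close> vp by (auto simp: \<epsilon>_def)
      show "\<epsilon> \<le> B/2" unfolding \<epsilon>_def by (rule min.cobounded1)
      have "\<epsilon> \<le> \<eta> * B / (4 * (norm v + 1))" unfolding \<epsilon>_def by (rule min.cobounded2)
      then show "\<epsilon> * (2/B) * (norm v + 1) \<le> \<eta>/2" using B(1) vp by (simp add: field_simps)
    qed
    have "\<exists>d>0. \<forall>z. norm (z - x) < d \<longrightarrow> norm (f z - f x - L (z - x)) \<le> \<epsilon> * norm (z - x)"
      using f(1) \<epsilon>(1) unfolding has_derivative_at_alt by blast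
    then obtain d where d: "d > 0" "\<And>z. norm (z - x) < d \<Longrightarrow> norm (f z - f x - L (z - x)) \<le> \<epsilon> * norm (z - x)"
      by blast
    have ev1: "\<forall>\<^sub>F t in at 0. norm (y t - x) < d"
      using y(1) d(1) by (simp add: tendsto_iff dist_norm)
    define \<mu> where "\<mu> = min 1 (\<eta>/2) / 2"
    have \<mu>: "\<mu> > 0" "\<mu> < min 1 (\<eta>/2)" using \<open>\<eta> > 0\<close> by (auto simp: \<mu>_def min_def)
    have "(c has_derivative (\<lambda>t. t *\<^sub>R v)) (at 0)" using c(1) by (simp add: has_vector_derivative_def)
    then obtain d' where d': "d' > 0" "\<And>t. norm (t - 0) < d' \<Longrightarrow> norm (c t - c 0 - (t - 0) *\<^sub>R v) \<le> \<mu> * norm (t - 0)"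
      using \<mu>(1) unfolding has_derivative_at_alt by blast
    have "norm ((c t - c 0) /\<^sub>R t - v) < min 1 (\<eta>/2)" if "t \<noteq> 0" "dist t 0 < d'" for t
    proof -
      have "(c t - c 0) /\<^sub>R t - v = (c t - c 0 - t *\<^sub>R v) /\<^sub>R t"
        using that(1) by (simp add: scaleR_diff_right)
      then have "norm ((c t - c 0) /\<^sub>R t - v) \<le> \<mu>"
        using d'(2)[of t] that by (simp add: dist_norm divide_simps mult.commute)
      then show ?thesis using \<mu>(2) by linarith
    qed
    then have ev2: "\<forall>\<^sub>F t in at 0. norm ((c t - c 0) /\<^sub>R t - v) < min 1 (\<eta>/2)"
      unfolding eventually_at using d'(1) by blast
    have ev3: "\<forall>\<^sub>F t::real in at 0. t \<noteq> 0" by (simp add: eventually_at_filter)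
    have "\<forall>\<^sub>F t in at (0::real). f (y t) = c t \<and> norm (y t - x) < d \<and>
        norm ((c t - c 0) /\<^sub>R t - v) < min 1 (\<eta>/2) \<and> t \<noteq> 0"
      using y(2) ev1 ev2 ev3 by eventually_elim simp
    then obtain t where t: "f (y t) = c t" "norm (y t - x) < d"
        "norm ((c t - c 0) /\<^sub>R t - v) < min 1 (\<eta>/2)" "t \<noteq> 0"
      using eventually_happens[of _ "at (0::real)"] trivial_limit_at[of "0::real"] by blast
    define k where "k = y t - x"
    have 1: "norm (c t - c 0 - L k) \<le> \<epsilon> * norm k"
      using d(2)[OF t(2)] t(1) c(2) by (simp add: k_def)
    have "B * norm k \<le> norm (L k)" by (rule B(2))
    also have "\<dots> \<le> norm (c t - c 0) + norm (c t - c 0 - L k)"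
      by (metis add.commute norm_minus_commute norm_triangle_sub)
    also have "\<dots> \<le> norm (c t - c 0) + (B/2) * norm k"
      using 1 mult_right_mono[OF \<epsilon>(2), of "norm k"] by simp
    finally have "norm k \<le> (2/B) * norm (c t - c 0)" using B(1) by (simp add: field_simps)
    then have "norm (c t - c 0 - L k) \<le> \<epsilon> * ((2/B) * norm (c t - c 0))"
      using 1 \<epsilon>(1) by (meson mult_left_mono order_less_imp_le order_trans)
    then have "inverse \<bar>t\<bar> * norm (c t - c 0 - L k) \<le> inverse \<bar>t\<bar> * (\<epsilon> * ((2/B) * norm (c t - c 0)))"
      by (rule mult_left_mono) simp
    then have "norm ((c t - c 0 - L k) /\<^sub>R t) \<le> \<epsilon> * (2/B) * norm ((c t - c 0) /\<^sub>R t)"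
      by (simp add: mult_ac)
    also have "\<dots> \<le> \<epsilon> * (2/B) * (norm v + 1)"
    proof (rule mult_left_mono)
      have "norm ((c t - c 0) /\<^sub>R t) \<le> norm v + norm ((c t - c 0) /\<^sub>R t - v)"
        by (metis norm_triangle_sub)
      then show "norm ((c t - c 0) /\<^sub>R t) \<le> norm v + 1" using t(3) by linarith
    qed (use \<epsilon>(1) B(1) in simp)
    also note \<epsilon>(3)
    finally have 2: "norm ((c t - c 0) /\<^sub>R t - L (k /\<^sub>R t)) \<le> \<eta>/2"
      by (simp add: scaleR_diff_right linear_scale[OF lin])
    have "dist (L (k /\<^sub>R t)) v \<le> norm ((c t - c 0) /\<^sub>R t - L (k /\<^sub>R t)) + norm ((c t - c 0) /\<^sub>R t - v)"
      by (metis dist_norm norm_minus_commute dist_commute dist_triangle)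
    also have "\<dots> < \<eta>" using 2 t(3) by linarith
    finally show "\<exists>z\<in>range L. dist z v < \<eta>" by blast
  qed
  ultimately show ?thesis by (simp add: closure_closed)
qed

lemma is_chart_open_image:
  assumes "is_chart X (U, \<phi>)" "openin X O'"
  shows "open (\<phi> ` (U \<inter> O'))"
proof -
  have h: "homeomorphic_map (subtopology X U) (top_of_set (\<phi> ` U)) \<phi>" and U: "open (\<phi> ` U)"
    using assms by (auto simp: is_chart_def)
  have "openin (subtopology X U) (U \<inter> O')" using assms(2) by (metis inf_commute openin_subtopology_Int)
  then have "openin (top_of_set (\<phi> ` U)) (\<phi> ` (U \<inter> O'))"
    using h homeomorphic_imp_open_map open_map_def by blast
  then show ?thesis using U openin_open_trans by blast
qed

lemma is_chart_continuous_map: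
  assumes "is_chart X (U, \<phi>)"
  shows "continuous_map (subtopology X U) euclidean \<phi>"
  using assms homeomorphic_imp_continuous_map[of "subtopology X U" "top_of_set (\<phi> ` U)" \<phi>]
  by (auto simp: is_chart_def continuous_map_in_subtopology)

lemma is_chart_inj_on:
  assumes "is_chart X (U, \<phi>)" shows "inj_on \<phi> U"
proof -
  have "homeomorphic_map (subtopology X U) (top_of_set (\<phi> ` U)) \<phi>" "U \<subseteq> topspace X"
    using assms openin_subset by (auto simp: is_chart_def)
  then show ?thesis
    using homeomorphic_imp_injective_map by (metis topspace_subtopology_subset)
qed

lemma is_chart_inverse_continuous_map:
  assumes "is_chart X (U, \<phi>)"
  shows "continuous_map (top_of_set (\<phi> ` U)) (subtopology X U) (inv_into U \<phi>)"
proof -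
  have h: "homeomorphic_map (subtopology X U) (top_of_set (\<phi> ` U)) \<phi>" and U: "U \<subseteq> topspace X"
    using assms openin_subset by (auto simp: is_chart_def)
  obtain k where k: "homeomorphic_maps (subtopology X U) (top_of_set (\<phi> ` U)) \<phi> k"
    using h homeomorphic_map_maps by blast
  then have "k y = inv_into U \<phi> y" if "y \<in> \<phi> ` U" for y
    using that U is_chart_inj_on[OF assms]
    by (auto simp: homeomorphic_maps_def inv_into_f_f topspace_subtopology_subset)
  then show ?thesis
    using k continuous_map_eq[of "top_of_set (\<phi> ` U)" "subtopology X U" k "inv_into U \<phi>"]
    by (auto simp: homeomorphic_maps_def)
qed

text \<open>A curve through \<open>p\<close> in \<open>S\<close> stays in the neighbourhood \<open>O'\<close> for a short time, and there \<open>S\<close> and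
  \<open>S'\<close> are the same.\<close>

lemma tangent_space_in_local:
  assumes c: "is_chart X (U, \<phi>)" and O': "openin X O'" "p \<in> O'" "S \<inter> O' = S' \<inter> O'" "p \<in> U"
  shows "tangent_space_in (U, \<phi>) S p \<subseteq> tangent_space_in (U, \<phi>) S' p"
proof
  fix v assume "v \<in> tangent_space_in (U, \<phi>) S p"
  then obtain e g where e: "e > 0" and g: "smooth_on g {-e<..<e}"
      "g ` {-e<..<e} \<subseteq> \<phi> ` (S \<inter> U)" "g 0 = \<phi> p" "(g has_vector_derivative v) (at 0)"
    by (auto simp: tangent_space_in_def)
  have "open ({-e<..<e} \<inter> g -` (\<phi> ` (U \<inter> O')))"
    using smooth_on_imp_continuous_on[OF g(1)] is_chart_open_image[OF c O'(1)]
    by (intro continuous_open_preimage) auto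
  moreover have "0 \<in> {-e<..<e} \<inter> g -` (\<phi> ` (U \<inter> O'))" using e g(3) O' by auto
  ultimately obtain d where d: "d > 0" "ball 0 d \<subseteq> {-e<..<e} \<inter> g -` (\<phi> ` (U \<inter> O'))"
    using open_contains_ball by metis
  have b: "{-d<..<d} = ball 0 d" by (auto simp: dist_real_def)
  have sub: "{-d<..<d} \<subseteq> {-e<..<e}" using d(2) unfolding b by blast
  have "g t \<in> \<phi> ` (S' \<inter> U)" if "t \<in> {-d<..<d}" for t
  proof -
    have "g t \<in> \<phi> ` (U \<inter> O')" "g t \<in> \<phi> ` (S \<inter> U)" using that d(2) g(2) sub unfolding b by blast+
    then obtain q q' where "q \<in> U" "q \<in> O'" "g t = \<phi> q" "q' \<in> S" "q' \<in> U" "g t = \<phi> q'" by blast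
    then have "q = q'" using is_chart_inj_on[OF c] by (metis inj_onD)
    then show ?thesis using \<open>q \<in> O'\<close> \<open>q' \<in> S\<close> \<open>q' \<in> U\<close> \<open>g t = \<phi> q'\<close> O'(3) by blast
  qed
  then show "v \<in> tangent_space_in (U, \<phi>) S' p"
    unfolding tangent_space_in_def using d(1) g(3,4) smooth_on_subset[OF g(1) sub] by blast
qed

locale holomorphic_coordinates =
  fixes X :: "'a topology" and A :: "'a chart set" and U :: "'a set" and \<phi> :: "'a \<Rightarrow> complex \<times> complex"
  assumes surface: "complex_surface X A" and chart: "holomorphic_chart X A (U, \<phi>)"
begin

definition point :: "complex \<times> complex \<Rightarrow> 'a" where "point = inv_into U \<phi>"

lemma is_chart: "is_chart X (U, \<phi>)" using chart by (simp add: holomorphic_chart_def)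

lemma U_subset: "U \<subseteq> topspace X" using is_chart openin_subset by (auto simp: is_chart_def)

lemma point_\<phi>: "x \<in> U \<Longrightarrow> point (\<phi> x) = x"
  using is_chart_inj_on[OF is_chart] by (simp add: point_def)

lemma \<phi>_point: "m \<in> \<phi> ` U \<Longrightarrow> \<phi> (point m) = m"
  by (simp add: point_def f_inv_into_f)

lemma point_in_U: "m \<in> \<phi> ` U \<Longrightarrow> point m \<in> U"
  by (simp add: point_def inv_into_into)

lemma point_inj: "m \<in> \<phi> ` U \<Longrightarrow> m' \<in> \<phi> ` U \<Longrightarrow> point m = point m' \<Longrightarrow> m = m'"
  using \<phi>_point by metis

lemma continuous_map_point:
  "B \<subseteq> \<phi> ` U \<Longrightarrow> continuous_map (top_of_set B) X point"
  using is_chart_inverse_continuous_map[OF is_chart] continuous_map_from_subtopology_mono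
  unfolding point_def by (metis continuous_map_in_subtopology)

lemma openin_coordinates: "open \<Omega> \<Longrightarrow> openin X (U \<inter> \<phi> -` \<Omega>)"
proof -
  assume "open \<Omega>"
  then have "openin (subtopology X U) {x \<in> topspace (subtopology X U). \<phi> x \<in> \<Omega>}"
    using is_chart_continuous_map[OF is_chart] by (simp add: continuous_map_def)
  moreover have "{x \<in> topspace (subtopology X U). \<phi> x \<in> \<Omega>} = U \<inter> \<phi> -` \<Omega>"
    using U_subset by auto
  ultimately show ?thesis
    using is_chart openin_trans_full by (auto simp: is_chart_def)
qed

lemma atlas_chart: "(U', \<phi>') \<in> A \<Longrightarrow> is_chart X (U', \<phi>')"
  using surface by (auto simp: complex_surface_def)

text \<open>The differential of a transition map is invertible because the reverse transition map is differentiable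
  too and the two are inverse to each other.\<close>

lemma transition:
  assumes "(U', \<phi>') \<in> A"
  shows "open (\<phi> ` (U \<inter> U'))" "smooth_on (\<phi>' \<circ> point) (\<phi> ` (U \<inter> U'))"
    and "m \<in> \<phi> ` (U \<inter> U') \<Longrightarrow> \<exists>D. ((\<phi>' \<circ> point) has_derivative D) (at m) \<and> linear D \<and> inj D \<and>
           (\<forall>v. D (complex_structure v) = complex_structure (D v))"
proof -
  have U': "openin X U'" using atlas_chart[OF assms] by (simp add: is_chart_def)
  show op: "open (\<phi> ` (U \<inter> U'))" by (rule is_chart_open_image[OF is_chart U'])
  have hol: "holomorphic2_on (\<phi>' \<circ> inv_into U \<phi>) (\<phi> ` (U \<inter> U'))"
    "holomorphic2_on (\<phi> \<circ> inv_into U' \<phi>') (\<phi>' ` (U' \<inter> U))"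
    using chart assms by (auto simp: holomorphic_chart_def holomorphic_transition_def)
  show "smooth_on (\<phi>' \<circ> point) (\<phi> ` (U \<inter> U'))"
    unfolding point_def by (rule holomorphic2_imp_smooth_on[OF op hol(1)])
  assume m: "m \<in> \<phi> ` (U \<inter> U')"
  then obtain x where x: "x \<in> U" "x \<in> U'" "m = \<phi> x" by blast
  obtain D where D: "((\<phi>' \<circ> point) has_derivative D) (at m)"
      "\<And>v. D (complex_structure v) = complex_structure (D v)"
    using hol(1) m unfolding holomorphic2_on_def point_def by blast
  have "\<phi>' x \<in> \<phi>' ` (U' \<inter> U)" using x by blast
  then obtain E where E: "((\<phi> \<circ> inv_into U' \<phi>') has_derivative E) (at (\<phi>' x))"
    using hol(2) unfolding holomorphic2_on_def by blast
  have "(\<phi>' \<circ> point) m = \<phi>' x" using x by (simp add: point_\<phi>)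
  then have "((\<lambda>m. (\<phi> \<circ> inv_into U' \<phi>') ((\<phi>' \<circ> point) m)) has_derivative (\<lambda>h. E (D h))) (at m)"
    using has_derivative_compose[OF D(1)] E by metis
  moreover have "(\<phi> \<circ> inv_into U' \<phi>') ((\<phi>' \<circ> point) m) = m" if "m \<in> \<phi> ` (U \<inter> U')" for m
    using that is_chart_inj_on[OF atlas_chart[OF assms]] by (auto simp: point_\<phi>)
  ultimately have "((\<lambda>m. m) has_derivative (\<lambda>h. E (D h))) (at m)"
    by (rule has_derivative_transform_within_open[OF _ op m])
  from has_derivative_unique[OF this has_derivative_ident]
  have "inj D" by (metis injI)
  then show "\<exists>D. ((\<phi>' \<circ> point) has_derivative D) (at m) \<and> linear D \<and> inj D \<and>
           (\<forall>v. D (complex_structure v) = complex_structure (D v))"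
    using D has_derivative_linear by blast
qed

end

text \<open>A piece of a surface that is described in a single holomorphic chart. An explicit continuous
  \<open>Q\<close> is used to express that \<open>P\<close> is a homeomorphism onto its image.\<close>

locale coordinate_piece = holomorphic_coordinates +
  fixes S :: "'a set" and V :: "complex set" and P :: "complex \<Rightarrow> complex \<times> complex"
    and Q :: "complex \<times> complex \<Rightarrow> complex"
  assumes V: "open V" and P: "smooth_on P V" "P ` V \<subseteq> \<phi> ` U"
    and Q: "continuous_on (P ` V) Q" "\<And>z. z \<in> V \<Longrightarrow> Q (P z) = z"
    and inS: "openin (subtopology X S) ((\<lambda>z. point (P z)) ` V)"
begin

abbreviation \<psi> where "\<psi> \<equiv> (\<lambda>z. point (P z))"

lemma \<psi>_in_U: "z \<in> V \<Longrightarrow> \<psi> z \<in> U" using P point_in_U by blast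

lemma \<phi>_\<psi>: "z \<in> V \<Longrightarrow> \<phi> (\<psi> z) = P z" using P \<phi>_point by blast

lemma homeomorphic_maps_\<psi>: "homeomorphic_maps (top_of_set V) (subtopology X (\<psi> ` V)) \<psi> (Q \<circ> \<phi>)"
proof -
  have sub: "\<psi> ` V \<subseteq> topspace X" using \<psi>_in_U U_subset by blast
  have "continuous_map (top_of_set V) (top_of_set (P ` V)) P"
    using smooth_on_imp_continuous_on[OF P(1)] by simp
  then have "continuous_map (top_of_set V) X (point \<circ> P)"
    using continuous_map_point[OF P(2)] continuous_map_compose by blast
  then have 1: "continuous_map (top_of_set V) (subtopology X (\<psi> ` V)) \<psi>"
    by (auto simp: continuous_map_in_subtopology o_def)
  have "continuous_map (subtopology X (\<psi> ` V)) euclidean \<phi>"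
    by (rule continuous_map_from_subtopology_mono[OF is_chart_continuous_map[OF is_chart]])
      (use \<psi>_in_U in auto)
  then have "continuous_map (subtopology X (\<psi> ` V)) (top_of_set (P ` V)) \<phi>"
    using \<phi>_\<psi> by (auto simp: continuous_map_in_subtopology)
  moreover have "continuous_map (top_of_set (P ` V)) (top_of_set V) Q"
    using Q by auto
  ultimately have 2: "continuous_map (subtopology X (\<psi> ` V)) (top_of_set V) (Q \<circ> \<phi>)"
    by (rule continuous_map_compose)
  show ?thesis
    unfolding homeomorphic_maps_def using 1 2 sub \<phi>_\<psi> Q(2) by auto
qed

lemma derivative_in_chart:
  assumes c: "(U', \<phi>') \<in> A" and x: "x \<in> V" "\<psi> x \<in> U'"
  obtains D where "((\<phi>' \<circ> \<psi>) has_derivative (\<lambda>h. D (frechet_derivative P (at x) h))) (at x)"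
    "linear D" "inj D" "\<And>v. D (complex_structure v) = complex_structure (D v)"
proof -
  have "P x \<in> \<phi> ` (U \<inter> U')" using x \<phi>_\<psi> \<psi>_in_U by (metis IntI imageI)
  then obtain D where D: "((\<phi>' \<circ> point) has_derivative D) (at (P x))" "linear D" "inj D"
      "\<And>v. D (complex_structure v) = complex_structure (D v)"
    using transition(3)[OF c] by blast
  have "((\<lambda>z. (\<phi>' \<circ> point) (P z)) has_derivative (\<lambda>h. D (frechet_derivative P (at x) h))) (at x)"
    by (rule has_derivative_compose[OF smooth_on_imp_has_derivative[OF P(1) x(1)] D(1)])
  then show thesis using that D by (simp add: o_def)
qed

lemma smooth_in_chart:
  assumes c: "(U', \<phi>') \<in> A"
  shows "open (V \<inter> \<psi> -` U')" "smooth_on (\<phi>' \<circ> \<psi>) (V \<inter> \<psi> -` U')"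
proof -
  have "\<psi> z \<in> U' \<longleftrightarrow> P z \<in> \<phi> ` (U \<inter> U')" if "z \<in> V" for z
  proof
    assume "\<psi> z \<in> U'"
    then show "P z \<in> \<phi> ` (U \<inter> U')" using \<phi>_\<psi>[OF that] \<psi>_in_U[OF that] by (metis IntI imageI)
  next
    assume "P z \<in> \<phi> ` (U \<inter> U')"
    then obtain x where "x \<in> U" "x \<in> U'" "P z = \<phi> x" by blast
    then show "\<psi> z \<in> U'" using point_\<phi> by simp
  qed
  then have eq: "V \<inter> \<psi> -` U' = V \<inter> P -` (\<phi> ` (U \<inter> U'))" by blast
  show op: "open (V \<inter> \<psi> -` U')"
    unfolding eq using smooth_on_imp_continuous_on[OF P(1)] V transition(1)[OF c]
    by (intro continuous_open_preimage)
  have "smooth_on (\<lambda>z. (\<phi>' \<circ> point) (P z)) (V \<inter> \<psi> -` U')"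
    by (rule smooth_on_compose[OF op transition(1,2)[OF c] smooth_on_subset[OF P(1)]])
      (auto simp: eq)
  then show "smooth_on (\<phi>' \<circ> \<psi>) (V \<inter> \<psi> -` U')" by (simp add: o_def)
qed

lemma surface_parametrization_\<psi>:
  assumes "\<And>x. x \<in> V \<Longrightarrow> inj (frechet_derivative P (at x))"
  shows "surface_parametrization X A S V \<psi>"
  unfolding surface_parametrization_def
proof (intro conjI ballI)
  show "open V" by (rule V)
  show "\<psi> ` V \<subseteq> S" using openin_subset[OF inS] by auto
  show "openin (subtopology X S) (\<psi> ` V)" by (rule inS)
  show "homeomorphic_map (top_of_set V) (subtopology X (\<psi> ` V)) \<psi>"
    using homeomorphic_maps_\<psi> homeomorphic_map_maps by blast
  fix c assume c: "c \<in> A"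
  obtain U' \<phi>' where c': "c = (U', \<phi>')" by (cases c)
  have "inj (frechet_derivative (\<phi>' \<circ> \<psi>) (at x))" if x: "x \<in> V \<inter> \<psi> -` U'" for x
  proof -
    obtain D where D: "((\<phi>' \<circ> \<psi>) has_derivative (\<lambda>h. D (frechet_derivative P (at x) h))) (at x)" "inj D"
      using derivative_in_chart[of U' \<phi>' x] c c' x by blast
    have "inj (D \<circ> frechet_derivative P (at x))"
      using D(2) assms x by (intro inj_compose) auto
    then show ?thesis unfolding frechet_derivative_eq[OF D(1)] by (simp add: o_def)
  qed
  then show "case c of (U', \<phi>') \<Rightarrow> smooth_on (\<phi>' \<circ> \<psi>) (V \<inter> \<psi> -` U') \<and>
      (\<forall>x\<in>V \<inter> \<psi> -` U'. inj (frechet_derivative (\<phi>' \<circ> \<psi>) (at x)))"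
    using smooth_in_chart(2) c c' by simp
qed

lemma tangent_space_subset_range:
  assumes c: "(U', \<phi>') \<in> A" and x: "x \<in> V" "\<psi> x \<in> U'"
    and L: "((\<phi>' \<circ> \<psi>) has_derivative L) (at x)" "inj L"
  shows "tangent_space_in (U', \<phi>') S (\<psi> x) \<subseteq> range L"
proof
  fix v assume "v \<in> tangent_space_in (U', \<phi>') S (\<psi> x)"
  then obtain e g where e: "e > 0" and g: "smooth_on g {-e<..<e}"
      "g ` {-e<..<e} \<subseteq> \<phi>' ` (S \<inter> U')" "g 0 = \<phi>' (\<psi> x)" "(g has_vector_derivative v) (at 0)"
    by (auto simp: tangent_space_in_def)
  have ch: "is_chart X (U', \<phi>')" by (rule atlas_chart[OF c])
  obtain O' where O': "openin X O'" "\<psi> ` V = O' \<inter> S"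
    using inS by (auto simp: openin_subtopology)
  let ?q = "inv_into U' \<phi>'"
  define y where "y t = Q (\<phi> (?q (g t)))" for t
  have contg: "continuous_on {-e<..<e} g" by (rule smooth_on_imp_continuous_on[OF g(1)])
  define I where "I = {-e<..<e} \<inter> g -` (\<phi>' ` (U' \<inter> O'))"
  have "open I" unfolding I_def
    using contg is_chart_open_image[OF ch O'(1)] by (intro continuous_open_preimage) auto
  have "0 \<in> I" using e g(3) x O'(2) by (auto simp: I_def)
  have q: "?q (g t) \<in> \<psi> ` V" "?q (g t) \<in> U'" "\<phi>' (?q (g t)) = g t" if t: "t \<in> I" for t
  proof -
    obtain p where p: "p \<in> U'" "p \<in> O'" "g t = \<phi>' p" using t by (auto simp: I_def)
    obtain p' where p': "p' \<in> U'" "p' \<in> S" "g t = \<phi>' p'" using t g(2) unfolding I_def by blast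
    have "p = p'" using p p' is_chart_inj_on[OF ch] by (metis inj_onD)
    moreover have "?q (g t) = p" using p is_chart_inj_on[OF ch] by simp
    ultimately show "?q (g t) \<in> \<psi> ` V" "?q (g t) \<in> U'" "\<phi>' (?q (g t)) = g t"
      using p p' O'(2) by auto
  qed
  have yV: "y t \<in> V" "\<psi> (y t) = ?q (g t)" if "t \<in> I" for t
    using q(1)[OF that] \<phi>_\<psi> Q(2) by (auto simp: y_def)
  have "continuous_map (top_of_set I) (top_of_set (\<phi>' ` U')) g"
    using continuous_on_subset[OF contg, of I] by (auto simp: I_def)
  then have "continuous_map (top_of_set I) (subtopology X U') (?q \<circ> g)"
    using is_chart_inverse_continuous_map[OF ch] continuous_map_compose by blast
  then have "continuous_map (top_of_set I) (subtopology X (\<psi> ` V)) (?q \<circ> g)"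
    using q(1) by (auto simp: continuous_map_in_subtopology)
  then have "continuous_map (top_of_set I) (top_of_set V) ((Q \<circ> \<phi>) \<circ> (?q \<circ> g))"
    using homeomorphic_maps_\<psi> continuous_map_compose unfolding homeomorphic_maps_def by blast
  then have "continuous_on I y"
    by (simp add: y_def[abs_def] o_def)
  then have "isCont y 0" using \<open>open I\<close> \<open>0 \<in> I\<close> by (simp add: continuous_on_eq_continuous_at)
  moreover have "y 0 = x"
    using g(3) x is_chart_inj_on[OF ch] \<phi>_\<psi> Q(2) by (simp add: y_def)
  ultimately have "(y \<longlongrightarrow> x) (at 0)" by (simp add: isCont_def)
  moreover have "\<forall>\<^sub>F t in at 0. (\<phi>' \<circ> \<psi>) (y t) = g t"
    using eventually_nhds_in_open[OF \<open>open I\<close> \<open>0 \<in> I\<close>] unfolding eventually_at_filter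
    by eventually_elim (use yV q in auto)
  ultimately show "v \<in> range L"
    using velocity_in_range[OF L g(4)] g(3) by simp
qed

text \<open>The tangent space contains the nonzero velocity \<open>D (P' 1)\<close> and lies in the plane \<open>range (D \<circ> P')\<close>. If it were
  invariant under the complex structure, that plane would contain \<open>J (D (P' 1)) = D (J (P' 1))\<close>, which total
  reality of \<open>P'\<close> excludes since \<open>D\<close> is injective and complex linear.\<close>

lemma not_complex_point:
  assumes x: "x \<in> V" and tr: "totally_real_map (frechet_derivative P (at x))"
  shows "\<not> complex_point X A S (\<psi> x)"
proof
  assume "complex_point X A S (\<psi> x)"
  then obtain U' \<phi>' where c: "(U', \<phi>') \<in> A" "\<psi> x \<in> U'"
      "complex_structure ` tangent_space_in (U', \<phi>') S (\<psi> x) = tangent_space_in (U', \<phi>') S (\<psi> x)"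
    by (auto simp: complex_point_def)
  let ?T = "tangent_space_in (U', \<phi>') S (\<psi> x)"
  let ?P' = "frechet_derivative P (at x)"
  have linP: "linear ?P'" by (rule has_derivative_linear[OF smooth_on_imp_has_derivative[OF P(1) x]])
  obtain D where D: "((\<phi>' \<circ> \<psi>) has_derivative (\<lambda>h. D (?P' h))) (at x)"
    "linear D" "inj D" "\<And>v. D (complex_structure v) = complex_structure (D v)"
    using derivative_in_chart[OF c(1) x c(2)] by blast
  have inj: "inj (\<lambda>h. D (?P' h))"
    using inj_compose[OF D(3) totally_real_map_imp_inj[OF linP tr]] by (simp add: o_def)
  have sub: "?T \<subseteq> range (\<lambda>h. D (?P' h))"
    by (rule tangent_space_subset_range[OF c(1) x c(2) D(1) inj])
  have "D (?P' 1) \<in> ?T"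
  proof -
    have op: "open (V \<inter> \<psi> -` U')" and sm: "smooth_on (\<phi>' \<circ> \<psi>) (V \<inter> \<psi> -` U')"
      using smooth_in_chart[OF c(1)] by blast+
    obtain e where e: "e > 0" "ball x e \<subseteq> V \<inter> \<psi> -` U'"
      using op x c(2) open_contains_ball by (metis IntI vimageI2)
    let ?l = "\<lambda>t::real. x + of_real t"
    let ?g = "\<lambda>t. (\<phi>' \<circ> \<psi>) (?l t)"
    have l: "?l ` {-e<..<e} \<subseteq> V \<inter> \<psi> -` U'"
      using e(2) by (auto simp: dist_norm subset_iff)
    have "smooth_on ?g {-e<..<e}"
      by (rule smooth_on_compose[OF _ op sm _ l])
        (intro open_greaterThanLessThan smooth_on_add smooth_on_const smooth_on_linear[OF bounded_linear_of_real])+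
    moreover have "?g ` {-e<..<e} \<subseteq> \<phi>' ` (S \<inter> U')"
    proof (rule image_subsetI)
      fix t assume "t \<in> {-e<..<e}"
      then have "?l t \<in> V \<inter> \<psi> -` U'" using l by blast
      moreover have "\<psi> ` V \<subseteq> S" using openin_subset[OF inS] by simp
      ultimately show "?g t \<in> \<phi>' ` (S \<inter> U')" unfolding o_def by (intro imageI) blast
    qed
    moreover have "(?g has_vector_derivative D (?P' 1)) (at 0)"
    proof -
      have "(?l has_derivative (\<lambda>h. of_real h)) (at 0)"
        by (auto intro!: derivative_eq_intros)
      moreover have "((\<phi>' \<circ> \<psi>) has_derivative (\<lambda>h. D (?P' h))) (at (?l 0))" using D(1) by simp
      ultimately have "(?g has_derivative (\<lambda>h. D (?P' (of_real h)))) (at 0)"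
        by (rule has_derivative_compose)
      moreover have "D (?P' (of_real h)) = h *\<^sub>R D (?P' 1)" for h
        using linear_scale[OF linP, of h 1] linear_scale[OF D(2)] by (simp add: scaleR_conv_of_real)
      ultimately show ?thesis by (simp add: has_vector_derivative_def)
    qed
    ultimately show ?thesis
      unfolding tangent_space_in_def prod.case mem_Collect_eq using e(1)
      by (intro exI[of _ e] exI[of _ ?g] conjI) (simp_all only: of_real_0 add_0_right o_apply)
  qed
  then have "complex_structure (D (?P' 1)) \<in> range (\<lambda>h. D (?P' h))" using c(3) sub by blast
  then obtain h where "D (?P' h) = D (complex_structure (?P' 1))" using D(4) by auto
  then have "?P' h = complex_structure (?P' 1)" using D(3) by (simp add: inj_eq)
  then show False using tr unfolding totally_real_map_def by fastforce
qed

end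

section \<open>Cross-caps from even maps of a spherical band\<close>

text \<open>The part of the sphere that covers the standard cross-cap twice.\<close>

definition cap_band :: "(real^3) set" where
  "cap_band = {x \<in> sphere 0 1. \<bar>x $ 3\<bar> \<le> 1/2}"

lemma antipodal_class_eq_iff: "antipodal_class x = antipodal_class y \<longleftrightarrow> y = x \<or> y = - x"
  unfolding antipodal_class_def by (auto simp: doubleton_eq_iff)

lemma standard_cross_cap_eq: "standard_cross_cap = antipodal_class ` cap_band"
proof -
  have "antipodal_class x \<in> antipodal_class ` {x \<in> sphere 0 1. x $ 3 > 1/2} \<longleftrightarrow> \<not> \<bar>x $ 3\<bar> \<le> 1/2"
    if "x \<in> sphere 0 1" for x :: "real^3"
  proof
    assume "antipodal_class x \<in> antipodal_class ` {x \<in> sphere 0 1. x $ 3 > 1/2}"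
    then obtain y where "y $ 3 > 1/2" "antipodal_class x = antipodal_class y" by blast
    then show "\<not> \<bar>x $ 3\<bar> \<le> 1/2" by (auto simp: antipodal_class_eq_iff)
  next
    assume "\<not> \<bar>x $ 3\<bar> \<le> 1/2"
    then have "x $ 3 > 1/2 \<or> (-x) $ 3 > 1/2" by auto
    moreover have "antipodal_class x = antipodal_class (-x)" by (simp add: antipodal_class_eq_iff)
    ultimately show "antipodal_class x \<in> antipodal_class ` {x \<in> sphere 0 1. x $ 3 > 1/2}"
      using that by (metis (mono_tags, lifting) imageI mem_Collect_eq mem_sphere_0 norm_minus_cancel)
  qed
  then show ?thesis
    unfolding standard_cross_cap_def topspace_real_projective_plane cap_band_def by blast
qed

lemma standard_cross_cap_boundary_subset:
  "standard_cross_cap_boundary = antipodal_class ` {x \<in> cap_band. x $ 3 = 1/2}"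
  unfolding standard_cross_cap_boundary_def cap_band_def by (rule arg_cong[of _ _ "image _"]) auto

lemma continuous_antipodal_class:
  "continuous_map (top_of_set (sphere 0 1)) real_projective_plane antipodal_class"
  unfolding continuous_map_def topspace_real_projective_plane openin_real_projective_plane by simp

lemma compact_cap_band: "compact cap_band"
proof -
  have "cap_band = sphere 0 1 \<inter> {x. \<bar>x $ 3\<bar> \<le> 1/2}" by (auto simp: cap_band_def)
  moreover have "closed {x :: real^3. \<bar>x $ 3\<bar> \<le> 1/2}"
    by (intro closed_Collect_le continuous_intros)
  ultimately show ?thesis using compact_Int_closed[OF compact_sphere] by metis
qed

text \<open>The class map is continuous, so the cross-cap is compact; a continuous bijection from a compact to
  a Hausdorff space is a homeomorphism. Continuity of the induced map is checked on closed sets, whose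
  preimages in the band are compact and invariant under the antipodal map.\<close>

lemma cross_cap_from_even_map:
  assumes X: "Hausdorff_space X"
    and H: "continuous_map (top_of_set cap_band) X H"
    and even: "\<And>x. x \<in> cap_band \<Longrightarrow> H (- x) = H x"
    and inj: "\<And>x y. x \<in> cap_band \<Longrightarrow> y \<in> cap_band \<Longrightarrow> H x = H y \<Longrightarrow> y = x \<or> y = - x"
  shows "compactin X (H ` cap_band)"
    and "cross_cap X (H ` cap_band) (H ` {x \<in> cap_band. x $ 3 = 1/2})"
proof -
  show comp: "compactin X (H ` cap_band)"
    using image_compactin[OF _ H] compact_cap_band by (simp add: compactin_subtopology)
  define h where "h cl = H (SOME x. x \<in> cl)" for cl
  have h: "h (antipodal_class x) = H x" if "x \<in> cap_band" for x
  proof -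
    have "(SOME y. y \<in> antipodal_class x) \<in> antipodal_class x"
      by (rule someI[of _ x]) (simp add: antipodal_class_def)
    then show ?thesis using even[OF that] by (auto simp: h_def antipodal_class_def)
  qed
  let ?C = "subtopology real_projective_plane standard_cross_cap"
  have band: "cap_band \<subseteq> sphere 0 1" by (auto simp: cap_band_def)
  have top: "topspace ?C = antipodal_class ` cap_band"
    unfolding standard_cross_cap_eq topspace_subtopology topspace_real_projective_plane using band by blast
  have img: "h ` (antipodal_class ` cap_band) = H ` cap_band"
    unfolding image_image using h by (metis (no_types, lifting) image_cong)
  have neg: "- x \<in> cap_band" if "x \<in> cap_band" for x using that by (auto simp: cap_band_def)
  have "compactin (top_of_set (sphere 0 1)) cap_band"
    using compact_cap_band band by (simp add: compactin_subtopology)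
  from image_compactin[OF this continuous_antipodal_class]
  have "compact_space ?C"
    by (simp add: standard_cross_cap_eq compact_space_subtopology)
  moreover have "continuous_map ?C (subtopology X (H ` cap_band)) h"
  proof -
    have "continuous_map ?C X h"
      unfolding continuous_map_closedin
    proof (intro conjI ballI allI impI)
      show "h \<in> topspace ?C \<rightarrow> topspace X"
        using continuous_map_image_subset_topspace[OF H] h unfolding top by auto
      fix K assume K: "closedin X K"
      define B where "B = {x \<in> cap_band. H x \<in> K}"
      have "closedin (top_of_set cap_band) B"
        using closedin_continuous_map_preimage[OF H K] by (simp add: B_def)
      then have "closed B"
        using compact_cap_band closedin_closed_trans compact_imp_closed by blast
      have Bsym: "antipodal_class x \<in> antipodal_class ` B \<longleftrightarrow> x \<in> B" for x
        using neg even by (fastforce simp: B_def antipodal_class_eq_iff)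
      have "{x \<in> sphere 0 1. antipodal_class x \<in> topspace real_projective_plane - antipodal_class ` B}
          = sphere 0 1 - B"
        using Bsym by (auto simp: topspace_real_projective_plane)
      moreover have "openin (top_of_set (sphere 0 1)) (sphere 0 1 - B)"
        using \<open>closed B\<close> by (metis Diff_eq open_Compl openin_open_Int)
      ultimately have "openin real_projective_plane (topspace real_projective_plane - antipodal_class ` B)"
        unfolding openin_real_projective_plane topspace_real_projective_plane by auto
      moreover have "antipodal_class ` B \<subseteq> topspace real_projective_plane"
        using band by (auto simp: B_def topspace_real_projective_plane)
      ultimately have "closedin real_projective_plane (antipodal_class ` B)"
        by (simp add: closedin_def)
      moreover have "{cl \<in> topspace ?C. h cl \<in> K} = standard_cross_cap \<inter> antipodal_class ` B"
        unfolding top unfolding standard_cross_cap_eq using h by (auto simp: B_def)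
      ultimately show "closedin ?C {cl \<in> topspace ?C. h cl \<in> K}"
        by (metis closedin_subtopology_Int_closed)
    qed
    then show ?thesis using img top by (auto simp: continuous_map_in_subtopology)
  qed
  moreover have "Hausdorff_space (subtopology X (H ` cap_band))" using X by (rule Hausdorff_space_subtopology)
  moreover have "h ` topspace ?C = topspace (subtopology X (H ` cap_band))"
    unfolding top img using compactin_subset_topspace[OF comp] by auto
  moreover have "inj_on h (topspace ?C)"
    unfolding top using h inj by (auto simp: inj_on_def antipodal_class_eq_iff)
  ultimately have "homeomorphic_map ?C (subtopology X (H ` cap_band)) h"
    by (intro continuous_imp_homeomorphic_map)
  moreover have "h ` standard_cross_cap_boundary = H ` {x \<in> cap_band. x $ 3 = 1/2}"
    unfolding standard_cross_cap_boundary_subset image_image using h by (intro image_cong) auto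
  ultimately show "cross_cap X (H ` cap_band) (H ` {x \<in> cap_band. x $ 3 = 1/2})"
    unfolding cross_cap_def using compactin_subset_topspace[OF comp] by blast
qed

section \<open>The Moebius band over a disc\<close>

text \<open>The graph of \<open>g\<close> over a punctured disc is completed by the circle of radius \<open>\<epsilon>\<close> around \<open>c\<close> over
  \<open>\<xi> = 0\<close>: close to \<open>0\<close>, on the line of direction \<open>u\<close> and on either side of \<open>0\<close>, \<open>g\<close> has the
  value \<open>c + \<epsilon> u\<^sup>-\<^sup>2\<close>.\<close>

locale moebius_graph =
  fixes g :: "complex \<Rightarrow> complex" and c :: complex and r R \<delta> \<epsilon> :: real
  assumes radii: "0 < \<delta>" "\<delta> < R" "R < r" "0 < \<epsilon>"
    and g_smooth: "smooth_on g (ball 0 r - {0})"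
    and g_dbar: "\<And>\<xi>. \<xi> \<in> ball 0 r - {0} \<Longrightarrow> dbar g \<xi> \<noteq> 0"
    and g_inner: "\<And>\<xi>. norm \<xi> < \<delta> \<Longrightarrow> g \<xi> = c + of_real \<epsilon> * (cnj \<xi> * inverse \<xi>)"
begin

definition moebius :: "complex set \<Rightarrow> (complex \<times> complex) set" where
  "moebius D = {(\<xi>, \<eta>). \<xi> \<in> D \<and> (if \<xi> = 0 then norm (\<eta> - c) = \<epsilon> else \<eta> = g \<xi>)}"

lemma g_polar:
  assumes "norm u = 1" "s \<noteq> 0" "\<bar>s\<bar> < \<delta>"
  shows "g (of_real s * u) = c + of_real \<epsilon> * (cnj u)\<^sup>2"
proof -
  have "u * cnj u = 1" using assms(1) complex_norm_square[of u] by simp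
  then have "inverse u = cnj u" by (metis inverse_unique)
  then have "cnj (of_real s * u) * inverse (of_real s * u) = (cnj u)\<^sup>2"
    using assms(2) by (simp add: power2_eq_square)
  then show ?thesis using g_inner[of "of_real s * u"] assms by (simp add: norm_mult)
qed

text \<open>The parametrization of the completed graph by signed radius and direction. For \<open>0 < |s| < \<delta>\<close> the two
  expressions agree, so the threshold is immaterial; the value \<open>\<delta>/2\<close> leaves an overlap, from which
  continuity is read off.\<close>

definition polar :: "real \<Rightarrow> complex \<Rightarrow> complex \<times> complex" where
  "polar s u = (of_real s * u, if \<bar>s\<bar> \<le> \<delta>/2 then c + of_real \<epsilon> * (cnj u)\<^sup>2 else g (of_real s * u))"

lemma polar_inner: "norm u = 1 \<Longrightarrow> \<bar>s\<bar> < \<delta> \<Longrightarrow> polar s u = (of_real s * u, c + of_real \<epsilon> * (cnj u)\<^sup>2)"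
  using g_polar by (auto simp: polar_def)

lemma polar_outer: "norm u = 1 \<Longrightarrow> s \<noteq> 0 \<Longrightarrow> polar s u = (of_real s * u, g (of_real s * u))"
  using g_polar radii(1) by (auto simp: polar_def)

lemma polar_minus: "polar (- s) (- u) = polar s u"
  by (simp add: polar_def)

lemma polar_in_moebius:
  assumes "norm u = 1" "of_real s * u \<in> D" shows "polar s u \<in> moebius D"
  using assms polar_outer[of u s] polar_inner[of u 0] radii
  by (cases "s = 0") (auto simp: moebius_def norm_mult norm_power)

lemma moebius_imp_polar:
  assumes "m \<in> moebius D"
  obtains s u where "norm u = 1" "\<bar>s\<bar> = norm (fst m)" "m = polar s u"
proof (cases "fst m = 0")
  case True
  define w where "w = (snd m - c) / of_real \<epsilon>"
  have w: "norm w = 1" "snd m = c + of_real \<epsilon> * w"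
    using assms True radii by (auto simp: w_def moebius_def norm_divide)
  have "norm (cnj (csqrt w)) = 1"
    using w(1) norm_power[of "csqrt w" 2] by (simp add: power2_eq_1_iff)
  moreover have "m = polar 0 (cnj (csqrt w))"
    using polar_inner[OF calculation, of 0] radii True w(2) by (simp add: prod_eq_iff)
  ultimately show thesis using that[of "cnj (csqrt w)" 0] True by simp
next
  case False
  have u: "norm (fst m / of_real (norm (fst m))) = 1" using False by (simp add: norm_divide)
  have "m = polar (norm (fst m)) (fst m / of_real (norm (fst m)))"
    using polar_outer[OF u, of "norm (fst m)"] False assms by (auto simp: moebius_def)
  then show thesis by (rule that[OF u, rotated]) simp
qed

lemma polar_eq_imp:
  assumes "norm u = 1" "norm v = 1" "polar s u = polar t v"
  shows "t = s \<and> v = u \<or> t = - s \<and> v = - u"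
proof -
  have 1: "of_real s * u = of_real t * v" using assms(3) by (simp add: polar_def)
  then have "norm (of_real s * u) = norm (of_real t * v)" by simp
  then have st: "\<bar>s\<bar> = \<bar>t\<bar>" using assms by (simp add: norm_mult)
  show ?thesis
  proof (cases "s = 0")
    case True
    then have "(cnj u)\<^sup>2 = (cnj v)\<^sup>2"
      using assms st radii polar_inner[of u 0] polar_inner[of v 0] by simp
    then have "cnj u = cnj v \<or> cnj u = - cnj v" by (simp add: power2_eq_iff)
    then show ?thesis using True st by (metis abs_0_eq complex_cnj_cancel_iff complex_cnj_minus minus_equation_iff neg_0_equal_iff_equal)
  next
    case False
    then have "t = s \<or> t = - s" using st by linarith
    then show ?thesis
    proof
      assume "t = - s"
      then have "of_real s * v = of_real s * (- u)" using 1 by simp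
      then show ?thesis using False \<open>t = - s\<close> mult_left_cancel[of "of_real s" v "- u"] by simp
    qed (use 1 False in simp)
  qed
qed

text \<open>The band of the sphere is mapped to the Moebius band by using the height as signed radius and the
  longitude as direction; antipodal points have the same image.\<close>

definition direction :: "real^3 \<Rightarrow> complex" where
  "direction x = Complex (x $ 1) (x $ 2) / of_real (sqrt (1 - (x $ 3)\<^sup>2))"

lemma cap_band_height:
  assumes "x \<in> cap_band" shows "0 < 1 - (x $ 3)\<^sup>2" "(x $ 1)\<^sup>2 + (x $ 2)\<^sup>2 = 1 - (x $ 3)\<^sup>2"
proof -
  have "\<bar>x $ 3\<bar> \<le> 1/2" using assms by (simp add: cap_band_def)
  then have "(x $ 3)\<^sup>2 \<le> (1/2)\<^sup>2" by (intro abs_le_square_iff[THEN iffD1]) simp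
  then show "0 < 1 - (x $ 3)\<^sup>2" by (simp add: power_divide)
  have "x \<bullet> x = 1" using assms by (simp add: cap_band_def norm_eq_1)
  then show "(x $ 1)\<^sup>2 + (x $ 2)\<^sup>2 = 1 - (x $ 3)\<^sup>2"
    by (simp add: inner_vec_def sum_3 power2_eq_square)
qed

lemma norm_direction:
  assumes "x \<in> cap_band" shows "norm (direction x) = 1"
proof -
  have "norm (Complex (x $ 1) (x $ 2)) = sqrt (1 - (x $ 3)\<^sup>2)"
    using cap_band_height(2)[OF assms] by (simp add: cmod_def)
  then show ?thesis
    using cap_band_height(1)[OF assms] by (simp add: direction_def norm_divide)
qed

lemma direction_minus: "direction (- x) = - direction x"
  by (simp add: direction_def complex_eq_iff)

definition band_map :: "real^3 \<Rightarrow> complex \<times> complex" where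
  "band_map x = polar (2 * R * x $ 3) (direction x)"

lemma band_map_minus: "band_map (- x) = band_map x"
  using polar_minus[of "2 * R * x $ 3" "direction x"] by (simp add: band_map_def direction_minus)

lemma band_map_inj:
  assumes "x \<in> cap_band" "y \<in> cap_band" "band_map x = band_map y"
  shows "y = x \<or> y = - x"
proof -
  have eqI: "y = x" if "y $ 3 = x $ 3" "direction y = direction x" "x \<in> cap_band" for x y :: "real^3"
  proof -
    have "sqrt (1 - (x $ 3)\<^sup>2) \<noteq> 0" using cap_band_height[OF that(3)] by simp
    then have "Complex (y $ 1) (y $ 2) = Complex (x $ 1) (x $ 2)"
      using that(1,2) by (simp add: direction_def)
    then show ?thesis using that(1) by (simp add: vec_eq_iff forall_3)
  qed
  have "(2 * R * y $ 3 = 2 * R * x $ 3 \<and> direction y = direction x) \<or>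
      (2 * R * y $ 3 = - (2 * R * x $ 3) \<and> direction y = - direction x)"
    by (rule polar_eq_imp[OF norm_direction[OF assms(1)] norm_direction[OF assms(2)]
          assms(3)[unfolded band_map_def]])
  moreover have "(- y) $ 3 = x $ 3" if "2 * R * y $ 3 = - (2 * R * x $ 3)"
  proof -
    have "R * (y $ 3 + x $ 3) = 0" using that unfolding distrib_left by linarith
    then have "y $ 3 + x $ 3 = 0" using radii by simp
    then show ?thesis by simp
  qed
  ultimately have "(y $ 3 = x $ 3 \<and> direction y = direction x) \<or>
      ((- y) $ 3 = x $ 3 \<and> direction (- y) = direction x)"
    using radii by (auto simp: direction_minus)
  then have "y = x \<or> - y = x" using eqI assms(1) by blast
  then show ?thesis by auto
qed

lemma cap_band_point:
  assumes "norm u = 1" "\<bar>s\<bar> \<le> R"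
  obtains x where "x \<in> cap_band" "2 * R * x $ 3 = s" "direction x = u"
proof -
  define t where "t = s / (2 * R)"
  have t: "\<bar>t\<bar> \<le> 1/2" "2 * R * t = s" using assms radii by (auto simp: t_def field_simps)
  then have "t\<^sup>2 \<le> (1/2)\<^sup>2" by (intro abs_le_square_iff[THEN iffD1]) simp
  then have k: "1 - t\<^sup>2 > 0" by (simp add: power_divide)
  define x :: "real^3" where "x = vector [sqrt (1 - t\<^sup>2) * Re u, sqrt (1 - t\<^sup>2) * Im u, t]"
  have x: "x $ 1 = sqrt (1 - t\<^sup>2) * Re u" "x $ 2 = sqrt (1 - t\<^sup>2) * Im u" "x $ 3 = t"
    by (simp_all add: x_def)
  have "(Re u)\<^sup>2 + (Im u)\<^sup>2 = 1" using assms(1) by (simp add: cmod_def)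
  then have "(1 - t\<^sup>2) * (Re u)\<^sup>2 + (1 - t\<^sup>2) * (Im u)\<^sup>2 = 1 - t\<^sup>2"
    by (simp flip: distrib_left)
  then have "x \<bullet> x = 1"
    using k by (simp add: inner_vec_def sum_3 x power2_eq_square[symmetric] power_mult_distrib)
  then have "x \<in> cap_band" using t(1) by (simp add: cap_band_def norm_eq_1 x)
  moreover have "direction x = u"
    using k by (simp add: direction_def x complex_eq_iff)
  ultimately show thesis using that t(2) x by simp
qed

lemma band_map_image: "band_map ` cap_band = moebius (cball 0 R)"
proof
  show "band_map ` cap_band \<subseteq> moebius (cball 0 R)"
  proof
    fix m assume "m \<in> band_map ` cap_band"
    then obtain x where x: "x \<in> cap_band" "m = band_map x" by blast
    then have "\<bar>2 * R * x $ 3\<bar> \<le> R"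
      using radii by (auto simp: cap_band_def abs_mult)
    then show "m \<in> moebius (cball 0 R)"
      unfolding x(2) band_map_def using norm_direction[OF x(1)]
      by (intro polar_in_moebius) (auto simp: norm_mult)
  qed
  show "moebius (cball 0 R) \<subseteq> band_map ` cap_band"
  proof
    fix m assume m: "m \<in> moebius (cball 0 R)"
    obtain s u where su: "norm u = 1" "\<bar>s\<bar> = norm (fst m)" "m = polar s u"
      using moebius_imp_polar[OF m] by blast
    have "\<bar>s\<bar> \<le> R" using m su(2) by (auto simp: moebius_def)
    then obtain x where "x \<in> cap_band" "2 * R * x $ 3 = s" "direction x = u"
      using cap_band_point[OF su(1)] by blast
    then show "m \<in> band_map ` cap_band" using su(3) by (auto simp: band_map_def)
  qed
qed

lemma band_map_boundary: "band_map ` {x \<in> cap_band. x $ 3 = 1/2} = (\<lambda>\<xi>. (\<xi>, g \<xi>)) ` sphere 0 R"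
proof
  show "band_map ` {x \<in> cap_band. x $ 3 = 1/2} \<subseteq> (\<lambda>\<xi>. (\<xi>, g \<xi>)) ` sphere 0 R"
  proof (rule image_subsetI)
    fix x assume "x \<in> {x \<in> cap_band. x $ 3 = 1/2}"
    then have x: "x \<in> cap_band" "x $ 3 = 1/2" by simp_all
    then have "2 * R * x $ 3 = R" by simp
    then have "band_map x = (of_real R * direction x, g (of_real R * direction x))"
      using polar_outer[OF norm_direction[OF x(1)], of R] radii by (simp only: band_map_def)
    moreover have "of_real R * direction x \<in> sphere 0 R"
      using norm_direction[OF x(1)] radii by (simp add: norm_mult)
    ultimately show "band_map x \<in> (\<lambda>\<xi>. (\<xi>, g \<xi>)) ` sphere 0 R" by blast
  qed
  show "(\<lambda>\<xi>. (\<xi>, g \<xi>)) ` sphere 0 R \<subseteq> band_map ` {x \<in> cap_band. x $ 3 = 1/2}"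
  proof (rule image_subsetI)
    fix \<xi> :: complex assume \<xi>: "\<xi> \<in> sphere 0 R"
    then have u: "norm (\<xi> / of_real R) = 1" using radii by (simp add: norm_divide)
    obtain x where x: "x \<in> cap_band" "2 * R * x $ 3 = R" "direction x = \<xi> / of_real R"
      using cap_band_point[OF u, of R] radii by auto
    then have "x $ 3 = 1/2" using radii by auto
    moreover have "band_map x = (\<xi>, g \<xi>)"
      unfolding band_map_def x(2,3) using radii polar_outer[OF u, of R] by simp
    ultimately show "(\<xi>, g \<xi>) \<in> band_map ` {x \<in> cap_band. x $ 3 = 1/2}"
      using x(1) by (metis (mono_tags, lifting) imageI mem_Collect_eq)
  qed
qed

lemma continuous_on_band_map: "continuous_on cap_band band_map"
proof -
  let ?s = "\<lambda>x::real^3. 2 * R * x $ 3"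
  define B1 where "B1 = cap_band \<inter> {x. \<bar>?s x\<bar> \<le> \<delta>/2}"
  define B2 where "B2 = cap_band \<inter> {x. \<delta>/2 \<le> \<bar>?s x\<bar>}"
  have "closed cap_band" using compact_cap_band compact_imp_closed by blast
  then have closed: "closed B1" "closed B2"
    unfolding B1_def B2_def by (auto intro!: closed_Int closed_Collect_le continuous_intros)
  have dir: "continuous_on cap_band direction"
    unfolding direction_def Complex_eq using cap_band_height(1)
    by (intro continuous_intros) (auto simp del: of_real_power, force)
  have "continuous_on B1 (\<lambda>x. (of_real (?s x) * direction x, c + of_real \<epsilon> * (cnj (direction x))\<^sup>2))"
    by (intro continuous_intros continuous_on_subset[OF dir]) (auto simp: B1_def)
  then have 1: "continuous_on B1 band_map"
    by (rule continuous_on_eq) (auto simp: B1_def band_map_def polar_def)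
  have "continuous_on B2 (\<lambda>x. (of_real (?s x) * direction x, g (of_real (?s x) * direction x)))"
  proof (intro continuous_intros continuous_on_subset[OF dir] continuous_on_compose2[OF smooth_on_imp_continuous_on[OF g_smooth]])
    show "(\<lambda>x. of_real (?s x) * direction x) ` B2 \<subseteq> ball 0 r - {0}"
    proof (rule image_subsetI)
      fix x assume x: "x \<in> B2"
      have "\<bar>?s x\<bar> \<le> R" "?s x \<noteq> 0" "norm (direction x) = 1"
        using x radii norm_direction[of x] by (auto simp: B2_def cap_band_def abs_mult)
      then show "of_real (?s x) * direction x \<in> ball 0 r - {0}"
        using radii by (auto simp: norm_mult simp del: of_real_mult)
    qed
  qed (auto simp: B2_def)
  then have 2: "continuous_on B2 band_map"
  proof (rule continuous_on_eq)
    fix x assume "x \<in> B2"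
    then have "norm (direction x) = 1" "?s x \<noteq> 0"
      using radii norm_direction[of x] by (auto simp: B2_def)
    then show "(of_real (?s x) * direction x, g (of_real (?s x) * direction x)) = band_map x"
      unfolding band_map_def by (rule polar_outer[symmetric])
  qed
  have "cap_band = B1 \<union> B2" by (auto simp: B1_def B2_def)
  then show ?thesis using continuous_on_closed_Un[OF closed 1 2] by simp
qed

subsection \<open>Totally real parametrizations\<close>

definition graph_param :: "complex \<Rightarrow> complex \<times> complex" where
  "graph_param \<xi> = (\<xi>, g \<xi>)"

lemma graph_param_smooth: "smooth_on graph_param (ball 0 r - {0})"
  unfolding graph_param_def by (intro smooth_on_Pair open_punctured_ball smooth_on_id g_smooth)

text \<open>Complex linearity of \<open>g'\<close> fails on every nonzero vector: \<open>g' (i b) - i g' b\<close> is \<open>-2 i cnj b\<close> times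
  \<open>dbar g\<close>.\<close>

lemma graph_param_totally_real:
  assumes "\<xi> \<in> ball 0 r - {0}"
  shows "totally_real_map (frechet_derivative graph_param (at \<xi>))"
proof -
  let ?g' = "frechet_derivative g (at \<xi>)"
  have g': "(g has_derivative ?g') (at \<xi>)" by (rule smooth_on_imp_has_derivative[OF g_smooth assms])
  interpret g': linear ?g' by (rule has_derivative_linear[OF g'])
  have "(graph_param has_derivative (\<lambda>h. (h, ?g' h))) (at \<xi>)"
    unfolding graph_param_def by (intro has_derivative_Pair has_derivative_ident g')
  then have eq: "frechet_derivative graph_param (at \<xi>) = (\<lambda>h. (h, ?g' h))"
    by (rule frechet_derivative_eq)
  have "b = 0" if "?g' (\<i> * b) = \<i> * ?g' b" for b
  proof -
    have b: "b = Re b *\<^sub>R 1 + Im b *\<^sub>R \<i>" "\<i> * b = Re b *\<^sub>R \<i> + (- Im b) *\<^sub>R 1"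
      by (simp_all add: complex_eq_iff)
    have 1: "?g' b = Re b *\<^sub>R ?g' 1 + Im b *\<^sub>R ?g' \<i>"
      by (rule trans[OF arg_cong[OF b(1), of ?g']]) (simp only: g'.add g'.scaleR)
    have 2: "?g' (\<i> * b) = Re b *\<^sub>R ?g' \<i> + (- Im b) *\<^sub>R ?g' 1"
      by (rule trans[OF arg_cong[OF b(2), of ?g']]) (simp only: g'.add g'.scaleR)
    have "- 2 * \<i> * cnj b * dbar g \<xi> = ?g' (\<i> * b) - \<i> * ?g' b"
      unfolding 1 2 by (simp add: dbar_def complex_eq_iff algebra_simps add_divide_distrib diff_divide_distrib)
    then show ?thesis using that g_dbar[OF assms] by simp
  qed
  then show ?thesis by (auto simp: eq totally_real_map_def complex_structure_def)
qed

text \<open>Around the circle over \<open>0\<close> the graph is resolved by polar coordinates in which the radius may be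
  negative; \<open>u\<close> is the direction about which the angle is measured.\<close>

definition core_param :: "complex \<Rightarrow> complex \<Rightarrow> complex \<times> complex" where
  "core_param u z = (of_real (Re z) * (u * exp (\<i> * of_real (Im z))),
      c + of_real \<epsilon> * ((cnj u)\<^sup>2 * exp (- 2 * \<i> * of_real (Im z))))"

definition core_domain :: "complex set" where
  "core_domain = {z. \<bar>Re z\<bar> < \<delta> \<and> \<bar>Im z\<bar> < pi/2}"

definition core_inverse :: "complex \<Rightarrow> complex \<times> complex \<Rightarrow> complex" where
  "core_inverse u m = (let t = - Im (Ln ((snd m - c) * u\<^sup>2 / of_real \<epsilon>)) / 2
      in Complex (Re (fst m * cnj u * exp (- \<i> * of_real t))) t)"

lemma core_domain_open: "open core_domain"
  unfolding core_domain_def by (intro open_Collect_conj open_Collect_less continuous_intros)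

lemma bounded_linear_mult_of_real_Im: "bounded_linear (\<lambda>z. k * complex_of_real (Im z))"
  by (rule bounded_linear_const_mult[OF bounded_linear_compose[OF bounded_linear_of_real bounded_linear_Im]])

lemma core_param_smooth: "smooth_on (core_param u) core_domain"
proof -
  have im: "smooth_on (\<lambda>z. exp (k * of_real (Im z))) core_domain" for k :: complex
    by (rule smooth_on_holomorphic_compose[where g=exp and T=UNIV])
      (auto intro!: core_domain_open holomorphic_intros smooth_on_linear bounded_linear_mult_of_real_Im)
  show ?thesis
    unfolding core_param_def
    by (intro smooth_on_Pair core_domain_open smooth_on_mult smooth_on_add smooth_on_const im
        smooth_on_linear bounded_linear_compose[OF bounded_linear_of_real bounded_linear_Re])
qed

text \<open>The second coordinate depends on the angle alone, so its differential takes values in a real line;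
  on vectors that it annihilates, the first coordinate moves in the real line spanned by the direction.
  A real line in \<open>\<complex>\<close> contains no nonzero vector together with its multiple by \<open>i\<close>.\<close>

lemma core_param_totally_real:
  assumes "norm u = 1"
  shows "totally_real_map (frechet_derivative (core_param u) (at z))"
proof -
  have exp_der: "((\<lambda>z. exp (k * of_real (Im z))) has_derivative
      (\<lambda>h. exp (k * of_real (Im z)) * (k * of_real (Im h)))) (at z)" for k :: complex
  proof (rule has_derivative_compose[of "\<lambda>z. k * of_real (Im z)" "\<lambda>h. k * of_real (Im h)" z UNIV exp])
    show "((\<lambda>z. k * of_real (Im z)) has_derivative (\<lambda>h. k * of_real (Im h))) (at z)"
      by (rule bounded_linear_imp_has_derivative[OF bounded_linear_mult_of_real_Im])
    show "(exp has_derivative (*) (exp (k * of_real (Im z)))) (at (k * of_real (Im z)))"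
      using DERIV_exp has_field_derivative_def by blast
  qed
  have re_der: "((\<lambda>z. complex_of_real (Re z)) has_derivative (\<lambda>h. complex_of_real (Re h))) (at z)"
    by (rule bounded_linear_imp_has_derivative[OF bounded_linear_compose[OF bounded_linear_of_real bounded_linear_Re]])
  let ?E = "exp (\<i> * of_real (Im z))" and ?E2 = "exp (- 2 * \<i> * of_real (Im z))"
  let ?L = "\<lambda>h. (of_real (Re z) * (u * (?E * (\<i> * of_real (Im h)))) + of_real (Re h) * (u * ?E),
      of_real \<epsilon> * ((cnj u)\<^sup>2 * (?E2 * (- 2 * \<i> * of_real (Im h)))))"
  have "((\<lambda>z. c + of_real \<epsilon> * ((cnj u)\<^sup>2 * exp (- 2 * \<i> * of_real (Im z)))) has_derivative
      (\<lambda>h. of_real \<epsilon> * ((cnj u)\<^sup>2 * (?E2 * (- 2 * \<i> * of_real (Im h)))))) (at z)"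
    by (rule has_derivative_eq_rhs[OF has_derivative_add[OF has_derivative_const
            has_derivative_mult_right[OF has_derivative_mult_right[OF exp_der]]]]) simp
  then have "(core_param u has_derivative ?L) (at z)"
    unfolding core_param_def
    by (intro has_derivative_Pair has_derivative_mult[OF re_der] has_derivative_mult_right exp_der)
  then have eq: "frechet_derivative (core_param u) (at z) = ?L" by (rule frechet_derivative_eq)
  have nz: "u \<noteq> 0" "\<epsilon> \<noteq> 0" using assms radii by auto
  show ?thesis
    unfolding totally_real_map_def eq
  proof (intro allI impI)
    fix a b assume ab: "?L a = complex_structure (?L b)"
    then have "complex_of_real (Im a) = \<i> * of_real (Im b)"
      using nz by (simp add: complex_structure_def)
    then have im: "Im a = 0" "Im b = 0" by (simp_all add: complex_eq_iff)
    then have "complex_of_real (Re a) = \<i> * of_real (Re b)"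
      using ab nz by (simp add: complex_structure_def)
    then have "Re b = 0" by (simp add: complex_eq_iff)
    with im show "b = 0" by (simp add: complex_eq_iff)
  qed
qed

lemma core_param_polar:
  assumes "norm u = 1" "z \<in> core_domain"
  shows "core_param u z = polar (Re z) (u * exp (\<i> * of_real (Im z)))"
proof -
  let ?v = "u * exp (\<i> * of_real (Im z))"
  have "norm ?v = 1" using assms(1) by (simp add: norm_mult)
  moreover have "(cnj ?v)\<^sup>2 = (cnj u)\<^sup>2 * exp (- 2 * \<i> * of_real (Im z))"
    by (simp add: power_mult_distrib exp_cnj mult.assoc flip: exp_double)
  ultimately show ?thesis
    using polar_inner[of ?v "Re z"] assms(2) by (simp add: core_param_def core_domain_def)
qed

text \<open>An open set on which the principal logarithm recovers the angle from the second coordinate. Its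
  intersection with the Moebius band is the patch parametrized by \<open>core_param u\<close>.\<close>

definition core_region :: "complex \<Rightarrow> (complex \<times> complex) set" where
  "core_region u = {m. norm (fst m) < \<delta>} \<inter> (\<lambda>m. (snd m - c) * u\<^sup>2 / of_real \<epsilon>) -` (- \<real>\<^sub>\<le>\<^sub>0)"

lemma core_region_open: "open (core_region u)"
  unfolding core_region_def
  by (intro open_Int open_Collect_less continuous_intros continuous_open_vimage open_Compl closed_nonpos_Reals_complex)
    (use radii in auto)

lemma core_param_normalized:
  assumes "norm u = 1"
  shows "(snd (core_param u z) - c) * u\<^sup>2 / of_real \<epsilon> = exp (- 2 * \<i> * of_real (Im z))"
proof -
  have "cnj u * u = 1" using assms complex_norm_square[of u] by (simp add: mult.commute)
  then have "(cnj u)\<^sup>2 * u\<^sup>2 = 1" by (simp flip: power_mult_distrib)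
  then show ?thesis using radii by (simp add: core_param_def mult_ac)
qed

lemma Ln_exp_angle: "\<bar>t\<bar> < pi/2 \<Longrightarrow> Ln (exp (- 2 * \<i> * of_real t)) = - 2 * \<i> * of_real t"
  by (intro Ln_exp) auto

lemma exp_angle_region: "\<bar>t\<bar> < pi/2 \<Longrightarrow> exp (- 2 * \<i> * of_real t) \<notin> \<real>\<^sub>\<le>\<^sub>0"
proof
  assume t: "\<bar>t\<bar> < pi/2" and n: "exp (- 2 * \<i> * of_real t) \<in> \<real>\<^sub>\<le>\<^sub>0"
  let ?E = "exp (- 2 * \<i> * complex_of_real t)"
  have "?E \<noteq> 0" by (rule exp_not_eq_zero)
  then have "Re ?E < 0 \<and> Im ?E = 0"
    using n unfolding complex_nonpos_Reals_iff complex_eq_iff by force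
  then have "Im (Ln ?E) = pi" using Im_Ln_eq_pi[OF \<open>?E \<noteq> 0\<close>] by blast
  then show False unfolding Ln_exp_angle[OF t] using t by simp
qed

lemma core_inverse_param:
  assumes "norm u = 1" "z \<in> core_domain"
  shows "core_inverse u (core_param u z) = z"
proof -
  have t: "- Im (Ln ((snd (core_param u z) - c) * u\<^sup>2 / of_real \<epsilon>)) / 2 = Im z"
  proof -
    have "\<bar>Im z\<bar> < pi/2" using assms(2) by (simp add: core_domain_def)
    then show ?thesis unfolding core_param_normalized[OF assms(1)] by (subst Ln_exp_angle) simp_all
  qed
  have "u * cnj u = 1" using assms complex_norm_square[of u] by simp
  moreover have "exp (\<i> * of_real (Im z)) * exp (- \<i> * of_real (Im z)) = 1"
    by (simp flip: exp_add)
  ultimately have "fst (core_param u z) * cnj u * exp (- \<i> * of_real (Im z)) = of_real (Re z)"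
    by (simp add: core_param_def mult_ac)
  then show ?thesis unfolding core_inverse_def Let_def t by simp
qed

lemma continuous_on_core_inverse:
  assumes "norm u = 1"
  shows "continuous_on (core_param u ` core_domain) (core_inverse u)"
proof -
  have "continuous_on (core_region u) (core_inverse u)"
    unfolding core_inverse_def Let_def Complex_eq using radii
    by (intro continuous_intros) (auto simp: core_region_def)
  moreover have "core_param u ` core_domain \<subseteq> core_region u"
  proof (rule image_subsetI)
    fix z assume z: "z \<in> core_domain"
    then show "core_param u z \<in> core_region u"
      using exp_angle_region[of "Im z"] core_param_normalized[OF assms, of z] assms
      by (simp add: core_region_def core_domain_def) (simp add: core_param_def norm_mult)
  qed
  ultimately show ?thesis using continuous_on_subset by blast
qed

text \<open>A point of the band determines its direction only up to sign, and in this region exactly one of the two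
  signs lies within a quarter turn of \<open>u\<close>.\<close>

lemma core_param_image:
  assumes u: "norm u = 1"
  shows "core_param u ` core_domain = moebius (ball 0 r) \<inter> core_region u"
proof
  show "core_param u ` core_domain \<subseteq> moebius (ball 0 r) \<inter> core_region u"
  proof (rule image_subsetI)
    fix z assume z: "z \<in> core_domain"
    have "norm (u * exp (\<i> * of_real (Im z))) = 1" using u by (simp add: norm_mult)
    then have "core_param u z \<in> moebius (ball 0 r)"
      unfolding core_param_polar[OF u z] using z radii
      by (intro polar_in_moebius) (auto simp: core_domain_def norm_mult)
    moreover have "core_param u z \<in> core_region u"
      using exp_angle_region[of "Im z"] core_param_normalized[OF u, of z] u z
      by (simp add: core_region_def core_domain_def) (simp add: core_param_def norm_mult)
    ultimately show "core_param u z \<in> moebius (ball 0 r) \<inter> core_region u" by blast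
  qed
  show "moebius (ball 0 r) \<inter> core_region u \<subseteq> core_param u ` core_domain"
  proof
    fix m assume m: "m \<in> moebius (ball 0 r) \<inter> core_region u"
    then obtain s v where sv: "norm v = 1" "\<bar>s\<bar> = norm (fst m)" "m = polar s v"
      using moebius_imp_polar by blast
    have s: "\<bar>s\<bar> < \<delta>" using sv(2) m by (simp add: core_region_def)
    have meq: "m = (of_real s * v, c + of_real \<epsilon> * (cnj v)\<^sup>2)" using sv polar_inner s by simp
    define q where "q = (cnj v * u)\<^sup>2"
    have q: "q \<notin> \<real>\<^sub>\<le>\<^sub>0"
      using m radii by (simp add: core_region_def meq q_def power_mult_distrib)
    have "norm q = 1" using sv(1) u by (simp add: q_def norm_mult norm_power)
    have "q \<noteq> 0" using q by auto
    define t where "t = - Im (Ln q) / 2"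
    have "\<bar>Im (Ln q)\<bar> < pi" using q Im_Ln_less_pi[of q] mpi_less_Im_Ln[OF \<open>q \<noteq> 0\<close>] 
      by (auto simp: complex_nonpos_Reals_iff)
    then have t: "\<bar>t\<bar> < pi/2" by (simp add: t_def)
    have "Ln q = \<i> * of_real (Im (Ln q))"
      using \<open>norm q = 1\<close> \<open>q \<noteq> 0\<close> by (simp add: complex_eq_iff)
    then have "Ln q = - 2 * \<i> * of_real t" by (simp add: t_def)
    then have qe: "q = exp (- 2 * \<i> * of_real t)" using exp_Ln[OF \<open>q \<noteq> 0\<close>] by simp
    define w where "w = u * exp (\<i> * of_real t)"
    have w1: "norm w = 1" using u by (simp add: w_def norm_mult)
    have "(cnj v * w)\<^sup>2 = q * (exp (\<i> * of_real t))\<^sup>2"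
      by (simp add: q_def w_def power_mult_distrib)
    also have "\<dots> = 1" unfolding qe by (simp flip: exp_double exp_add)
    finally have "cnj v * w = 1 \<or> cnj v * w = - 1" by (simp add: power2_eq_1_iff)
    moreover have "v * cnj v = 1" using sv(1) complex_norm_square[of v] by simp
    then have "w = v * (cnj v * w)" by (simp flip: mult.assoc)
    ultimately have "w = v \<or> w = - v" by (metis mult.right_neutral mult_minus_right)
    then obtain s' where s': "polar s v = polar s' w" "\<bar>s'\<bar> = \<bar>s\<bar>"
      using polar_minus[of s v] by (metis abs_minus_cancel)
    have "Complex s' t \<in> core_domain" using s s' t by (simp add: core_domain_def)
    moreover have "core_param u (Complex s' t) = m"
      using core_param_polar[OF u calculation] s' sv(3) by (simp add: w_def)
    ultimately show "m \<in> core_param u ` core_domain" by (metis imageI)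
  qed
qed

lemma core_region_covers:
  assumes "m \<in> moebius D" "fst m = 0"
  obtains u where "norm u = 1" "m \<in> core_region u"
proof -
  obtain s v where sv: "norm v = 1" "\<bar>s\<bar> = norm (fst m)" "m = polar s v"
    using moebius_imp_polar[OF assms(1)] by blast
  have m: "m = (0, c + of_real \<epsilon> * (cnj v)\<^sup>2)"
    using sv assms(2) polar_inner[OF sv(1), of 0] radii by simp
  have "cnj v * v = 1" using sv(1) complex_norm_square[of v] by (simp add: mult.commute)
  then have "(cnj v)\<^sup>2 * v\<^sup>2 = 1" by (simp flip: power_mult_distrib)
  then have "m \<in> core_region v" using radii by (simp add: core_region_def m)
  then show thesis using that sv(1) by blast
qed

end

section \<open>Surgery\<close>

lemma surface_parametrization_restrict:
  assumes par: "surface_parametrization X A S V \<psi>"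
    and O': "openin X O'" "S \<inter> O' = S' \<inter> O'"
  shows "surface_parametrization X A S' {z \<in> V. \<psi> z \<in> O'} \<psi>"
proof -
  let ?V = "{z \<in> V. \<psi> z \<in> O'}"
  have p: "open V" "\<psi> ` V \<subseteq> S" "openin (subtopology X S) (\<psi> ` V)"
    "homeomorphic_map (top_of_set V) (subtopology X (\<psi> ` V)) \<psi>"
    "\<And>U \<phi>. (U, \<phi>) \<in> A \<Longrightarrow> smooth_on (\<phi> \<circ> \<psi>) (V \<inter> \<psi> -` U) \<and>
        (\<forall>x\<in>V \<inter> \<psi> -` U. inj (frechet_derivative (\<phi> \<circ> \<psi>) (at x)))"
    using par by (auto simp: surface_parametrization_def)
  have img: "\<psi> ` ?V = \<psi> ` V \<inter> O'" by auto
  have "continuous_map (top_of_set V) X \<psi>"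
    using homeomorphic_imp_continuous_map[OF p(4)] by (simp add: continuous_map_in_subtopology)
  from openin_continuous_map_preimage[OF this O'(1)]
  have "open ?V" using p(1) openin_open_trans by fastforce
  obtain O1 where O1: "openin X O1" "\<psi> ` V = O1 \<inter> S" using p(3) by (auto simp: openin_subtopology)
  have "\<psi> ` ?V = (O1 \<inter> O') \<inter> S'" using img O1(2) O'(2) by blast
  then have "openin (subtopology X S') (\<psi> ` ?V)"
    using openin_Int[OF O1(1) O'(1)] by (auto simp: openin_subtopology)
  moreover have "\<psi> ` ?V \<subseteq> S'" using calculation openin_subset by fastforce
  moreover have "homeomorphic_map (top_of_set ?V) (subtopology X (\<psi> ` ?V)) \<psi>"
  proof -
    have "\<psi> ` V \<subseteq> topspace X" using O1 openin_subset by blast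
    then have "\<psi> ` (topspace (top_of_set V) \<inter> ?V) = topspace (subtopology X (\<psi> ` V)) \<inter> \<psi> ` ?V"
      by auto
    from homeomorphic_map_subtopologies[OF p(4) this]
    have "homeomorphic_map (subtopology (top_of_set V) ?V) (subtopology (subtopology X (\<psi> ` V)) (\<psi> ` ?V)) \<psi>" .
    moreover have "V \<inter> ?V = ?V" "\<psi> ` V \<inter> \<psi> ` ?V = \<psi> ` ?V" by auto
    ultimately show ?thesis by (simp add: subtopology_subtopology)
  qed
  moreover have "smooth_on (\<phi> \<circ> \<psi>) (?V \<inter> \<psi> -` U) \<and>
      (\<forall>x\<in>?V \<inter> \<psi> -` U. inj (frechet_derivative (\<phi> \<circ> \<psi>) (at x)))" if "(U, \<phi>) \<in> A" for U \<phi>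
    using p(5)[OF that] smooth_on_subset[of "\<phi> \<circ> \<psi>" "V \<inter> \<psi> -` U" "?V \<inter> \<psi> -` U"] by blast
  ultimately show ?thesis
    using \<open>open ?V\<close> unfolding surface_parametrization_def by (intro conjI) (simp_all only: split_paired_all prod.case Ball_def, blast+)
qed

text \<open>The tangent space at a point depends only on the surface near that point.\<close>

lemma complex_point_local:
  assumes X: "complex_surface X A" and O': "openin X O'" "p \<in> O'" "S \<inter> O' = S' \<inter> O'"
    and cp: "complex_point X A S' p"
  shows "complex_point X A S p"
proof -
  obtain U \<phi> where c: "p \<in> S'" "(U, \<phi>) \<in> A" "p \<in> U"
      "complex_structure ` tangent_space_in (U, \<phi>) S' p = tangent_space_in (U, \<phi>) S' p"
    using cp by (auto simp: complex_point_def)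
  have ch: "is_chart X (U, \<phi>)" using X c(2) by (auto simp: complex_surface_def)
  have "tangent_space_in (U, \<phi>) S p = tangent_space_in (U, \<phi>) S' p"
    using tangent_space_in_local[OF ch O'(1,2) _ c(3)] O'(3) by blast
  then show ?thesis
    unfolding complex_point_def using c O' by (metis IntD1 IntI fst_conv)
qed

lemma scaled_disc_image:
  assumes "R > 0"
  shows "(\<lambda>z. complex_of_real R * z) ` {z. Q (R * norm z)} = {\<xi>. Q (norm \<xi>)}"
proof
  show "{\<xi>. Q (norm \<xi>)} \<subseteq> (\<lambda>z. complex_of_real R * z) ` {z. Q (R * norm z)}"
  proof
    fix \<xi> :: complex assume "\<xi> \<in> {\<xi>. Q (norm \<xi>)}"
    then show "\<xi> \<in> (\<lambda>z. complex_of_real R * z) ` {z. Q (R * norm z)}"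
      using assms by (intro image_eqI[of _ _ "\<xi> / of_real R"]) (auto simp: norm_divide)
  qed
qed (use assms in \<open>auto simp: norm_mult\<close>)

text \<open>The coordinate disc over \<open>|\<xi>| < R\<close> is removed and the completed graph of the modified function is joined. Three kinds of
  points are then to be parametrized: those of the modified graph off \<open>\<xi> = 0\<close>, those of the core circle, and
  those outside the chart neighbourhood \<open>W\<close>, where old and new surface agree.\<close>

theorem proposition4:
  fixes X :: "'a topology" and A :: "'a chart set" and S :: "'a set" and \<gamma> :: 'a
  assumes "complex_surface X A"
    and "embedded_real_surface X A S"
    and "{p. complex_point X A S p} = {\<gamma>}"
    and "hyperbolic_complex_point X A S \<gamma>"
  shows "\<exists>S'. cross_cap_surgery X A S \<gamma> S' \<and>
              embedded_real_surface X A S' \<and> totally_real X A S'"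
proof -
  obtain U \<phi> W r F where chart: "holomorphic_chart X A (U, \<phi>)"
    and W: "openin X W" "\<gamma> \<in> W" "W \<subseteq> U" and \<gamma>0: "fst (\<phi> \<gamma>) = 0"
    and F: "r > 0" "smooth_on F (ball 0 r)" "\<phi> ` (S \<inter> W) = (\<lambda>\<xi>. (\<xi>, F \<xi>)) ` ball 0 r"
      "\<And>\<xi>. \<xi> \<in> ball 0 r - {0} \<Longrightarrow> dbar F \<xi> \<noteq> 0"
      "\<forall>\<^sub>F \<rho> in at_right 0. winding_number (dbar F \<circ> circlepath 0 \<rho>) 0 = -1"
    using assms(4) unfolding hyperbolic_complex_point_def complex_point_has_index_def by auto
  have "\<gamma> \<in> S" using assms(3) by (auto simp: complex_point_def)
  interpret holomorphic_coordinates X A U \<phi> using assms(1) chart by unfold_locales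
  have X: "Hausdorff_space X" using assms(1) by (simp add: complex_surface_def)
  have point_image: "point ` \<phi> ` B = B" if "B \<subseteq> U" for B
    using that point_\<phi> by (force simp: image_image)
  have "U \<inter> W = W" using W(3) by blast
  then have openW: "open (\<phi> ` W)" using is_chart_open_image[OF is_chart W(1)] by simp
  have "(0, F 0) \<in> \<phi> ` (S \<inter> W)" unfolding F(3) using F(1) by auto
  then have "(0, F 0) \<in> \<phi> ` W" by blast
  then obtain A1 A2 where A12: "open A1" "open A2" "(0, F 0) \<in> A1 \<times> A2" "A1 \<times> A2 \<subseteq> \<phi> ` W"
    using open_prod_elim[OF openW] by metis
  obtain e1 where e1: "e1 > 0" "ball 0 e1 \<subseteq> A1" using A12 open_contains_ball by (metis mem_Sigma_iff)
  obtain e2 where e2: "e2 > 0" "ball (F 0) e2 \<subseteq> A2" using A12 open_contains_ball by (metis mem_Sigma_iff)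
  define e where "e = min e1 e2"
  have e: "e > 0" using e1 e2 by (simp add: e_def)
  have box: "(\<xi>, \<eta>) \<in> \<phi> ` W" if "norm \<xi> < e" "norm (\<eta> - F 0) < e" for \<xi> \<eta>
    using that e1(2) e2(2) A12(4) by (auto simp: e_def dist_norm norm_minus_commute subset_iff)
  obtain g R \<delta> \<epsilon> where g: "0 < \<delta>" "\<delta> < R" "R < r" "R < e" "0 < \<epsilon>" "\<epsilon> < e"
    "smooth_on g (ball 0 r - {0})"
    "\<And>\<xi>. \<xi> \<in> ball 0 r - {0} \<Longrightarrow> dbar g \<xi> \<noteq> 0"
    "\<And>\<xi>. R \<le> norm \<xi> \<Longrightarrow> g \<xi> = F \<xi>"
    "\<And>\<xi>. norm \<xi> < \<delta> \<Longrightarrow> g \<xi> = F 0 + of_real \<epsilon> * (cnj \<xi> * inverse \<xi>)"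
    "\<And>\<xi>. \<xi> \<noteq> 0 \<Longrightarrow> norm \<xi> \<le> R \<Longrightarrow> norm (g \<xi> - F 0) < e"
    by (rule hyperbolic_modification[OF F(1,2,4,5) e]) (assumption, (rule that; assumption))
  have R: "0 < R" using g(1,2) by simp
  interpret M: moebius_graph g "F 0" r R \<delta> \<epsilon>
    using g by unfold_locales auto
  define gr where "gr B = (\<lambda>\<xi>. (\<xi>, F \<xi>)) ` B" for B
  have gr_W: "gr B \<subseteq> \<phi> ` W" if "B \<subseteq> ball 0 r" for B
  proof -
    have "gr B \<subseteq> \<phi> ` (S \<inter> W)" unfolding F(3) gr_def using that by blast
    then show ?thesis by blast
  qed
  have M_W: "M.moebius (cball 0 R) \<subseteq> \<phi> ` W"
    using box g by (auto simp: M.moebius_def split: if_splits)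
  have M_split: "M.moebius (ball 0 r) = M.moebius (cball 0 R) \<union> gr {\<xi>. R \<le> norm \<xi> \<and> norm \<xi> < r}"
    using g(9) R g(3) by (auto simp: M.moebius_def gr_def split: if_splits)
  have Mr_W: "M.moebius (ball 0 r) \<subseteq> \<phi> ` W"
  proof -
    have "{\<xi>. R \<le> norm \<xi> \<and> norm \<xi> < r} \<subseteq> ball 0 r" by auto
    then show ?thesis unfolding M_split using M_W gr_W by blast
  qed
  have WU: "\<phi> ` W \<subseteq> \<phi> ` U" using W(3) by blast
  have point_W: "point m \<in> W" if "m \<in> \<phi> ` W" for m
    using that W(3) point_\<phi> by auto
  have SW: "S \<inter> W = point ` gr (ball 0 r)"
    using point_image[of "S \<inter> W"] W(3) F(3) by (auto simp: gr_def)

  \<comment> \<open>The disc that is removed is the part of the graph over \<open>norm \<xi> < R\<close>.\<close>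
  let ?P0 = "\<lambda>z::complex. (of_real R * z, F (of_real R * z))"
  have P0_image: "(\<lambda>z. point (?P0 z)) ` {z. Q (R * norm z)} = point ` gr {\<xi>. Q (norm \<xi>)}" for Q
    unfolding gr_def scaled_disc_image[OF R, of Q, symmetric] by (simp add: image_image)
  have P0_smooth: "smooth_on ?P0 (ball 0 (r/R))"
  proof (intro smooth_on_Pair open_ball)
    show lin: "smooth_on (\<lambda>z::complex. of_real R * z) (ball 0 (r/R))"
      by (rule smooth_on_linear[OF bounded_linear_mult_right open_ball])
    show "smooth_on (\<lambda>z. F (of_real R * z)) (ball 0 (r/R))"
      by (rule smooth_on_compose[OF _ open_ball F(2) lin]) (use R in \<open>auto simp: norm_mult field_simps\<close>)
  qed
  have V0_eq: "ball 0 (r/R) = {z::complex. R * norm z < r}" using R by (auto simp: field_simps)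
  interpret D: coordinate_piece X A U \<phi> S "ball 0 (r/R)" ?P0 "\<lambda>m. fst m / of_real R"
  proof unfold_locales
    show "?P0 ` ball 0 (r/R) \<subseteq> \<phi> ` U"
    proof (rule image_subsetI)
      fix z :: complex assume "z \<in> ball 0 (r/R)"
      then have "of_real R * z \<in> ball 0 r" using R unfolding V0_eq by (simp add: norm_mult)
      then have "?P0 z \<in> gr (ball 0 r)" unfolding gr_def by blast
      then show "?P0 z \<in> \<phi> ` U" using gr_W[of "ball 0 r"] WU by blast
    qed
    have "(\<lambda>z. point (?P0 z)) ` ball 0 (r/R) = S \<inter> W"
      unfolding V0_eq P0_image[of "\<lambda>t. t < r"] SW by (simp add: ball_def)
    then show "openin (subtopology X S) ((\<lambda>z. point (?P0 z)) ` ball 0 (r/R))"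
      using W(1) by (auto simp: openin_subtopology)
  qed (use P0_smooth R in \<open>auto intro!: continuous_intros\<close>)
  have par0: "surface_parametrization X A S (ball 0 (r/R)) (\<lambda>z. point (?P0 z))"
  proof (rule D.surface_parametrization_\<psi>)
    fix z assume z: "z \<in> ball (0::complex) (r/R)"
    let ?L = "frechet_derivative ?P0 (at z)"
    have "((\<lambda>z. fst (?P0 z)) has_derivative (\<lambda>h. fst (?L h))) (at z)"
      by (rule has_derivative_fst[OF smooth_on_imp_has_derivative[OF P0_smooth z]])
    moreover have "((\<lambda>z. fst (?P0 z)) has_derivative (\<lambda>h. of_real R * h)) (at z)"
      by (auto intro!: derivative_eq_intros)
    ultimately have "(\<lambda>h. fst (?L h)) = (\<lambda>h. of_real R * h)" by (rule has_derivative_unique)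
    then have L: "fst (?L h) = of_real R * h" for h by (rule fun_cong)
    show "inj ?L"
    proof (rule injI)
      fix a b assume "?L a = ?L b"
      then have "fst (?L a) = fst (?L b)" by (rule arg_cong)
      then have "of_real R * a = of_real R * b" by (rule box_equals[OF _ L L])
      then show "a = b" using R by simp
    qed
  qed
  have disc: "(\<lambda>z. point (?P0 z)) ` ball 0 1 = point ` gr (ball 0 R)"
    "(\<lambda>z. point (?P0 z)) ` cball 0 1 = point ` gr (cball 0 R)"
    "(\<lambda>z. point (?P0 z)) ` sphere 0 1 = point ` gr (sphere 0 R)"
    using P0_image[of "\<lambda>t. t < R"] P0_image[of "\<lambda>t. t \<le> R"] P0_image[of "\<lambda>t. t = R"] R
    by (simp_all add: ball_def cball_def sphere_def)

  \<comment> \<open>Along the circle of radius \<open>R\<close> the functions \<open>g\<close> and \<open>F\<close> agree, so the boundary of the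
      cross-cap is the boundary of the removed disc.\<close>
  define C where "C = point ` M.moebius (cball 0 R)"
  let ?H = "\<lambda>x. point (M.band_map x)"
  have H_image: "?H ` cap_band = C"
    unfolding C_def M.band_map_image[symmetric] by (simp add: image_image)
  have H_boundary: "?H ` {x \<in> cap_band. x $ 3 = 1/2} = point ` gr (sphere 0 R)"
  proof -
    have "(\<lambda>\<xi>. (\<xi>, g \<xi>)) ` sphere 0 R = gr (sphere 0 R)"
      unfolding gr_def using g(9) by (intro image_cong) auto
    then have "point ` M.band_map ` {x \<in> cap_band. x $ 3 = 1/2} = point ` gr (sphere 0 R)"
      using M.band_map_boundary by simp
    then show ?thesis by (simp only: image_image)
  qed
  have MU: "M.moebius (cball 0 R) \<subseteq> \<phi> ` U" using M_W WU by blast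
  have "continuous_map (top_of_set cap_band) (top_of_set (M.moebius (cball 0 R))) M.band_map"
    using M.continuous_on_band_map M.band_map_image by auto
  from continuous_map_compose[OF this continuous_map_point[OF MU]]
  have contH: "continuous_map (top_of_set cap_band) X ?H" by (simp add: o_def)
  have injH: "y = x \<or> y = - x" if "x \<in> cap_band" "y \<in> cap_band" "?H x = ?H y" for x y
  proof -
    have "M.band_map x \<in> \<phi> ` U" "M.band_map y \<in> \<phi> ` U"
      using that M.band_map_image MU by blast+
    then show ?thesis using that point_inj M.band_map_inj by blast
  qed
  have evenH: "?H (- x) = ?H x" for x by (simp only: M.band_map_minus)
  note cap = cross_cap_from_even_map[OF X contH evenH injH, unfolded H_image H_boundary]
  have C_compact: "compactin X C" by (rule cap(1))
  have C_cap: "cross_cap X C (point ` gr (sphere 0 R))" by (rule cap(2))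
  have CW: "C \<subseteq> W" unfolding C_def using M_W point_W by blast

  define S' where "S' = (S - point ` gr (ball 0 R)) \<union> C"
  have gr_U: "gr B \<subseteq> \<phi> ` U" if "B \<subseteq> ball 0 r" for B using gr_W[OF that] WU by blast
  have C_meets: "C \<inter> (S - point ` gr (ball 0 R)) = point ` gr (sphere 0 R)"
  proof
    show "C \<inter> (S - point ` gr (ball 0 R)) \<subseteq> point ` gr (sphere 0 R)"
    proof
      fix x assume x: "x \<in> C \<inter> (S - point ` gr (ball 0 R))"
      then have "x \<in> point ` gr (ball 0 r)" using CW SW by blast
      then obtain \<xi> where \<xi>: "norm \<xi> < r" "x = point (\<xi>, F \<xi>)" by (auto simp: gr_def)
      obtain m where m: "m \<in> M.moebius (cball 0 R)" "x = point m" using x by (auto simp: C_def)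
      have "(\<xi>, F \<xi>) \<in> \<phi> ` U" using gr_U[of "ball 0 r"] \<xi>(1) by (auto simp: gr_def)
      then have "m = (\<xi>, F \<xi>)" using m \<xi>(2) MU point_inj by blast
      then have "norm \<xi> \<le> R" using m(1) by (auto simp: M.moebius_def)
      moreover have "\<not> norm \<xi> < R" using x \<xi>(2) by (auto simp: gr_def)
      ultimately show "x \<in> point ` gr (sphere 0 R)" using \<xi>(2) by (auto simp: gr_def)
    qed
    show "point ` gr (sphere 0 R) \<subseteq> C \<inter> (S - point ` gr (ball 0 R))"
    proof
      fix x assume "x \<in> point ` gr (sphere 0 R)"
      then obtain \<xi> where \<xi>: "norm \<xi> = R" "x = point (\<xi>, F \<xi>)" by (auto simp: gr_def)
      have "(\<xi>, F \<xi>) \<in> M.moebius (cball 0 R)"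
        using \<xi>(1) R g(9)[of \<xi>] by (auto simp: M.moebius_def)
      then have "x \<in> C" using \<xi>(2) by (simp add: C_def)
      moreover have "x \<in> S" using SW \<xi> g(3) by (auto simp: gr_def)
      moreover have "x \<notin> point ` gr (ball 0 R)"
      proof
        assume "x \<in> point ` gr (ball 0 R)"
        then obtain \<xi>' where \<xi>': "norm \<xi>' < R" "x = point (\<xi>', F \<xi>')" by (auto simp: gr_def)
        have "(\<xi>, F \<xi>) \<in> \<phi> ` U" "(\<xi>', F \<xi>') \<in> \<phi> ` U"
          using gr_U[of "ball 0 r"] \<xi>(1) \<xi>'(1) g(3) by (auto simp: gr_def)
        then have "(\<xi>, F \<xi>) = (\<xi>', F \<xi>')" using \<xi>(2) \<xi>'(2) point_inj by metis
        then show False using \<xi>(1) \<xi>'(1) by simp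
      qed
      ultimately show "x \<in> C \<inter> (S - point ` gr (ball 0 R))" by blast
    qed
  qed
  have \<gamma>_disc: "\<gamma> \<in> point ` gr (ball 0 R)"
  proof -
    have "\<phi> \<gamma> \<in> (\<lambda>\<xi>. (\<xi>, F \<xi>)) ` ball 0 r" using F(3) \<open>\<gamma> \<in> S\<close> W(2) by blast
    then have "\<phi> \<gamma> = (0, F 0)" using \<gamma>0 by auto
    then have "\<gamma> = point (0, F 0)" using point_\<phi> W by (metis subsetD)
    then show ?thesis using R by (auto simp: gr_def)
  qed
  have unit_disc: "cball 0 1 \<subseteq> ball (0::complex) (r/R)"
    using R g(3) by (simp add: cball_subset_ball_iff)
  have surgery: "cross_cap_surgery X A S \<gamma> S'"
    unfolding cross_cap_surgery_def
  proof (intro exI conjI)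
    show "surface_parametrization X A S (ball 0 (r/R)) (\<lambda>z. point (?P0 z))" by (rule par0)
    show "cball 0 1 \<subseteq> ball (0::complex) (r/R)" by (rule unit_disc)
    show "\<gamma> \<in> (\<lambda>z. point (?P0 z)) ` ball 0 1" unfolding disc(1) by (rule \<gamma>_disc)
    show "cross_cap X C ((\<lambda>z. point (?P0 z)) ` sphere 0 1)" unfolding disc(3) by (rule C_cap)
    show "C \<inter> (S - (\<lambda>z. point (?P0 z)) ` ball 0 1) = (\<lambda>z. point (?P0 z)) ` sphere 0 1"
      unfolding disc by (rule C_meets)
    show "S' = (S - (\<lambda>z. point (?P0 z)) ` ball 0 1) \<union> C"
      unfolding disc by (rule S'_def)
  qed

  \<comment> \<open>Since \<open>g\<close> continues as \<open>F\<close> beyond radius \<open>R\<close>, the cross-cap and the rest of \<open>S\<close> in \<open>W\<close> form one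
      Moebius band over the whole disc; no seam has to be considered at radius \<open>R\<close>.\<close>
  have S'W: "S' \<inter> W = point ` M.moebius (ball 0 r)"
  proof
    show "S' \<inter> W \<subseteq> point ` M.moebius (ball 0 r)"
    proof
      fix x assume x: "x \<in> S' \<inter> W"
      show "x \<in> point ` M.moebius (ball 0 r)"
      proof (cases "x \<in> C")
        case True
        then show ?thesis unfolding C_def M_split by blast
      next
        case False
        then have "x \<in> S" "x \<notin> point ` gr (ball 0 R)" using x by (auto simp: S'_def)
        then have "x \<in> point ` gr (ball 0 r)" using SW x by blast
        then obtain \<xi> where \<xi>: "norm \<xi> < r" "x = point (\<xi>, F \<xi>)" by (auto simp: gr_def)
        then have "\<not> norm \<xi> < R" using \<open>x \<notin> point ` gr (ball 0 R)\<close> by (auto simp: gr_def)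
        then have "(\<xi>, F \<xi>) \<in> gr {\<xi>. R \<le> norm \<xi> \<and> norm \<xi> < r}" using \<xi>(1) by (auto simp: gr_def)
        then show ?thesis unfolding M_split using \<xi>(2) by blast
      qed
    qed
    show "point ` M.moebius (ball 0 r) \<subseteq> S' \<inter> W"
    proof
      fix x assume "x \<in> point ` M.moebius (ball 0 r)"
      then obtain m where m: "m \<in> M.moebius (ball 0 r)" "x = point m" by blast
      have xW: "x \<in> W" using m Mr_W point_W by blast
      show "x \<in> S' \<inter> W"
      proof (cases "m \<in> M.moebius (cball 0 R)")
        case True
        then show ?thesis using xW m(2) by (auto simp: S'_def C_def)
      next
        case False
        then obtain \<xi> where \<xi>: "m = (\<xi>, F \<xi>)" "R \<le> norm \<xi>" "norm \<xi> < r"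
          using m(1) unfolding M_split by (auto simp: gr_def)
        have "x \<in> S" using SW m(2) \<xi> by (auto simp: gr_def)
        moreover have "x \<notin> point ` gr (ball 0 R)"
        proof
          assume "x \<in> point ` gr (ball 0 R)"
          then obtain \<xi>' where \<xi>': "norm \<xi>' < R" "x = point (\<xi>', F \<xi>')" by (auto simp: gr_def)
          have "(\<xi>, F \<xi>) \<in> \<phi> ` U" "(\<xi>', F \<xi>') \<in> \<phi> ` U"
            using gr_U[of "ball 0 r"] \<xi>(3) \<xi>'(1) g(3) by (auto simp: gr_def)
          then have "(\<xi>, F \<xi>) = (\<xi>', F \<xi>')" using \<xi>(1) m(2) \<xi>'(2) point_inj by metis
          then show False using \<xi>(2) \<xi>'(1) by simp
        qed
        ultimately show ?thesis using xW by (auto simp: S'_def)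
      qed
    qed
  qed
  have open_piece: "openin (subtopology X S') (point ` (M.moebius (ball 0 r) \<inter> \<Omega>))" if "open \<Omega>" for \<Omega>
  proof -
    have "point ` (M.moebius (ball 0 r) \<inter> \<Omega>) = (W \<inter> (U \<inter> \<phi> -` \<Omega>)) \<inter> S'"
    proof
      show "point ` (M.moebius (ball 0 r) \<inter> \<Omega>) \<subseteq> (W \<inter> (U \<inter> \<phi> -` \<Omega>)) \<inter> S'"
      proof (rule image_subsetI)
        fix m assume m: "m \<in> M.moebius (ball 0 r) \<inter> \<Omega>"
        then have "m \<in> \<phi> ` U" "point m \<in> S' \<inter> W" using Mr_W WU S'W by blast+
        then show "point m \<in> (W \<inter> (U \<inter> \<phi> -` \<Omega>)) \<inter> S'"
          using m \<phi>_point point_in_U by simp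
      qed
      show "(W \<inter> (U \<inter> \<phi> -` \<Omega>)) \<inter> S' \<subseteq> point ` (M.moebius (ball 0 r) \<inter> \<Omega>)"
      proof
        fix x assume x: "x \<in> (W \<inter> (U \<inter> \<phi> -` \<Omega>)) \<inter> S'"
        then obtain m where m: "m \<in> M.moebius (ball 0 r)" "x = point m" using S'W by blast
        then have "\<phi> x = m" using Mr_W WU \<phi>_point by blast
        then show "x \<in> point ` (M.moebius (ball 0 r) \<inter> \<Omega>)" using x m by blast
      qed
    qed
    moreover have "openin X (W \<inter> (U \<inter> \<phi> -` \<Omega>))"
      using W(1) openin_coordinates[OF that] by (rule openin_Int)
    ultimately show ?thesis by (auto simp: openin_subtopology)
  qed
  have MrU: "M.moebius (ball 0 r) \<subseteq> \<phi> ` U" using Mr_W WU by blast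
  have graph_image: "M.graph_param ` (ball 0 r - {0}) = M.moebius (ball 0 r) \<inter> {m. fst m \<noteq> 0}"
    by (auto simp: M.graph_param_def M.moebius_def)
  interpret G: coordinate_piece X A U \<phi> S' "ball 0 r - {0}" M.graph_param fst
  proof unfold_locales
    show "M.graph_param ` (ball 0 r - {0}) \<subseteq> \<phi> ` U" unfolding graph_image using MrU by blast
    have "open {m :: complex \<times> complex. fst m \<noteq> 0}"
      by (intro open_Collect_neq continuous_intros)
    from open_piece[OF this]
    show "openin (subtopology X S') ((\<lambda>z. point (M.graph_param z)) ` (ball 0 r - {0}))"
      unfolding graph_image[symmetric] by (simp add: image_image)
  qed (auto simp: M.graph_param_smooth M.graph_param_def open_punctured_ball intro!: continuous_intros)
  have core: "coordinate_piece X A U \<phi> S' M.core_domain (M.core_param u) (M.core_inverse u)"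
    if u: "norm u = 1" for u
  proof unfold_locales
    show "M.core_param u ` M.core_domain \<subseteq> \<phi> ` U" unfolding M.core_param_image[OF u] using MrU by blast
    from open_piece[OF M.core_region_open[of u]]
    show "openin (subtopology X S') ((\<lambda>z. point (M.core_param u z)) ` M.core_domain)"
      unfolding M.core_param_image[OF u, symmetric] by (simp add: image_image)
  qed (use M.core_domain_open M.core_param_smooth M.continuous_on_core_inverse[OF u]
      M.core_inverse_param[OF u] in auto)
  have in_W: "(\<exists>V \<psi>. surface_parametrization X A S' V \<psi> \<and> p \<in> \<psi> ` V) \<and> \<not> complex_point X A S' p"
    if "p \<in> S'" "p \<in> W" for p
  proof -
    have "p \<in> point ` M.moebius (ball 0 r)" unfolding S'W[symmetric] using that by (rule IntI)
    then obtain m where m: "m \<in> M.moebius (ball 0 r)" "p = point m" by blast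
    show ?thesis
    proof (cases "fst m = 0")
      case False
      then have "m \<in> M.graph_param ` (ball 0 r - {0})" unfolding graph_image using m(1) by blast
      then obtain z where z: "z \<in> ball 0 r - {0}" "p = point (M.graph_param z)" using m(2) by blast
      have "surface_parametrization X A S' (ball 0 r - {0}) (\<lambda>z. point (M.graph_param z))"
        using totally_real_map_imp_inj[OF _ M.graph_param_totally_real]
          has_derivative_linear[OF smooth_on_imp_has_derivative[OF M.graph_param_smooth]]
        by (intro G.surface_parametrization_\<psi>) blast
      moreover have "\<not> complex_point X A S' p"
        unfolding z(2) by (rule G.not_complex_point[OF z(1) M.graph_param_totally_real[OF z(1)]])
      ultimately show ?thesis using z by blast
    next
      case True
      obtain u where u: "norm u = 1" "m \<in> M.core_region u" using M.core_region_covers[OF m(1) True] by blast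
      interpret E: coordinate_piece X A U \<phi> S' M.core_domain "M.core_param u" "M.core_inverse u"
        by (rule core[OF u(1)])
      have "m \<in> M.core_param u ` M.core_domain" unfolding M.core_param_image[OF u(1)] using m(1) u(2) by blast
      then obtain z where z: "z \<in> M.core_domain" "p = point (M.core_param u z)" using m(2) by blast
      have "surface_parametrization X A S' M.core_domain (\<lambda>z. point (M.core_param u z))"
        using totally_real_map_imp_inj[OF _ M.core_param_totally_real[OF u(1)]]
          has_derivative_linear[OF smooth_on_imp_has_derivative[OF M.core_param_smooth]]
        by (intro E.surface_parametrization_\<psi>) blast
      moreover have "\<not> complex_point X A S' p"
        unfolding z(2) by (rule E.not_complex_point[OF z(1) M.core_param_totally_real[OF u(1)]])
      ultimately show ?thesis using z by blast
    qed
  qed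

  \<comment> \<open>Disc and cross-cap are compact, hence closed in \<open>X\<close>, and off them the surface has not changed.\<close>
  define O' where "O' = topspace X - (C \<union> point ` gr (cball 0 R))"
  have "compactin X (point ` gr (cball 0 R))"
  proof -
    have "continuous_map (top_of_set (cball 0 1)) X (\<lambda>z. point (?P0 z))"
    proof -
      have "continuous_map (top_of_set (ball 0 (r/R))) X (\<lambda>z. point (?P0 z))"
        using D.homeomorphic_maps_\<psi> by (simp add: homeomorphic_maps_def continuous_map_in_subtopology)
      then show ?thesis
        by (rule continuous_map_from_subtopology_mono[OF _ unit_disc])
    qed
    from image_compactin[OF _ this, of "cball 0 1"] show ?thesis
      unfolding disc(2) by (simp add: compactin_subtopology)
  qed
  then have "closedin X (C \<union> point ` gr (cball 0 R))"
    using C_compact compactin_imp_closedin[OF X] by (intro closedin_Un) auto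
  then have O': "openin X O'" by (simp add: O'_def closedin_def)
  have "gr (ball 0 R) \<subseteq> gr (cball 0 R)" by (auto simp: gr_def)
  then have agree: "S \<inter> O' = S' \<inter> O'" by (auto simp: S'_def O'_def)
  have disc_W: "point ` gr (cball 0 R) \<subseteq> W"
    using gr_W[of "cball 0 R"] point_W g(3) by (auto simp: subset_iff)
  have S'_sub: "S' \<subseteq> topspace X"
    using assms(2) compactin_subset_topspace[OF C_compact] by (auto simp: S'_def embedded_real_surface_def)
  have not_W: "(\<exists>V \<psi>. surface_parametrization X A S' V \<psi> \<and> p \<in> \<psi> ` V) \<and> \<not> complex_point X A S' p"
    if "p \<in> S'" "p \<notin> W" for p
  proof
    have pO: "p \<in> O'" using that CW disc_W S'_sub by (auto simp: O'_def)
    then have "p \<in> S" using agree that(1) by blast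
    then obtain V \<psi> where par: "surface_parametrization X A S V \<psi>" "p \<in> \<psi> ` V"
      using assms(2) by (auto simp: embedded_real_surface_def)
    then have "p \<in> \<psi> ` {z \<in> V. \<psi> z \<in> O'}" using pO by blast
    then show "\<exists>V \<psi>. surface_parametrization X A S' V \<psi> \<and> p \<in> \<psi> ` V"
      using surface_parametrization_restrict[OF par(1) O' agree] by blast
    show "\<not> complex_point X A S' p"
    proof
      assume "complex_point X A S' p"
      then have "complex_point X A S p" by (rule complex_point_local[OF assms(1) O' pO agree])
      then have "p = \<gamma>" using assms(3) by blast
      then show False using that(2) W(2) by simp
    qed
  qed
  have "embedded_real_surface X A S'"
    unfolding embedded_real_surface_def using S'_sub in_W not_W by blast
  moreover have "totally_real X A S'"
    unfolding totally_real_def using in_W not_W by (metis complex_point_def)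
  ultimately show ?thesis using surgery by blast
qed

end
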